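(* Let $G=(V,E)$ be a finite connected loopless multigraph and $\alpha'>0$. Let $S\subseteq V$ be nonempty such that $G[S]$ is a tree, and let $K_1,\ldots,K_r$ be the connected components of the graph induced on $V\setminus S$. For each edge $e\in E(G[S])$ let $D_e$ and $S\setminus D_e$ be the vertex sets of the two components of $G[S]$ with $e$ deleted. Then on $X_S=0$ the internal block is $$\mathcal C_S(\alpha')=\prod_{e\in E(G[S])}\frac{\alpha'}{2}B\Big(\frac{\alpha'}{2}X_{D_e},\frac{\alpha'}{2}X_{S\setminus D_e}\Big)\bigg|_{X_S=0},$$ and consequently $$\operatorname*{Res}_{X_S=0}\mathcal I_G^{\mathrm{zono}}(\alpha')=2\Big(\prod_{j=1}^r\mathcal J_{K_j}^{S}(\alpha')\Big)\prod_{e\in E(G[S])}\frac{\alpha'}{2}B\Big(\frac{\alpha'}{2}X_{D_e},\frac{\alpha'}{2}X_{S\setminus D_e}\Big)\bigg|_{X_S=0}.$$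
   Context: Loopless means no self-loops; cycles and parallel edges are allowed in $G$. $B$ is the Euler beta function. The energies are $x_v$ ($v\in V$) and $y_e$ ($e\in E$). For $x_v,y_e>0$, $$\mathcal I_G^{\mathrm{zono}}(\alpha')=(\alpha')^{|V|}\int_{\mathbb R^{V}}\prod_{v\in V}\mathrm d\tau_v\prod_{v\in V}(2\cosh\tau_v)^{-\alpha' x_v}\prod_{e=uv\in E}(2\cosh(\tau_u-\tau_v))^{-\alpha' y_e},$$ and it is then continued meromorphically in $(x,y)$. For $A\subseteq V$ let $\partial_G(A)$ be the set of edges of $G$ with exactly one endpoint in $A$, and $X_A=\sum_{v\in A}x_v+\sum_{e\in\partial_G(A)}y_e$. The residue at the simple pole $X_S=0$ is the restriction of $X_S\,\mathcal I_G^{\mathrm{zono}}(\alpha')$ to $X_S=0$. For every vertex $v\in V$ put $\eta_v^S=\sum_{e}y_e$, the sum over edges $e\in\partial_G(S)$ incident to $v$. The shifted component blocks are $$\mathcal J_{K_j}^{S}(\alpha')=(\alpha')^{|V(K_j)|}\int_{\mathbb R^{V(K_j)}}\prod_{v\in V(K_j)}\mathrm d\tau_v\prod_{v\in V(K_j)}(2\cosh\tau_v)^{-\alpha' x_v}\prod_{e=uv\in E(K_j)}(2\cosh(\tau_u-\tau_v))^{-\alpha' y_e}\exp\Big[\alpha'\sum_{v\in V(K_j)}\eta_v^S\tau_v\Big].$$ For a reference vertex $a_\star\in S$, with $\tau_{a_\star}:=0$, the internal block is $$\mathcal C_S(\alpha')=(\alpha')^{|S|-1}\int_{\mathbb R^{S\setminus\{a_\star\}}}\prod_{v\in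 S\setminus\{a_\star\}}\mathrm d\tau_v\,\exp\Big[-\alpha'\sum_{v\in S}(x_v+\eta_v^S)\tau_v\Big]\prod_{e=uv\in E(G[S])}(2\cosh(\tau_u-\tau_v))^{-\alpha' y_e},$$ evaluated on $X_S=0$. All integrals are understood by meromorphic continuation in the energies; empty products equal $1$. *)

theory Defs
  imports "HOL-Analysis.Analysis"
begin

section \<open>Undirected multigraphs\<close>

record ('v, 'e) multigraph =
  verts :: "'v set"
  edges :: "'e set"
  ends :: "'e \<Rightarrow> 'v set"

definition loopless_multigraph :: "('v, 'e) multigraph \<Rightarrow> bool" where
  "loopless_multigraph G \<longleftrightarrow> finite (verts G) \<and> finite (edges G) \<and>
     (\<forall>e\<in>edges G. ends G e \<subseteq> verts G \<and> card (ends G e) = 2)"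

definition induced :: "('v, 'e) multigraph \<Rightarrow> 'v set \<Rightarrow> ('v, 'e) multigraph" where
  "induced G A = G\<lparr>verts := A, edges := {e \<in> edges G. ends G e \<subseteq> A}\<rparr>"

definition delete_edge :: "('v, 'e) multigraph \<Rightarrow> 'e \<Rightarrow> ('v, 'e) multigraph" where
  "delete_edge G e = G\<lparr>edges := edges G - {e}\<rparr>"

definition adj :: "('v, 'e) multigraph \<Rightarrow> 'v rel" where
  "adj G = {(u, v). \<exists>e\<in>edges G. ends G e = {u, v}}"

definition connected_graph :: "('v, 'e) multigraph \<Rightarrow> bool" where
  "connected_graph G \<longleftrightarrow> verts G \<noteq> {} \<and> (\<forall>u\<in>verts G. \<forall>v\<in>verts G. (u, v) \<in> (adj G)\<^sup>*)"

text \<open>Connected components are represented by their vertex sets.\<close>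

definition conn_components :: "('v, 'e) multigraph \<Rightarrow> 'v set set" where
  "conn_components G = {(adj G)\<^sup>* `` {u} | u. u \<in> verts G}"

text \<open>Two parallel edges form a cycle of length 2.\<close>

definition is_cycle :: "('v, 'e) multigraph \<Rightarrow> 'v list \<Rightarrow> 'e list \<Rightarrow> bool" where
  "is_cycle G vs es \<longleftrightarrow>
     length vs = length es \<and> es \<noteq> [] \<and> distinct vs \<and> distinct es \<and>
     set vs \<subseteq> verts G \<and> set es \<subseteq> edges G \<and>
     (\<forall>i<length es. ends G (es ! i) = {vs ! i, vs ! (Suc i mod length es)})"

definition is_tree :: "('v, 'e) multigraph \<Rightarrow> bool" where
  "is_tree G \<longleftrightarrow> connected_graph G \<and> (\<nexists>vs es. is_cycle G vs es)"

definition edge_boundary :: "('v, 'e) multigraph \<Rightarrow> 'v set \<Rightarrow> 'e set" where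
  "edge_boundary G A = {e \<in> edges G. card (ends G e \<inter> A) = 1}"


section \<open>Meromorphic functions of several complex variables\<close>

definition holo_on :: "(complex ^ 'n \<Rightarrow> complex) \<Rightarrow> (complex ^ 'n) set \<Rightarrow> bool" where
  "holo_on f U \<longleftrightarrow>
     (\<forall>z\<in>U. \<exists>c :: complex ^ 'n. (f has_derivative (\<lambda>h. \<Sum>i\<in>UNIV. c $ i * h $ i)) (at z))"

text \<open>
  Meromorphic functions on a complex linear subspace \<open>H\<close>: locally quotients \<open>g / h\<close> of holomorphic
  functions, where \<open>h\<close> does not vanish identically on any nonempty relatively open subset of its
  domain in \<open>H\<close>. Holomorphic functions on \<open>H\<close> are locally restrictions of holomorphic functions of
  the ambient space. As for \<open>meromorphic_on\<close> in one variable, values on the exceptional set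
  \<open>h = 0\<close> are arbitrary.
\<close>

definition mero_on :: "(complex ^ 'n \<Rightarrow> complex) \<Rightarrow> (complex ^ 'n) set \<Rightarrow> bool" where
  "mero_on M H \<longleftrightarrow>
     (\<forall>p\<in>H. \<exists>W g h. open W \<and> p \<in> W \<and> holo_on g W \<and> holo_on h W \<and>
        W \<inter> H \<subseteq> closure {z \<in> W \<inter> H. h z \<noteq> 0} \<and>
        (\<forall>z \<in> W \<inter> H. h z \<noteq> 0 \<longrightarrow> M z = g z / h z))"

text \<open>\<open>M\<close> continues \<open>f\<close>, given on \<open>D\<close>, to a meromorphic function on the subspace \<open>H\<close>.\<close>

definition mero_continuation ::
  "(complex ^ 'n) set \<Rightarrow> (complex ^ 'n) set \<Rightarrow> (complex ^ 'n \<Rightarrow> complex) \<Rightarrow>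
    (complex ^ 'n \<Rightarrow> complex) \<Rightarrow> bool" where
  "mero_continuation H D f M \<longleftrightarrow> mero_on M H \<and> (\<forall>z\<in>D. M z = f z)"

text \<open>
  The value of a meromorphic function at a point where it is holomorphic, independent of the
  arbitrary values on exceptional sets (the analogue of \<open>remove_sings\<close>).
\<close>

definition has_mero_value ::
  "(complex ^ 'n \<Rightarrow> complex) \<Rightarrow> complex ^ 'n \<Rightarrow> complex \<Rightarrow> bool" where
  "has_mero_value M p c \<longleftrightarrow>
     (\<exists>W F. open W \<and> p \<in> W \<and> holo_on F W \<and> W \<subseteq> closure (interior {z \<in> W. F z = M z}) \<and> F p = c)"

definition regular_at :: "(complex ^ 'n \<Rightarrow> complex) \<Rightarrow> complex ^ 'n \<Rightarrow> bool" where
  "regular_at M p \<longleftrightarrow> (\<exists>c. has_mero_value M p c)"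

definition mero_value :: "(complex ^ 'n \<Rightarrow> complex) \<Rightarrow> complex ^ 'n \<Rightarrow> complex" where
  "mero_value M p = (THE c. has_mero_value M p c)"

lemma holo_on_imp_continuous_on: "holo_on f U \<Longrightarrow> continuous_on U f"
  unfolding holo_on_def
  by (meson continuous_at_imp_continuous_on has_derivative_continuous)

lemma has_mero_value_unique:
  assumes "has_mero_value M p c" "has_mero_value M p d"
  shows "c = d"
proof -
  obtain W F where F: "open W" "p \<in> W" "holo_on F W"
      "W \<subseteq> closure (interior {z \<in> W. F z = M z})" "F p = c"
    using assms(1) unfolding has_mero_value_def by blast
  obtain V E where E: "open V" "p \<in> V" "holo_on E V"
      "V \<subseteq> closure (interior {z \<in> V. E z = M z})" "E p = d"
    using assms(2) unfolding has_mero_value_def by blast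
  have "continuous_on (W \<inter> V) (\<lambda>z. F z - E z)"
    using F(3) E(3) by (intro continuous_on_diff continuous_on_subset[OF holo_on_imp_continuous_on]) auto
  moreover have "open (W \<inter> V)"
    using F(1) E(1) by blast
  ultimately have op: "open ((\<lambda>z. F z - E z) -` (- {0}) \<inter> (W \<inter> V))"
    using continuous_on_open_vimage by blast
  show ?thesis
  proof (rule ccontr)
    define N where "N = (\<lambda>z. F z - E z) -` (- {0}) \<inter> (W \<inter> V)"
    define A where "A = N \<inter> interior {z \<in> W. F z = M z}"
    assume "c \<noteq> d"
    then have "p \<in> N" using F(2,5) E(2,5) by (auto simp: N_def)
    then have "A \<noteq> {}"
      using F(2,4) op open_Int_closure_eq_empty[of N] unfolding A_def N_def by blast
    moreover have "open A" unfolding A_def N_def using op by blast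
    moreover have "A \<subseteq> closure (interior {z \<in> V. E z = M z})"
      using E(4) unfolding A_def N_def by blast
    ultimately obtain z where "z \<in> A" "z \<in> interior {z \<in> V. E z = M z}"
      using open_Int_closure_eq_empty[of A] by blast
    then have "F z = M z" "E z = M z" "F z \<noteq> E z"
      using interior_subset[of "{z \<in> W. F z = M z}"] interior_subset[of "{z \<in> V. E z = M z}"]
      unfolding A_def N_def by auto
    then show False by simp
  qed
qed

text \<open>
  Residue along the simple pole \<open>L = 0\<close>: restriction of \<open>L * M\<close> to that hyperplane.
\<close>

definition residue_along ::
  "(complex ^ 'n \<Rightarrow> complex) \<Rightarrow> (complex ^ 'n \<Rightarrow> complex) \<Rightarrow> complex ^ 'n \<Rightarrow> complex" where
  "residue_along L M = mero_value (\<lambda>z. L z * M z)"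

text \<open>
  Identities between meromorphic functions on a subspace \<open>H\<close> are identities on a
  relatively open dense subset of \<open>H\<close>.
\<close>

definition generically_on :: "'a::topological_space set \<Rightarrow> ('a \<Rightarrow> bool) \<Rightarrow> bool" where
  "generically_on H P \<longleftrightarrow> (\<exists>U. open U \<and> H \<subseteq> closure (H \<inter> U) \<and> (\<forall>z \<in> H \<inter> U. P z))"


section \<open>Energies and integrals\<close>

text \<open>
  A point of the energy space has components \<open>x\<^sub>v\<close> at \<open>Inl v\<close> and \<open>y\<^sub>e\<close> at \<open>Inr e\<close>.
\<close>

type_synonym ('v, 'e) energies = "complex ^ ('v + 'e)"

abbreviation xen :: "('v::finite, 'e::finite) energies \<Rightarrow> 'v \<Rightarrow> complex" where
  "xen z v \<equiv> z $ Inl v"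

abbreviation yen :: "('v::finite, 'e::finite) energies \<Rightarrow> 'e \<Rightarrow> complex" where
  "yen z e \<equiv> z $ Inr e"

definition positive_energies :: "('v::finite, 'e::finite) multigraph \<Rightarrow> ('v, 'e) energies set" where
  "positive_energies G =
     {z. (\<forall>v\<in>verts G. \<exists>t>0. xen z v = of_real t) \<and> (\<forall>e\<in>edges G. \<exists>t>0. yen z e = of_real t)}"

definition Xsum :: "('v::finite, 'e::finite) multigraph \<Rightarrow> 'v set \<Rightarrow> ('v, 'e) energies \<Rightarrow> complex" where
  "Xsum G A z = (\<Sum>v\<in>A. xen z v) + (\<Sum>e\<in>edge_boundary G A. yen z e)"

definition Xplane :: "('v::finite, 'e::finite) multigraph \<Rightarrow> 'v set \<Rightarrow> ('v, 'e) energies set" where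
  "Xplane G A = {z. Xsum G A z = 0}"

definition eta :: "('v::finite, 'e::finite) multigraph \<Rightarrow> 'v set \<Rightarrow> 'v \<Rightarrow> ('v, 'e) energies \<Rightarrow> complex" where
  "eta G S v z = (\<Sum>e\<in>{e \<in> edge_boundary G S. v \<in> ends G e}. yen z e)"

definition edge_cosh :: "('v, 'e) multigraph \<Rightarrow> ('v \<Rightarrow> real) \<Rightarrow> 'e \<Rightarrow> real" where
  "edge_cosh G \<tau> e = (let (u, v) = (SOME (u, v). ends G e = {u, v}) in cosh (\<tau> u - \<tau> v))"

lemma edge_cosh_eq:
  assumes "ends G e = {u, v}"
  shows "edge_cosh G \<tau> e = cosh (\<tau> u - \<tau> v)"
proof -
  define p where "p = (SOME (u, v). ends G e = {u, v})"
  have "case p of (u, v) \<Rightarrow> ends G e = {u, v}"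
    unfolding p_def by (rule someI[of _ "(u, v)"]) (simp add: assms)
  then have "p = (u, v) \<or> p = (v, u)"
    using assms by (cases p) (auto simp: doubleton_eq_iff)
  then have "(case p of (u, v) \<Rightarrow> cosh (\<tau> u - \<tau> v)) = cosh (\<tau> u - \<tau> v)"
    by (auto simp: cosh_def)
  then show ?thesis
    unfolding edge_cosh_def p_def by (simp add: Let_def)
qed

definition vertex_product ::
  "('v::finite, 'e::finite) multigraph \<Rightarrow> real \<Rightarrow> ('v, 'e) energies \<Rightarrow> ('v \<Rightarrow> real) \<Rightarrow> complex" where
  "vertex_product G \<alpha>' z \<tau> =
     (\<Prod>v\<in>verts G. of_real (2 * cosh (\<tau> v)) powr (- of_real \<alpha>' * xen z v))"

definition edge_product ::
  "('v::finite, 'e::finite) multigraph \<Rightarrow> real \<Rightarrow> ('v, 'e) energies \<Rightarrow> ('v \<Rightarrow> real) \<Rightarrow> complex" where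
  "edge_product G \<alpha>' z \<tau> =
     (\<Prod>e\<in>edges G. of_real (2 * edge_cosh G \<tau> e) powr (- of_real \<alpha>' * yen z e))"

definition zono_integral ::
  "('v::finite, 'e::finite) multigraph \<Rightarrow> real \<Rightarrow> ('v, 'e) energies \<Rightarrow> complex" where
  "zono_integral G \<alpha>' z =
     of_real \<alpha>' ^ card (verts G) *
     (LINT \<tau>|Pi\<^sub>M (verts G) (\<lambda>_. lborel). vertex_product G \<alpha>' z \<tau> * edge_product G \<alpha>' z \<tau>)"

definition J_integrand ::
  "('v::finite, 'e::finite) multigraph \<Rightarrow> real \<Rightarrow> 'v set \<Rightarrow> 'v set \<Rightarrow> ('v, 'e) energies \<Rightarrow> ('v \<Rightarrow> real) \<Rightarrow> complex" where
  "J_integrand G \<alpha>' S K z \<tau> =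
     vertex_product (induced G K) \<alpha>' z \<tau> * edge_product (induced G K) \<alpha>' z \<tau> *
     exp (of_real \<alpha>' * (\<Sum>v\<in>K. eta G S v z * of_real (\<tau> v)))"

definition J_domain ::
  "('v::finite, 'e::finite) multigraph \<Rightarrow> real \<Rightarrow> 'v set \<Rightarrow> 'v set \<Rightarrow> ('v, 'e) energies set" where
  "J_domain G \<alpha>' S K = {z. integrable (Pi\<^sub>M K (\<lambda>_. lborel)) (J_integrand G \<alpha>' S K z)}"

definition J_integral ::
  "('v::finite, 'e::finite) multigraph \<Rightarrow> real \<Rightarrow> 'v set \<Rightarrow> 'v set \<Rightarrow> ('v, 'e) energies \<Rightarrow> complex" where
  "J_integral G \<alpha>' S K z =
     of_real \<alpha>' ^ card K * (LINT \<tau>|Pi\<^sub>M K (\<lambda>_. lborel). J_integrand G \<alpha>' S K z \<tau>)"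

definition C_integrand ::
  "('v::finite, 'e::finite) multigraph \<Rightarrow> real \<Rightarrow> 'v set \<Rightarrow> ('v, 'e) energies \<Rightarrow> ('v \<Rightarrow> real) \<Rightarrow> complex" where
  "C_integrand G \<alpha>' S z \<tau> =
     exp (- of_real \<alpha>' * (\<Sum>v\<in>S. (xen z v + eta G S v z) * of_real (\<tau> v))) *
     edge_product (induced G S) \<alpha>' z \<tau>"

definition C_domain ::
  "('v::finite, 'e::finite) multigraph \<Rightarrow> real \<Rightarrow> 'v set \<Rightarrow> 'v \<Rightarrow> ('v, 'e) energies set" where
  "C_domain G \<alpha>' S a =
     {z. integrable (Pi\<^sub>M (S - {a}) (\<lambda>_. lborel)) (\<lambda>\<tau>. C_integrand G \<alpha>' S z (\<tau>(a := 0)))}"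

definition C_integral ::
  "('v::finite, 'e::finite) multigraph \<Rightarrow> real \<Rightarrow> 'v set \<Rightarrow> 'v \<Rightarrow> ('v, 'e) energies \<Rightarrow> complex" where
  "C_integral G \<alpha>' S a z =
     of_real \<alpha>' ^ (card S - 1) *
     (LINT \<tau>|Pi\<^sub>M (S - {a}) (\<lambda>_. lborel). C_integrand G \<alpha>' S z (\<tau>(a := 0)))"

text \<open>\<open>D e\<close> is the vertex set of one of the two components of \<open>G[S]\<close> with \<open>e\<close> deleted.\<close>

definition beta_product ::
  "('v::finite, 'e::finite) multigraph \<Rightarrow> real \<Rightarrow> 'v set \<Rightarrow> ('e \<Rightarrow> 'v set) \<Rightarrow> ('v, 'e) energies \<Rightarrow> complex" where
  "beta_product G \<alpha>' S D z =
     (\<Prod>e\<in>edges (induced G S). of_real (\<alpha>' / 2) *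
        Beta (of_real (\<alpha>' / 2) * Xsum G (D e) z) (of_real (\<alpha>' / 2) * Xsum G (S - D e) z))"

end

theory Submission
  imports Defs "HOL-Complex_Analysis.Complex_Analysis"
begin

text \<open>
  Internal block: \<open>G[S]\<close> is grown from the reference vertex one leaf at a time, so the integral over
  the last leaf splits off as \<open>\<integral> exp ((a - b) s) (2 cosh s) powr (- (a + b)) ds = B(a, b) / 2\<close>.

  Residue: let \<open>t\<close> be the common translation of the variables of \<open>S\<close>. Integrating
  the derivative of \<open>tanh t\<close> times the integrand replaces \<open>X\<^sub>S\<close> times the integral by an integral that
  converges in a neighbourhood of the point where all energies entering \<open>X\<^sub>S\<close> vanish and all others
  are \<open>1\<close>, which lies on the boundary of the positive energies. On \<open>X\<^sub>S = 0\<close> the integral over \<open>t\<close> is the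
  sum of the two limits at \<open>\<plusminus>\<infinity>\<close>, which are exchanged by the reflection \<open>\<tau> \<mapsto> - \<tau>\<close>; this gives the factor
  \<open>2\<close>, and the remaining integrand factors over \<open>S\<close> and the components \<open>K\<^sub>j\<close>. The identity theorem on the
  connected hyperplane, together with the local constancy of the pole order along it, makes the
  formula hold generically.
\<close>

section \<open>Holomorphic functions of several variables\<close>

text \<open>The obstacle is a gap. The integral is prescribed only at positive energies, where X_S >
  0; these are real points, so the hyperplane is reached only by continuation, and a meromorphic
  function carries arbitrary values on its exceptional set. Comparisons are therefore made on one
  small complex ball around the base point, where the continued integral and the outer blocks
  converge outright. Convergence there is a budget of three rates. Factors that do not feel t have
  exponents near 1 and decay in every coordinate relative to the reference vertex, because tree
  edges tie S to it and each outer vertex has its own cosh factor. Factors that feel t have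
  exponents near 0 and grow slowly. The remainder of the differentiation supplies decay in t, at a
  price in the relative coordinates that the first decay pays. The internal block has to be
  evaluated at every point of convergence on the hyperplane: there integrability itself forces
  positive real parts on the Beta arguments.\<close>

lemma bounded_linear_smult_left: "bounded_linear (\<lambda>t. t *s (d :: complex ^ 'n))"
  unfolding linear_conv_bounded_linear[symmetric]
  by (rule linearI) (auto simp: vec_eq_iff algebra_simps)

lemma continuous_on_smult [continuous_intros]:
  fixes d :: "'a::topological_space \<Rightarrow> complex ^ 'n"
  assumes "continuous_on T s" "continuous_on T d"
  shows "continuous_on T (\<lambda>t. s t *s d t)"
  using assms unfolding vector_scalar_mult_def
  by (intro continuous_on_vec_lambda continuous_intros) auto

lemma norm_smult: "norm (t *s (d :: complex ^ 'n)) = norm t * norm d"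
  by (simp add: norm_vec_def L2_set_def norm_mult power_mult_distrib real_sqrt_mult flip: sum_distrib_left)

text \<open>A real derivative that commutes with complex scalars is a complex linear form whose
  coefficients are its values on the axis vectors. In this coordinate-free form the closure
  properties follow from the rules for \<open>has_derivative\<close>.\<close>

lemma holo_on_alt:
  "holo_on f U \<longleftrightarrow>
     (\<forall>z\<in>U. \<exists>A. (f has_derivative A) (at z) \<and> (\<forall>c h. A (c *s h) = c * A h))"
proof
  assume L: "holo_on f U"
  show "\<forall>z\<in>U. \<exists>A. (f has_derivative A) (at z) \<and> (\<forall>c h. A (c *s h) = c * A h)"
  proof
    fix z assume "z \<in> U"
    then obtain c where "(f has_derivative (\<lambda>h. \<Sum>i\<in>UNIV. c $ i * h $ i)) (at z)"
      using L unfolding holo_on_def by blast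
    then show "\<exists>A. (f has_derivative A) (at z) \<and> (\<forall>c h. A (c *s h) = c * A h)"
      by (intro exI[of _ "\<lambda>h. \<Sum>i\<in>UNIV. c $ i * h $ i"]) (auto simp: sum_distrib_left algebra_simps)
  qed
next
  assume R: "\<forall>z\<in>U. \<exists>A. (f has_derivative A) (at z) \<and> (\<forall>c h. A (c *s h) = c * A h)"
  show "holo_on f U"
    unfolding holo_on_def
  proof
    fix z assume "z \<in> U"
    then obtain A where A: "(f has_derivative A) (at z)" "\<And>c h. A (c *s h) = c * A h"
      using R by blast
    have lin: "linear A"
      using A(1) has_derivative_linear by blast
    have "A h = (\<Sum>i\<in>UNIV. (\<chi> i. A (axis i 1)) $ i * h $ i)" for h
    proof -
      have "A h = A (\<Sum>i\<in>UNIV. h $ i *s axis i 1)"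
        by (simp add: basis_expansion)
      also have "\<dots> = (\<Sum>i\<in>UNIV. h $ i * A (axis i 1))"
        by (simp add: linear_sum[OF lin] A(2))
      finally show ?thesis by (simp add: mult.commute)
    qed
    then have "A = (\<lambda>h. \<Sum>i\<in>UNIV. (\<chi> i. A (axis i 1)) $ i * h $ i)"
      by (rule ext)
    with A(1) show "\<exists>c. (f has_derivative (\<lambda>h. \<Sum>i\<in>UNIV. c $ i * h $ i)) (at z)"
      by metis
  qed
qed

lemma holo_on_subset: "holo_on f U \<Longrightarrow> V \<subseteq> U \<Longrightarrow> holo_on f V"
  unfolding holo_on_def by blast

lemma holo_on_const [intro]: "holo_on (\<lambda>_. c) U"
  unfolding holo_on_alt by (auto intro!: exI[of _ "\<lambda>_. 0"] derivative_eq_intros)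

lemma holo_on_component [intro]: "holo_on (\<lambda>z. z $ i) U"
  unfolding holo_on_alt
  by (auto intro!: exI[of _ "\<lambda>h. h $ i"] bounded_linear_imp_has_derivative bounded_linear_vec_nth)

lemma holo_on_add [intro]:
  assumes "holo_on f U" "holo_on g U"
  shows "holo_on (\<lambda>z. f z + g z) U"
  unfolding holo_on_alt
proof
  fix z assume "z \<in> U"
  then obtain A B where "(f has_derivative A) (at z)" "\<And>c h. A (c *s h) = c * A h"
     "(g has_derivative B) (at z)" "\<And>c h. B (c *s h) = c * B h"
    using assms unfolding holo_on_alt by metis
  then show "\<exists>A. ((\<lambda>z. f z + g z) has_derivative A) (at z) \<and> (\<forall>c h. A (c *s h) = c * A h)"
    by (intro exI[of _ "\<lambda>h. A h + B h"]) (auto intro!: derivative_eq_intros simp: algebra_simps)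
qed

lemma holo_on_mult [intro]:
  assumes "holo_on f U" "holo_on g U"
  shows "holo_on (\<lambda>z. f z * g z) U"
  unfolding holo_on_alt
proof
  fix z assume "z \<in> U"
  then obtain A B where "(f has_derivative A) (at z)" "\<And>c h. A (c *s h) = c * A h"
     "(g has_derivative B) (at z)" "\<And>c h. B (c *s h) = c * B h"
    using assms unfolding holo_on_alt by metis
  then show "\<exists>A. ((\<lambda>z. f z * g z) has_derivative A) (at z) \<and> (\<forall>c h. A (c *s h) = c * A h)"
    by (intro exI[of _ "\<lambda>h. f z * B h + A h * g z"]) (auto intro!: derivative_eq_intros simp: algebra_simps)
qed

lemma holo_on_compose:
  assumes "holo_on f U" "\<And>z. z \<in> U \<Longrightarrow> g field_differentiable at (f z)"
  shows "holo_on (\<lambda>z. g (f z)) U"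
  unfolding holo_on_alt
proof
  fix z assume z: "z \<in> U"
  then obtain A where A: "(f has_derivative A) (at z)" "\<And>c h. A (c *s h) = c * A h"
    using assms unfolding holo_on_alt by metis
  obtain g' where "(g has_field_derivative g') (at (f z))"
    using assms(2)[OF z] unfolding field_differentiable_def by blast
  then have "((\<lambda>z. g (f z)) has_derivative (\<lambda>h. g' * A h)) (at z)"
    using has_derivative_compose[OF A(1)] unfolding has_field_derivative_def by blast
  then show "\<exists>A. ((\<lambda>z. g (f z)) has_derivative A) (at z) \<and> (\<forall>c h. A (c *s h) = c * A h)"
    by (intro exI[of _ "\<lambda>h. g' * A h"]) (auto simp: A(2) algebra_simps)
qed

lemma holo_on_cmult: "holo_on f U \<Longrightarrow> holo_on (\<lambda>z. c * f z) U"
  by (intro holo_on_mult holo_on_const)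

lemma holo_on_diff [intro]:
  assumes "holo_on f U" "holo_on g U"
  shows "holo_on (\<lambda>z. f z - g z) U"
  using holo_on_add[OF assms(1) holo_on_cmult[OF assms(2), of "-1"]] by simp

lemma holo_on_sum [intro]:
  "(\<And>i. i \<in> I \<Longrightarrow> holo_on (f i) U) \<Longrightarrow> holo_on (\<lambda>z. \<Sum>i\<in>I. f i z) U"
  by (induction I rule: infinite_finite_induct) (auto intro: holo_on_add holo_on_const)

lemma holo_on_prod [intro]:
  "(\<And>i. i \<in> I \<Longrightarrow> holo_on (f i) U) \<Longrightarrow> holo_on (\<lambda>z. \<Prod>i\<in>I. f i z) U"
  by (induction I rule: infinite_finite_induct) (auto intro: holo_on_mult holo_on_const)

lemma holo_on_divide [intro]:
  assumes "holo_on f U" "holo_on g U" "\<And>z. z \<in> U \<Longrightarrow> g z \<noteq> 0"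
  shows "holo_on (\<lambda>z. f z / g z) U"
proof -
  have "holo_on (\<lambda>z. inverse (g z)) U"
    by (rule holo_on_compose[OF assms(2)])
      (auto intro!: field_differentiable_inverse assms(3) field_differentiable_ident)
  then show ?thesis unfolding divide_inverse by (intro holo_on_mult assms)
qed

lemma holo_on_exp [intro]: "holo_on f U \<Longrightarrow> holo_on (\<lambda>z. exp (f z)) U"
  by (rule holo_on_compose) (auto simp: field_differentiable_def intro!: exI DERIV_exp)

lemma holo_on_transform:
  assumes "holo_on f U" "\<And>z. z \<in> U \<Longrightarrow> \<exists>V. open V \<and> z \<in> V \<and> (\<forall>w\<in>V. f w = g w)"
  shows "holo_on g U"
  unfolding holo_on_alt
proof
  fix z assume z: "z \<in> U"
  then obtain A where A: "(f has_derivative A) (at z)" "\<And>c h. A (c *s h) = c * A h"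
    using assms unfolding holo_on_alt by metis
  obtain V where V: "open V" "z \<in> V" "\<forall>w\<in>V. f w = g w" using assms(2)[OF z] by blast
  have "(g has_derivative A) (at z)"
    using has_derivative_transform_within_open[OF A(1) V(1,2)] V(3) by auto
  then show "\<exists>A. (g has_derivative A) (at z) \<and> (\<forall>c h. A (c *s h) = c * A h)"
    using A(2) by blast
qed

lemma holo_on_locally:
  assumes "\<And>z. z \<in> U \<Longrightarrow> \<exists>V. z \<in> V \<and> holo_on f V"
  shows "holo_on f U"
  using assms unfolding holo_on_def by blast

lemma open_line_preimage:
  fixes W :: "(complex ^ 'n) set"
  assumes "open W"
  shows "open {t. z + t *s d \<in> W}"
proof -
  have "continuous_on UNIV (\<lambda>t. z + t *s d)" by (intro continuous_intros)
  then show ?thesis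
    using assms open_vimage[of W "\<lambda>t. z + t *s d"] by (simp add: vimage_def)
qed

lemma convex_line_preimage:
  fixes W :: "(complex ^ 'n) set"
  assumes "convex W"
  shows "convex {t. z + t *s d \<in> W}"
proof (rule convexI)
  fix s t :: complex and u v :: real
  assume *: "s \<in> {t. z + t *s d \<in> W}" "t \<in> {t. z + t *s d \<in> W}" "0 \<le> u" "0 \<le> v" "u + v = 1"
  have "u *\<^sub>R (z + s *s d) + v *\<^sub>R (z + t *s d) = (u + v) *\<^sub>R z + (u *\<^sub>R s + v *\<^sub>R t) *s d"
    by (simp add: vec_eq_iff algebra_simps)
  then show "u *\<^sub>R s + v *\<^sub>R t \<in> {t. z + t *s d \<in> W}"
    using * convexD[OF assms, of "z + s *s d" "z + t *s d" u v] by simp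
qed

lemma holo_on_line:
  assumes "holo_on f W"
  shows "(\<lambda>t. f (z + t *s d)) holomorphic_on {t. z + t *s d \<in> W}"
  unfolding holomorphic_on_def
proof
  fix t assume "t \<in> {t. z + t *s d \<in> W}"
  then obtain A where A: "(f has_derivative A) (at (z + t *s d))" "\<And>c h. A (c *s h) = c * A h"
    using assms unfolding holo_on_alt by blast
  have "((\<lambda>t. z + t *s d) has_derivative (\<lambda>t. t *s d)) (at t)"
    by (auto intro!: derivative_eq_intros
        bounded_linear.has_derivative[OF bounded_linear_smult_left[of d]])
  from has_derivative_compose[OF this A(1)]
  have "((\<lambda>t. f (z + t *s d)) has_field_derivative A d) (at t)"
    unfolding has_field_derivative_def by (simp add: A(2) mult.commute[of _ "A d"])
  then show "(\<lambda>t. f (z + t *s d)) field_differentiable at t within {t. z + t *s d \<in> W}"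
    using field_differentiable_at_within field_differentiable_def by blast
qed

section \<open>Identity theorems along complex affine subspaces\<close>

text \<open>Closure under complex lines, not only real ones: restricting to the line through two
  points of the set leaves a function of one complex variable.\<close>

definition complex_affine :: "(complex ^ 'n) set \<Rightarrow> bool" where
  "complex_affine H \<longleftrightarrow> (\<forall>z\<in>H. \<forall>w\<in>H. \<forall>t. z + t *s (w - z) \<in> H)"

lemma complex_affine_UNIV [simp]: "complex_affine UNIV"
  by (simp add: complex_affine_def)

lemma complex_affine_convex:
  fixes H :: "(complex ^ 'n) set"
  assumes "complex_affine H"
  shows "convex H"
proof (rule convexI)
  fix x y :: "complex ^ 'n" and u v :: real
  assume *: "x \<in> H" "y \<in> H" "0 \<le> u" "0 \<le> v" "u + v = 1"
  have "x + complex_of_real v *s (y - x) = (1 - v) *\<^sub>R x + v *\<^sub>R y"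
    by (auto simp: vec_eq_iff complex_eq_iff algebra_simps)
  moreover have "x + complex_of_real v *s (y - x) \<in> H"
    using assms *(1,2) unfolding complex_affine_def by blast
  moreover have "u = 1 - v" using *(5) by simp
  ultimately show "u *\<^sub>R x + v *\<^sub>R y \<in> H" by metis
qed

text \<open>On the complex line from q to z, which stays in H, the part inside the convex set W is
  connected, and the zeros accumulate at the parameter of q. One-variable continuation then reaches
  z. The parameter H lets the same result serve the full space and the hyperplane.\<close>

lemma holo_on_identity:
  fixes f :: "complex ^ 'n \<Rightarrow> complex"
  assumes f: "holo_on f W" and W: "open W" "convex W" and H: "complex_affine H"
    and U: "open U" "q \<in> U" "q \<in> W" "q \<in> H" and z: "z \<in> W" "z \<in> H"
    and 0: "\<And>w. w \<in> U \<inter> W \<inter> H \<Longrightarrow> f w = 0"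
  shows "f z = 0"
proof -
  define T where "T = {t. q + t *s (z - q) \<in> W}"
  have op: "open T" unfolding T_def by (rule open_line_preimage[OF W(1)])
  have "open (T \<inter> {t. q + t *s (z - q) \<in> U})"
    using op open_line_preimage[OF U(1)] by blast
  moreover have "0 \<in> T \<inter> {t. q + t *s (z - q) \<in> U}"
    using U by (simp add: T_def)
  ultimately have lim: "0 islimpt (T \<inter> {t. q + t *s (z - q) \<in> U})"
    by (metis interior_limit_point interior_open)
  have "f (q + 1 *s (z - q)) = 0"
  proof (rule analytic_continuation[where f = "\<lambda>t. f (q + t *s (z - q))" and S = T, OF _ op _ _ _ lim])
    show "(\<lambda>t. f (q + t *s (z - q))) holomorphic_on T"
      unfolding T_def by (rule holo_on_line[OF f])
    show "connected T" unfolding T_def by (intro convex_connected convex_line_preimage W)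
    show "0 \<in> T" "1 \<in> T" using U z by (simp_all add: T_def)
    fix t assume "t \<in> T \<inter> {t. q + t *s (z - q) \<in> U}"
    moreover have "q + t *s (z - q) \<in> H"
      using H U(4) z(2) unfolding complex_affine_def by blast
    ultimately show "f (q + t *s (z - q)) = 0"
      using 0[of "q + t *s (z - q)"] unfolding T_def by blast
  qed auto
  then show ?thesis by simp
qed

text \<open>A hole in the nonzero set would be an open piece of H on which h vanishes, and the
  identity theorem would carry this to w. Hence a single nonzero point certifies a denominator on a
  convex neighbourhood.\<close>

lemma holo_on_nonzero_dense:
  fixes h :: "complex ^ 'n \<Rightarrow> complex"
  assumes h: "holo_on h W" and W: "open W" "convex W" and H: "complex_affine H"
    and w: "w \<in> W" "w \<in> H" "h w \<noteq> 0"
  shows "W \<inter> H \<subseteq> closure {z \<in> W \<inter> H. h z \<noteq> 0}"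
proof
  fix z assume z: "z \<in> W \<inter> H"
  define C where "C = closure {z \<in> W \<inter> H. h z \<noteq> 0}"
  show "z \<in> closure {z \<in> W \<inter> H. h z \<noteq> 0}"
  proof (rule ccontr)
    assume "z \<notin> closure {z \<in> W \<inter> H. h z \<noteq> 0}"
    then have zC: "z \<in> - C" by (simp add: C_def)
    have 0: "h x = 0" if "x \<in> - C \<inter> W \<inter> H" for x
      using that closure_subset[of "{z \<in> W \<inter> H. h z \<noteq> 0}"] unfolding C_def by blast
    have "open (- C)" by (simp add: C_def open_Compl)
    then have "h w = 0"
      using holo_on_identity[OF h W H _ zC _ _ w(1,2) 0] z by blast
    with w show False by simp
  qed
qed

definition real_points :: "(complex ^ 'n) set" where
  "real_points = {z. \<forall>i. z $ i \<in> \<real>}"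

text \<open>For w = x + i y near q with x, y real, the function t -> f(x + t y) vanishes for small
  real t, hence also at t = i. This turns agreement at positive energies, which are real, into
  agreement on an open set.\<close>

lemma holo_on_identity_real:
  fixes f :: "complex ^ 'n \<Rightarrow> complex"
  assumes f: "holo_on f W" and W: "open W" "convex W"
    and U: "open U" "q \<in> U" "q \<in> W" "q \<in> real_points" and z: "z \<in> W"
    and 0: "\<And>w. w \<in> U \<inter> W \<inter> real_points \<Longrightarrow> f w = 0"
  shows "f z = 0"
proof -
  obtain e where e: "e > 0" "ball q e \<subseteq> U \<inter> W"
    using U W openE[of "U \<inter> W" q] by blast
  \<comment> \<open>Both x - q and y are bounded by w - q, so half the radius keeps x + t y inside
    \<open>ball q e\<close> for all t with norm at most 1, in particular for t = i.\<close>
  have "f w = 0" if w: "w \<in> ball q (e / 2)" for w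
  proof -
    define x where "x = (\<chi> i. complex_of_real (Re (w $ i)))"
    define y where "y = (\<chi> i. complex_of_real (Im (w $ i)))"
    have wxy: "w = x + \<i> *s y" by (simp add: vec_eq_iff x_def y_def complex_eq)
    have xq: "norm (x - q) < e / 2" "norm y < e / 2"
    proof -
      have qi: "q $ i \<in> \<real>" for i using U(4) by (simp add: real_points_def)
      have "norm ((x - q) $ i) \<le> norm ((w - q) $ i)" for i
      proof -
        have eq: "(x - q) $ i = of_real (Re ((w - q) $ i))" using qi[of i]
          by (simp add: x_def complex_is_Real_iff complex_eq_iff)
        show ?thesis unfolding eq norm_of_real by (rule abs_Re_le_cmod)
      qed
      then have "norm (x - q) \<le> norm (w - q)" by (rule norm_le_componentwise_cart)
      moreover have "norm (y $ i) \<le> norm ((w - q) $ i)" for i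
      proof -
        have eq: "y $ i = of_real (Im ((w - q) $ i))" using qi[of i]
          by (simp add: y_def complex_is_Real_iff)
        show ?thesis unfolding eq norm_of_real by (rule abs_Im_le_cmod)
      qed
      then have "norm y \<le> norm (w - q)" by (rule norm_le_componentwise_cart)
      ultimately show "norm (x - q) < e / 2" "norm y < e / 2"
        using w by (simp_all add: dist_norm norm_minus_commute)
    qed
    define T where "T = {t. x + t *s y \<in> ball q e}"
    have op: "open T" unfolding T_def by (rule open_line_preimage) simp
    have inT: "t \<in> T" if "norm t \<le> 1" for t
    proof -
      have "norm (x + t *s y - q) \<le> norm (x - q) + norm (t *s y)"
        by (metis add_diff_eq add.commute norm_triangle_ineq)
      also have "\<dots> \<le> norm (x - q) + norm y"
        using that by (simp add: norm_smult mult_left_le_one_le)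
      also have "\<dots> < e" using xq by simp
      finally show ?thesis by (simp add: T_def dist_norm norm_minus_commute)
    qed
    have lim: "0 islimpt (of_real ` {0<..<1::real} :: complex set)"
      unfolding islimpt_approachable
    proof (intro allI impI)
      fix r :: real assume "r > 0"
      then show "\<exists>t\<in>of_real ` {0<..<1::real}. t \<noteq> (0::complex) \<and> dist t 0 < r"
        by (intro bexI[of _ "of_real (min (r / 2) (1 / 2))"] conjI imageI) (auto simp: min_def)
    qed
    have "f (x + \<i> *s y) = 0"
    proof (rule analytic_continuation[where f = "\<lambda>t. f (x + t *s y)" and S = T, OF _ op _ _ _ lim])
      show "(\<lambda>t. f (x + t *s y)) holomorphic_on T"
        unfolding T_def by (rule holo_on_line, rule holo_on_subset[OF f]) (use e in auto)
      show "connected T" unfolding T_def by (intro convex_connected convex_line_preimage convex_ball)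
      show "0 \<in> T" "\<i> \<in> T" by (simp_all add: inT)
      show "of_real ` {0<..<1::real} \<subseteq> T" by (auto intro: inT)
      fix t :: complex assume t: "t \<in> of_real ` {0<..<1::real}"
      then have "t \<in> T" by (auto intro: inT)
      moreover have "x + t *s y \<in> real_points"
        using t by (auto simp: real_points_def x_def y_def)
      ultimately show "f (x + t *s y) = 0" using e(2) by (intro 0) (auto simp: T_def)
    qed
    then show ?thesis using wxy by simp
  qed
  then show ?thesis
    using holo_on_identity[OF f W complex_affine_UNIV, of "ball q (e / 2)" q z] U(3) z e(1) by simp
qed

section \<open>Cauchy estimates and holomorphy of parameter integrals\<close>

text \<open>Cauchy's inequality on discs of radius r/2, centred within r/4 of the origin, bounds the
  second derivative by 2 B / (r/2)^2, which is the constant in Taylor's estimate.\<close>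

lemma holomorphic_quadratic_remainder:
  assumes f: "f holomorphic_on ball 0 r" and B: "\<And>t. t \<in> ball 0 r \<Longrightarrow> norm (f t) \<le> B"
    and t: "norm t \<le> r / 4" and r: "r > 0"
  shows "norm (f t - f 0 - t * deriv f 0) \<le> 8 * B / r\<^sup>2 * (norm t)\<^sup>2"
proof -
  have "norm ((deriv ^^ 0) f t - (\<Sum>i\<le>1. (deriv ^^ i) f 0 * (t - 0) ^ i / fact i))
      \<le> 8 * B / r\<^sup>2 * norm (t - 0) ^ Suc 1 / fact 1"
  proof (rule field_Taylor[where S = "cball 0 (r / 4)"])
    fix i and x :: complex assume x: "x \<in> cball 0 (r / 4)"
    have "(deriv ^^ i) f holomorphic_on ball 0 r"
      by (rule holomorphic_higher_deriv[OF f]) simp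
    then have "((deriv ^^ i) f has_field_derivative deriv ((deriv ^^ i) f) x) (at x)"
      by (rule holomorphic_derivI) (use x r in auto)
    then show "((deriv ^^ i) f has_field_derivative (deriv ^^ Suc i) f x) (at x within cball 0 (r / 4))"
      by (simp add: has_field_derivative_at_within)
  next
    fix x :: complex assume x: "x \<in> cball 0 (r / 4)"
    have sub: "cball x (r / 2) \<subseteq> ball 0 r"
    proof
      fix y assume "y \<in> cball x (r / 2)"
      then show "y \<in> ball 0 r"
        using x r norm_triangle_ineq[of "y - x" x] by (auto simp: dist_norm norm_minus_commute)
    qed
    have "norm ((deriv ^^ Suc 1) f x) \<le> fact (Suc 1) * B / (r / 2) ^ Suc 1"
    proof (rule Cauchy_inequality)
      show "f holomorphic_on ball x (r / 2)"
        using sub by (intro holomorphic_on_subset[OF f]) (meson ball_subset_cball order_trans)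
      show "continuous_on (cball x (r / 2)) f"
        by (intro holomorphic_on_imp_continuous_on holomorphic_on_subset[OF f] sub)
      fix y assume "norm (x - y) = r / 2"
      then show "norm (f y) \<le> B" by (intro B subsetD[OF sub]) (simp add: dist_norm)
    qed (use r in simp)
    then show "norm ((deriv ^^ Suc 1) f x) \<le> 8 * B / r\<^sup>2"
      by (simp add: power2_eq_square field_simps)
  qed (use t r in auto)
  then show ?thesis by (simp add: power2_eq_square algebra_simps)
qed

text \<open>Restricted to the line in direction h, the function is holomorphic on a disc of radius r
  / norm h. The one-variable estimate is used at t = 1, which is admissible exactly for norm h at
  most r/4.\<close>

lemma holo_on_quadratic_remainder:
  fixes f :: "complex ^ 'n \<Rightarrow> complex"
  assumes f: "holo_on f (ball z r)" and r: "r > 0"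
    and B: "\<And>w. w \<in> ball z r \<Longrightarrow> norm (f w) \<le> B"
  obtains c :: "complex ^ 'n" where "\<And>h. norm h \<le> r / 4 \<Longrightarrow>
     norm (f (z + h) - f z - (\<Sum>i\<in>UNIV. c $ i * h $ i)) \<le> 8 * B / r\<^sup>2 * (norm h)\<^sup>2"
proof -
  obtain c where c: "(f has_derivative (\<lambda>h. \<Sum>i\<in>UNIV. c $ i * h $ i)) (at z)"
    using f r unfolding holo_on_def by (meson centre_in_ball)
  show ?thesis
  proof
    fix h :: "complex ^ 'n" assume h: "norm h \<le> r / 4"
    show "norm (f (z + h) - f z - (\<Sum>i\<in>UNIV. c $ i * h $ i)) \<le> 8 * B / r\<^sup>2 * (norm h)\<^sup>2"
    proof (cases "h = 0")
      case False
      then have hp: "norm h > 0" by simp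
      define g where "g = (\<lambda>t. f (z + t *s h))"
      define R where "R = r / norm h"
      have inb: "z + t *s h \<in> ball z r" if "t \<in> ball 0 R" for t
        using that hp by (simp add: dist_norm norm_smult R_def field_simps)
      have g: "g holomorphic_on ball 0 R"
        unfolding g_def by (rule holomorphic_on_subset[OF holo_on_line[OF f]]) (use inb in blast)
      have "((\<lambda>t. z + t *s h) has_derivative (\<lambda>t. t *s h)) (at 0)"
        by (auto intro!: derivative_eq_intros
            bounded_linear.has_derivative[OF bounded_linear_smult_left[of h]])
      moreover have "(f has_derivative (\<lambda>h. \<Sum>i\<in>UNIV. c $ i * h $ i)) (at (z + 0 *s h))"
        using c by simp
      ultimately have "(g has_derivative (\<lambda>t. \<Sum>i\<in>UNIV. c $ i * (t *s h) $ i)) (at 0)"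
        unfolding g_def by (rule has_derivative_compose)
      then have "(g has_field_derivative (\<Sum>i\<in>UNIV. c $ i * h $ i)) (at 0)"
        unfolding has_field_derivative_def
        by (rule has_derivative_eq_rhs) (simp add: fun_eq_iff sum_distrib_left sum_distrib_right algebra_simps)
      then have d: "deriv g 0 = (\<Sum>i\<in>UNIV. c $ i * h $ i)" by (rule DERIV_imp_deriv)
      have "norm (g 1 - g 0 - 1 * deriv g 0) \<le> 8 * B / R\<^sup>2 * (norm (1::complex))\<^sup>2"
        by (rule holomorphic_quadratic_remainder[OF g])
          (use hp h r in \<open>auto simp: g_def R_def field_simps intro!: B[OF inb[unfolded R_def]]\<close>)
      then show ?thesis using hp r d by (simp add: g_def R_def field_simps)
    qed simp
  qed
qed

lemma norm_axis_eq: "norm (axis i x) = norm x"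
  by (simp add: norm_vec_def L2_set_def axis_def if_distrib[of norm] if_distrib[of "\<lambda>x. x\<^sup>2"] cong: if_cong)

text \<open>
  The Cauchy estimate makes the remainder of the first-order expansion quadratic with a constant
  proportional to the dominating function, so it can be integrated directly.
\<close>

lemma holo_on_integral:
  fixes f :: "complex ^ 'n \<Rightarrow> 's \<Rightarrow> complex"
  assumes W: "open W"
    and holo: "\<And>s. s \<in> space M \<Longrightarrow> holo_on (\<lambda>z. f z s) W"
    and meas: "\<And>z. z \<in> W \<Longrightarrow> f z \<in> borel_measurable M"
    and dom: "\<And>z0. z0 \<in> W \<Longrightarrow>
      \<exists>r>0. \<exists>B. integrable M B \<and> (\<forall>z\<in>ball z0 r \<inter> W. \<forall>s\<in>space M. norm (f z s) \<le> B s)"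
  shows "holo_on (\<lambda>z. LINT s|M. f z s) W"
  unfolding holo_on_def
proof
  fix z0 assume z0: "z0 \<in> W"
  obtain r0 B where r0: "r0 > 0" and B: "integrable M B"
    and bd0: "\<forall>z\<in>ball z0 r0 \<inter> W. \<forall>s\<in>space M. norm (f z s) \<le> B s"
    using dom[OF z0] by blast
  obtain r1 where r1: "r1 > 0" "ball z0 r1 \<subseteq> W" using W z0 openE by blast
  define r where "r = min r0 r1"
  have r: "r > 0" "ball z0 r \<subseteq> W" and bd: "\<And>z s. z \<in> ball z0 r \<Longrightarrow> s \<in> space M \<Longrightarrow> norm (f z s) \<le> B s"
    using r0 r1 bd0 by (auto simp: r_def)
  have "\<forall>s\<in>space M. \<exists>c :: complex ^ 'n. \<forall>h. norm h \<le> r / 4 \<longrightarrow>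
     norm (f (z0 + h) s - f z0 s - (\<Sum>i\<in>UNIV. c $ i * h $ i)) \<le> 8 * B s / r\<^sup>2 * (norm h)\<^sup>2"
  proof
    fix s assume s: "s \<in> space M"
    have "holo_on (\<lambda>z. f z s) (ball z0 r)" using holo[OF s] r(2) holo_on_subset by blast
    from holo_on_quadratic_remainder[OF this r(1) bd[OF _ s]]
    show "\<exists>c :: complex ^ 'n. \<forall>h. norm h \<le> r / 4 \<longrightarrow>
     norm (f (z0 + h) s - f z0 s - (\<Sum>i\<in>UNIV. c $ i * h $ i)) \<le> 8 * B s / r\<^sup>2 * (norm h)\<^sup>2"
      by blast
  qed
  from bchoice[OF this] obtain c :: "'s \<Rightarrow> complex ^ 'n" where c: "\<And>s h. s \<in> space M \<Longrightarrow> norm h \<le> r / 4 \<Longrightarrow>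
     norm (f (z0 + h) s - f z0 s - (\<Sum>i\<in>UNIV. c s $ i * h $ i)) \<le> 8 * B s / r\<^sup>2 * (norm h)\<^sup>2"
    by blast
  have ax: "norm (f (z0 + axis i (of_real e)) s - f z0 s - c s $ i * of_real e) \<le> 8 * B s / r\<^sup>2 * e\<^sup>2"
    if "s \<in> space M" "0 \<le> e" "e \<le> r / 4" for s i e
  proof -
    have "(\<Sum>j\<in>UNIV. c s $ j * axis i (complex_of_real e) $ j) = c s $ i * of_real e"
      by (subst sum.remove[of _ i]) (auto simp: axis_def)
    then show ?thesis using c[of s "axis i (of_real e)"] that by (simp add: norm_axis_eq)
  qed
  have inW: "z0 + h \<in> W" if "norm h \<le> r / 4" for h
    using r that by (intro subsetD[OF r(2)]) (simp add: dist_norm)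
  \<comment> \<open>The coefficients were chosen separately for each s, so measurability has to be
    recovered: they are pointwise limits of difference quotients along the axes.\<close>
  have cm: "(\<lambda>s. c s $ i) \<in> borel_measurable M" for i
  proof (rule borel_measurable_LIMSEQ_metric)
    define e where "e = (\<lambda>n::nat. r / 4 / real (Suc n))"
    have e: "0 < e n" "e n \<le> r / 4" for n using r by (simp_all add: e_def field_simps)
    show "(\<lambda>s. (f (z0 + axis i (of_real (e n))) s - f z0 s) / of_real (e n)) \<in> borel_measurable M" for n
    proof -
      have "z0 + axis i (of_real (e n)) \<in> W"
        by (intro inW) (use e[of n] in \<open>simp add: norm_axis_eq\<close>)
      then show ?thesis using meas z0 by measurable
    qed
    fix s assume s: "s \<in> space M"
    have lim0: "(\<lambda>n. 8 * B s / r\<^sup>2 * e n) \<longlonglongrightarrow> 0"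
    proof -
      have "e \<longlonglongrightarrow> 0" unfolding e_def
        using tendsto_mult_right_zero[OF LIMSEQ_inverse_real_of_nat, of "r / 4"] by (simp add: field_simps)
      then show ?thesis by (rule tendsto_mult_right_zero)
    qed
    have "(\<lambda>n. (f (z0 + axis i (of_real (e n))) s - f z0 s) / of_real (e n) - c s $ i) \<longlonglongrightarrow> 0"
    proof (rule Lim_null_comparison[OF _ lim0], rule always_eventually, rule allI)
      fix n
      have "(f (z0 + axis i (of_real (e n))) s - f z0 s) / of_real (e n) - c s $ i
         = (f (z0 + axis i (of_real (e n))) s - f z0 s - c s $ i * of_real (e n)) / of_real (e n)"
        using e(1)[of n] by (simp add: field_simps)
      also have "norm \<dots> \<le> 8 * B s / r\<^sup>2 * (e n)\<^sup>2 / e n"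
        using divide_right_mono[OF ax[OF s, of "e n" i], of "e n"] e[of n] by (simp add: norm_divide)
      also have "\<dots> = 8 * B s / r\<^sup>2 * e n" using e(1)[of n] by (simp add: power2_eq_square)
      finally show "norm ((f (z0 + axis i (of_real (e n))) s - f z0 s) / of_real (e n) - c s $ i)
         \<le> 8 * B s / r\<^sup>2 * e n" .
    qed
    then show "(\<lambda>n. (f (z0 + axis i (of_real (e n))) s - f z0 s) / of_real (e n)) \<longlonglongrightarrow> c s $ i"
      by (rule LIM_zero_cancel)
  qed
  \<comment> \<open>The expansion at the single axis step r/4 bounds the coefficient times r/4 by B
    + B + B/2, which explains the factor 10/r.\<close>
  have ci: "integrable M (\<lambda>s. c s $ i)" for i
  proof (rule Bochner_Integration.integrable_bound)
    show "integrable M (\<lambda>s. 10 / r * B s)" using B by simp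
    show "AE s in M. norm (c s $ i) \<le> norm (10 / r * B s)"
    proof (rule AE_I2)
      fix s assume s: "s \<in> space M"
      have B0: "0 \<le> B s" using bd[of z0 s] s r(1) norm_ge_zero order_trans by (metis centre_in_ball)
      have in1: "z0 + axis i (complex_of_real (r / 4)) \<in> ball z0 r"
        using r by (simp add: dist_norm norm_axis_eq)
      have "norm (c s $ i * of_real (r / 4)) \<le> norm (f (z0 + axis i (of_real (r / 4))) s) + norm (f z0 s)
          + norm (f (z0 + axis i (of_real (r / 4))) s - f z0 s - c s $ i * of_real (r / 4))"
        by norm
      also have "\<dots> \<le> B s + B s + 8 * B s / r\<^sup>2 * (r / 4)\<^sup>2"
        using bd[OF in1 s] bd[of z0 s] s ax[OF s, of "r / 4" i] r(1) by simp
      also have "\<dots> = 5 / 2 * B s" using r(1) by (simp add: power2_eq_square field_simps)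
      finally have "norm (c s $ i) * (r / 4) \<le> 5 / 2 * B s" using r(1) by (simp add: norm_mult)
      then have "norm (c s $ i) \<le> 10 / r * B s" using r(1) by (simp add: field_simps)
      also have "\<dots> \<le> norm (10 / r * B s)" unfolding real_norm_def by (rule abs_ge_self)
      finally show "norm (c s $ i) \<le> norm (10 / r * B s)" .
    qed
  qed (rule cm)
  have fi: "integrable M (f z)" if "z \<in> ball z0 r" for z
  proof (rule Bochner_Integration.integrable_bound[OF B])
    show "f z \<in> borel_measurable M" using that r meas by blast
    show "AE s in M. norm (f z s) \<le> norm (B s)"
      using bd[OF that] by (intro AE_I2) (auto intro: order_trans[OF _ abs_ge_self])
  qed
  define C :: "complex ^ 'n" where "C = (\<chi> i. LINT s|M. c s $ i)"
  define K where "K = 8 / r\<^sup>2 * (LINT s|M. B s)"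
  have main: "norm ((LINT s|M. f (z0 + h) s) - (LINT s|M. f z0 s) - (\<Sum>i\<in>UNIV. C $ i * h $ i))
      \<le> K * (norm h)\<^sup>2" if h: "norm h \<le> r / 4" for h
  proof -
    have zh: "z0 + h \<in> ball z0 r" "z0 \<in> ball z0 r" using h r by (simp_all add: dist_norm)
    have "(LINT s|M. f (z0 + h) s) - (LINT s|M. f z0 s) - (\<Sum>i\<in>UNIV. C $ i * h $ i)
      = (LINT s|M. f (z0 + h) s - f z0 s - (\<Sum>i\<in>UNIV. c s $ i * h $ i))"
      using fi[OF zh(1)] fi[OF zh(2)] ci by (simp add: C_def)
    also have "norm \<dots> \<le> (LINT s|M. 8 * B s / r\<^sup>2 * (norm h)\<^sup>2)"
    proof (rule order_trans[OF Bochner_Integration.integral_norm_bound integral_mono])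
      have "integrable M (\<lambda>s. f (z0 + h) s - f z0 s - (\<Sum>i\<in>UNIV. c s $ i * h $ i))"
        using fi[OF zh(1)] fi[OF zh(2)] ci by simp
      then show "integrable M (\<lambda>s. norm (f (z0 + h) s - f z0 s - (\<Sum>i\<in>UNIV. c s $ i * h $ i)))"
        by simp
      show "integrable M (\<lambda>s. 8 * B s / r\<^sup>2 * (norm h)\<^sup>2)" using B by simp
    qed (rule c[OF _ h])
    also have "\<dots> = K * (norm h)\<^sup>2" by (simp add: K_def)
    finally show ?thesis .
  qed
  have "((\<lambda>z. LINT s|M. f z s) has_derivative (\<lambda>h. \<Sum>i\<in>UNIV. C $ i * h $ i)) (at z0)"
  proof (rule has_derivativeI_sandwich[where e = "r / 4" and H = "\<lambda>y. K * norm (y - z0)"])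
    show "bounded_linear (\<lambda>h. \<Sum>i\<in>UNIV. C $ i * h $ i)"
      by (intro bounded_linear_sum bounded_linear_mult_const bounded_linear_const_mult bounded_linear_vec_nth)
    have "((\<lambda>y. K * norm (y - z0)) \<longlongrightarrow> K * norm (z0 - z0)) (at z0)" by (intro tendsto_intros)
    then show "((\<lambda>y. K * norm (y - z0)) \<longlongrightarrow> 0) (at z0)" by simp
    fix y assume y: "y \<noteq> z0" "dist y z0 < r / 4"
    then show "norm ((LINT s|M. f y s) - (LINT s|M. f z0 s) - (\<Sum>i\<in>UNIV. C $ i * (y - z0) $ i))
       / norm (y - z0) \<le> K * norm (y - z0)"
      using main[of "y - z0"] by (simp add: dist_norm field_simps power2_eq_square)
  qed (use r in simp)
  then show "\<exists>c :: complex ^ 'n. ((\<lambda>z. LINT s|M. f z s) has_derivative (\<lambda>h. \<Sum>i\<in>UNIV. c $ i * h $ i)) (at z0)"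
    by blast
qed

section \<open>Division by a linear form\<close>

lemma holo_on_shift:
  fixes d :: "complex ^ 'n"
  assumes f: "holo_on f V" and s: "holo_on s U" and sub: "\<And>z. z \<in> U \<Longrightarrow> z + s z *s d \<in> V"
  shows "holo_on (\<lambda>z. f (z + s z *s d)) U"
  unfolding holo_on_alt
proof
  fix z assume z: "z \<in> U"
  obtain A where A: "(s has_derivative A) (at z)" "\<And>c h. A (c *s h) = c * A h"
    using s z unfolding holo_on_alt by blast
  obtain B where B: "(f has_derivative B) (at (z + s z *s d))" "\<And>c h. B (c *s h) = c * B h"
    using f sub[OF z] unfolding holo_on_alt by blast
  have "((\<lambda>z. z + s z *s d) has_derivative (\<lambda>h. h + A h *s d)) (at z)"
    by (intro has_derivative_add has_derivative_ident
        bounded_linear.has_derivative[OF bounded_linear_smult_left[of d]] A(1))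
  from has_derivative_compose[OF this B(1)]
  have "((\<lambda>z. f (z + s z *s d)) has_derivative (\<lambda>h. B (h + A h *s d))) (at z)" .
  moreover have "c *s h + A (c *s h) *s d = c *s (h + A h *s d)" for c h
    by (simp add: A(2) vec_eq_iff algebra_simps)
  ultimately show "\<exists>A. ((\<lambda>z. f (z + s z *s d)) has_derivative A) (at z) \<and> (\<forall>c h. A (c *s h) = c * A h)"
    by (intro exI[of _ "\<lambda>h. B (h + A h *s d)"]) (simp only: B(2) simp_thms)
qed

lemma dense_Int:
  assumes A: "open A" "V \<subseteq> closure A" and V: "open V" "V \<subseteq> closure B"
  shows "V \<subseteq> closure (V \<inter> A \<inter> B)"
proof
  fix z assume z: "z \<in> V"
  show "z \<in> closure (V \<inter> A \<inter> B)"
    unfolding closure_iff_nhds_not_empty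
  proof (intro allI impI)
    fix N T assume *: "T \<subseteq> N" "open T" "z \<in> T"
    have "T \<inter> V \<inter> A \<noteq> {}"
      using open_Int_closure_eq_empty[of "T \<inter> V" A] * V A z by blast
    then have "T \<inter> V \<inter> A \<inter> B \<noteq> {}"
      using open_Int_closure_eq_empty[of "T \<inter> V \<inter> A" B] * V A by blast
    then show "V \<inter> A \<inter> B \<inter> N \<noteq> {}" using * by blast
  qed
qed

lemma continuous_eq_on_dense:
  fixes f g :: "'a::topological_space \<Rightarrow> 'b::real_normed_vector"
  assumes "open V" "continuous_on V f" "continuous_on V g" "V \<subseteq> closure {z \<in> V. f z = g z}" "z \<in> V"
  shows "f z = g z"
proof (rule ccontr)
  assume ne: "f z \<noteq> g z"
  have "continuous_on V (\<lambda>z. f z - g z)" using assms by (intro continuous_on_diff)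
  from continuous_open_preimage[OF this assms(1) open_Compl[OF closed_singleton[of 0]]]
  have op: "open (V \<inter> (\<lambda>z. f z - g z) -` (- {0}))" by blast
  have "z \<in> V \<inter> (\<lambda>z. f z - g z) -` (- {0})" using ne assms(5) by simp
  moreover have "z \<in> closure {z \<in> V. f z = g z}" using assms(4,5) by blast
  ultimately have "V \<inter> (\<lambda>z. f z - g z) -` (- {0}) \<inter> {z \<in> V. f z = g z} \<noteq> {}"
    using open_Int_closure_eq_empty[OF op] by blast
  then show False by auto
qed

text \<open>Points with a neighbourhood in which \<open>R\<close> is dense along H, and points with
  a neighbourhood missing \<open>R\<close> along H, form two open sets that are disjoint on H and
  cover it. Connectedness excludes the second kind. \<open>R\<close> will be a region of agreement
  or of regularity.\<close>

lemma dense_propagation: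
  fixes H :: "'a::topological_space set"
  assumes H: "connected H" and R: "open R" "H \<inter> R \<noteq> {}"
    and step: "\<And>p. p \<in> H \<Longrightarrow> \<exists>W. open W \<and> p \<in> W \<and> (W \<inter> H \<inter> R \<noteq> {} \<longrightarrow> W \<inter> H \<subseteq> closure (H \<inter> R))"
  shows "H \<subseteq> closure (H \<inter> R)"
proof -
  define T where "T = \<Union>{W. open W \<and> W \<inter> H \<subseteq> closure (H \<inter> R)}"
  define T' where "T' = \<Union>{W. open W \<and> W \<inter> H \<inter> R = {}}"
  have "open T" "open T'" unfolding T_def T'_def by auto
  moreover have "T \<inter> T' \<inter> H = {}"
  proof (rule ccontr)
    assume "T \<inter> T' \<inter> H \<noteq> {}"
    then obtain x W W' where x: "x \<in> H" "x \<in> W" "x \<in> W'" "open W" "open W'"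
      "W \<inter> H \<subseteq> closure (H \<inter> R)" "W' \<inter> H \<inter> R = {}" unfolding T_def T'_def by blast
    then have "W' \<inter> (H \<inter> R) \<noteq> {}"
      using open_Int_closure_eq_empty[of W' "H \<inter> R"] by blast
    with x show False by blast
  qed
  moreover have "H \<subseteq> T \<union> T'"
  proof
    fix p assume "p \<in> H"
    from step[OF this] show "p \<in> T \<union> T'" unfolding T_def T'_def by blast
  qed
  moreover have "R \<subseteq> T" using R(1) closure_subset[of "H \<inter> R"] unfolding T_def by blast
  ultimately have "T' \<inter> H = {}" using connectedD[OF H, of T T'] R(2) by blast
  then have "H \<subseteq> T" using \<open>H \<subseteq> T \<union> T'\<close> by blast
  then show ?thesis unfolding T_def by blast
qed

text \<open>The direction d is normalised so that L itself is the coordinate along each line in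
  direction d. This reduces orders of vanishing along L = 0 to orders of zeros in one
  variable.\<close>

locale linear_form =
  fixes L :: "complex ^ 'n \<Rightarrow> complex" and d :: "complex ^ 'n"
  assumes holo_L: "holo_on L UNIV"
    and L_add: "L (z + t *s d) = L z + t"
    and affine: "complex_affine {z. L z = 0}"
begin

lemma L_nonzero_dense:
  assumes "open V"
  shows "V \<subseteq> closure {z \<in> V. L z \<noteq> 0}"
proof
  fix z assume z: "z \<in> V"
  show "z \<in> closure {z \<in> V. L z \<noteq> 0}"
  proof (cases "L z = 0")
    case True
    have "open {t. z + t *s d \<in> T}" if "open T" for T using that by (rule open_line_preimage)
    show ?thesis unfolding closure_iff_nhds_not_empty
    proof (intro allI impI)
      fix N T assume *: "T \<subseteq> N" "open T" "z \<in> T"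
      have "open {t. z + t *s d \<in> T \<inter> V}" using * assms by (intro open_line_preimage) auto
      moreover have "0 \<in> {t. z + t *s d \<in> T \<inter> V}" using * z by simp
      ultimately obtain e where e: "e > 0" "ball 0 e \<subseteq> {t. z + t *s d \<in> T \<inter> V}"
        using openE by blast
      have "complex_of_real (e / 2) \<in> ball 0 e" using e(1) by simp
      then have "z + complex_of_real (e / 2) *s d \<in> T \<inter> V" using e(2) by blast
      moreover have "L (z + complex_of_real (e / 2) *s d) \<noteq> 0" using e(1) by (simp add: L_add True)
      ultimately show "{z \<in> V. L z \<noteq> 0} \<inter> N \<noteq> {}" using *(1) by blast
    qed
  next
    case False
    then show ?thesis using z closure_subset[of "{z \<in> V. L z \<noteq> 0}"] by blast
  qed
qed

text \<open>Put phi(u) = f(z + (u - L z) d). Then phi(L z) = f z, while phi(0) = 0 because its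
  argument lies on the hyperplane. Subtracting the Cauchy formulas at L z and at 0 gives the kernel
  L z / (u (u - L z)), from which L z factors out. What is left is an integral with bounded
  holomorphic integrand, so F is holomorphic.\<close>

lemma divide_local:
  assumes W: "open W" "z0 \<in> W" and f: "holo_on f W" and z0: "L z0 = 0"
    and 0: "\<And>z. z \<in> W \<Longrightarrow> L z = 0 \<Longrightarrow> f z = 0"
  obtains r F where "r > 0" "ball z0 r \<subseteq> W" "holo_on F (ball z0 r)"
    "\<And>z. z \<in> ball z0 r \<Longrightarrow> f z = L z * F z"
proof -
  obtain R where R: "R > 0" "cball z0 R \<subseteq> W" using W open_contains_cball by blast
  \<comment> \<open>The shift along d is then at most R/2, and together with r at most R/4 it stays
    in the closed ball of radius R. The \<open>+ 1\<close> keeps the denominator positive.\<close>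
  define \<rho> where "\<rho> = R / (4 * (norm d + 1))"
  have nd: "norm d + 1 > 0" by (simp add: add_nonneg_pos)
  have \<rho>: "\<rho> > 0" "\<rho> * norm d \<le> R / 4"
    using R(1) nd by (simp_all add: \<rho>_def field_simps)
  have "continuous_on UNIV L" by (rule holo_on_imp_continuous_on[OF holo_L])
  then have "open (L -` ball 0 (\<rho> / 2))" by (intro open_vimage) auto
  moreover have "z0 \<in> L -` ball 0 (\<rho> / 2)" using z0 \<rho> by simp
  ultimately obtain e where e: "e > 0" "ball z0 e \<subseteq> L -` ball 0 (\<rho> / 2)" using openE by blast
  define r where "r = min e (R / 4)"
  have r: "r > 0" "r \<le> R / 4" using e R by (simp_all add: r_def)
  have Lb: "norm (L z) < \<rho> / 2" if "z \<in> ball z0 r" for z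
    using that e(2) unfolding r_def by (auto simp: dist_norm)
  have inW: "z + (\<zeta> - L z) *s d \<in> cball z0 R" if z: "z \<in> ball z0 r" and \<zeta>: "norm \<zeta> \<le> \<rho>" for z \<zeta>
  proof -
    have "norm (z + (\<zeta> - L z) *s d - z0) \<le> norm (z - z0) + norm (\<zeta> - L z) * norm d"
      using norm_triangle_ineq[of "z - z0" "(\<zeta> - L z) *s d"]
      by (simp only: norm_smult add_diff_eq add.commute add_diff_cancel_left' diff_add_eq)
    also have "\<dots> \<le> r + (\<rho> + \<rho>) * norm d"
    proof (intro add_mono mult_right_mono)
      show "norm (z - z0) \<le> r" using z by (simp add: dist_norm norm_minus_commute)
      show "norm (\<zeta> - L z) \<le> \<rho> + \<rho>"
        using norm_triangle_ineq4[of \<zeta> "L z"] \<zeta> Lb[OF z] \<rho>(1) by simp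
    qed simp
    also have "\<dots> \<le> R" using r \<rho> R by (simp add: algebra_simps)
    finally show ?thesis by (simp add: dist_norm norm_minus_commute)
  qed
  have "compact (f ` cball z0 R)"
    by (intro compact_continuous_image continuous_on_subset[OF holo_on_imp_continuous_on[OF f]] R compact_cball)
  then obtain B where B: "\<And>w. w \<in> cball z0 R \<Longrightarrow> norm (f w) \<le> B"
    using compact_imp_bounded bounded_iff by (metis image_eqI)
  define \<gamma> where "\<gamma> = circlepath 0 \<rho>"
  have \<gamma>: "\<gamma> \<theta> = of_real \<rho> * exp (2 * of_real pi * \<i> * of_real \<theta>)" for \<theta>
    by (simp add: \<gamma>_def circlepath)
  have n\<gamma>: "norm (\<gamma> \<theta>) = \<rho>" for \<theta> using \<rho> by (simp add: \<gamma> norm_mult)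
  have den: "norm (\<gamma> \<theta> - L z) \<ge> \<rho> / 2" if "z \<in> ball z0 r" for z \<theta>
    using norm_triangle_ineq2[of "\<gamma> \<theta>" "L z"] n\<gamma>[of \<theta>] Lb[OF that] by simp
  have nz: "\<gamma> \<theta> - L z \<noteq> 0" if "z \<in> ball z0 r" for z \<theta>
    using den[OF that, of \<theta>] \<rho>(1) by auto
  \<comment> \<open>The velocity of the circle is 2 pi i times its position, so the factor u in the
    denominator of the kernel has cancelled.\<close>
  define g where "g = (\<lambda>z \<theta>. f (z + (\<gamma> \<theta> - L z) *s d) / (\<gamma> \<theta> - L z))"
  define M where "M = lebesgue_on {0..1::real}"
  have gn: "norm (g z \<theta>) \<le> B / (\<rho> / 2)" if "z \<in> ball z0 r" for z \<theta>
    unfolding g_def norm_divide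
    using B[OF inW[OF that, of "\<gamma> \<theta>"]] n\<gamma>[of \<theta>] den[OF that, of \<theta>] \<rho>
    by (intro frac_le) (auto intro: order_trans[OF norm_ge_zero])
  have cont: "continuous_on {0..1} (g z)" if z: "z \<in> ball z0 r" for z
  proof -
    have c\<gamma>: "continuous_on {0..1} \<gamma>" unfolding \<gamma> by (intro continuous_intros)
    have "continuous_on {0..1} (\<lambda>\<theta>. f (z + (\<gamma> \<theta> - L z) *s d))"
    proof (rule continuous_on_compose2[OF holo_on_imp_continuous_on[OF f]])
      show "continuous_on {0..1} (\<lambda>\<theta>. z + (\<gamma> \<theta> - L z) *s d)" by (intro continuous_intros c\<gamma>)
      show "(\<lambda>\<theta>. z + (\<gamma> \<theta> - L z) *s d) ` {0..1} \<subseteq> W"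
        using inW[OF z] n\<gamma> R(2) by (auto simp: image_subset_iff subset_iff)
    qed
    then show ?thesis unfolding g_def by (intro continuous_intros c\<gamma>) (use nz[OF z] in auto)
  qed
  define F where "F = (\<lambda>z. LINT \<theta>|M. g z \<theta>)"
  have meas: "g z \<in> borel_measurable M" if "z \<in> ball z0 r" for z
    unfolding M_def by (rule continuous_imp_measurable_on_sets_lebesgue[OF cont[OF that]]) simp
  have cM: "integrable M (\<lambda>_. B / (\<rho> / 2))" unfolding M_def
    by (rule finite_measure.integrable_const) (auto intro!: finite_measureI simp: emeasure_restrict_space)
  have Fh: "holo_on F (ball z0 r)"
    unfolding F_def
  proof (rule holo_on_integral)
    fix \<theta> assume "\<theta> \<in> space M"
    have hl: "holo_on (\<lambda>z. \<gamma> \<theta> - L z) (ball z0 r)"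
      by (intro holo_on_diff holo_on_const holo_on_subset[OF holo_L]) auto
    have "holo_on (\<lambda>z. f (z + (\<gamma> \<theta> - L z) *s d)) (ball z0 r)"
      by (rule holo_on_shift[OF f hl]) (use inW[OF _ eq_refl[OF n\<gamma>]] R in blast)
    then show "holo_on (\<lambda>z. g z \<theta>) (ball z0 r)" unfolding g_def
      by (rule holo_on_divide[OF _ hl]) (use nz in blast)
  next
    fix w assume w: "w \<in> ball z0 r"
    show "\<exists>r'>0. \<exists>B. integrable M B \<and> (\<forall>z\<in>ball w r' \<inter> ball z0 r. \<forall>s\<in>space M. norm (g z s) \<le> B s)"
      by (intro exI[of _ 1] conjI exI[of _ "\<lambda>_. B / (\<rho> / 2)"] cM ballI gn) auto
  qed (auto intro: meas)
  have "f z = L z * F z" if z: "z \<in> ball z0 r" for z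
  proof -
    define \<phi> where "\<phi> = (\<lambda>u. f (z + (u - L z) *s d))"
    have eq: "z + (u - L z) *s d = (z - L z *s d) + u *s d" for u
      by (simp add: vec_eq_iff algebra_simps)
    have inW': "z - L z *s d + t *s d \<in> W" if "norm t \<le> \<rho>" for t
      using subsetD[OF R(2) inW[OF z that]] unfolding eq .
    have "\<phi> holomorphic_on cball 0 \<rho>"
      unfolding \<phi>_def eq
      by (rule holomorphic_on_subset[OF holo_on_line[OF f]]) (use inW' in auto)
    note C = Cauchy_integral_circlepath_simple[OF this]
    have 1: "((\<lambda>u. \<phi> u / (u - L z)) has_contour_integral (2 * of_real pi * \<i> * \<phi> (L z))) \<gamma>"
      unfolding \<gamma>_def by (rule C) (use Lb[OF z] \<rho> in simp)
    have 2: "((\<lambda>u. \<phi> u / (u - 0)) has_contour_integral (2 * of_real pi * \<i> * \<phi> 0)) \<gamma>"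
      unfolding \<gamma>_def by (rule C) (use \<rho> in simp)
    have "z + (0 - L z) *s d \<in> W" using inW[OF z, of 0] \<rho> R(2) by auto
    then have "\<phi> 0 = 0" unfolding \<phi>_def using 0[of "z + (0 - L z) *s d"] by (simp only: L_add) simp
    then have "((\<lambda>u. \<phi> u / (u - L z) - \<phi> u / (u - 0)) has_contour_integral (2 * of_real pi * \<i> * f z)) \<gamma>"
      using has_contour_integral_diff[OF 1 2] by (simp add: \<phi>_def)
    then have "((\<lambda>\<theta>. (\<phi> (\<gamma> \<theta>) / (\<gamma> \<theta> - L z) - \<phi> (\<gamma> \<theta>) / (\<gamma> \<theta> - 0)) * vector_derivative \<gamma> (at \<theta>))
       has_integral (2 * of_real pi * \<i> * f z)) {0..1}"
      unfolding has_contour_integral .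
    moreover have "(\<phi> (\<gamma> \<theta>) / (\<gamma> \<theta> - L z) - \<phi> (\<gamma> \<theta>) / (\<gamma> \<theta> - 0)) * vector_derivative \<gamma> (at \<theta>)
       = 2 * of_real pi * \<i> * L z * g z \<theta>" for \<theta>
    proof -
      have "vector_derivative \<gamma> (at \<theta>) = 2 * of_real pi * \<i> * \<gamma> \<theta>"
        by (subst \<gamma>) (simp add: \<gamma>_def vector_derivative_circlepath algebra_simps)
      moreover have "\<gamma> \<theta> \<noteq> 0" using n\<gamma>[of \<theta>] \<rho>(1) by auto
      ultimately show ?thesis using nz[OF z, of \<theta>] by (simp add: g_def \<phi>_def field_simps)
    qed
    ultimately have "((\<lambda>\<theta>. 2 * of_real pi * \<i> * L z * g z \<theta>) has_integral (2 * of_real pi * \<i> * f z)) {0..1}"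
      by simp
    moreover have "(g z has_integral F z) {0..1}"
    proof -
      have "integrable M (g z)"
        by (rule Bochner_Integration.integrable_bound[OF cM meas[OF z]])
          (intro AE_I2 order_trans[OF gn[OF z]], simp only: real_norm_def abs_ge_self)
      then have "F z = integral {0..1} (g z)"
        unfolding F_def M_def by (rule lebesgue_integral_eq_integral) simp
      moreover have "g z integrable_on {0..1}" by (rule integrable_continuous_real[OF cont[OF z]])
      ultimately show ?thesis using integrable_integral by metis
    qed
    then have "((\<lambda>\<theta>. 2 * of_real pi * \<i> * L z * g z \<theta>) has_integral (2 * of_real pi * \<i> * L z * F z)) {0..1}"
      by (rule has_integral_mult_right)
    ultimately have "2 * of_real pi * \<i> * f z = 2 * of_real pi * \<i> * L z * F z"
      by (rule has_integral_unique)
    then show ?thesis by simp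
  qed
  moreover have "ball z0 r \<subseteq> W"
    using r(2) R by (auto intro!: subsetD[OF R(2)])
  ultimately show ?thesis using that r(1) Fh by blast
qed

text \<open>Local quotients glue because each equals one explicit function: f / L off the
  hyperplane, and on it the derivative of f in direction d, by the product rule.\<close>

lemma divide:
  assumes W: "open W" and f: "holo_on f W"
    and 0: "\<And>z. z \<in> W \<Longrightarrow> L z = 0 \<Longrightarrow> f z = 0"
  obtains F where "holo_on F W" "\<And>z. z \<in> W \<Longrightarrow> f z = L z * F z"
proof -
  define F where "F = (\<lambda>z. if L z = 0 then deriv (\<lambda>t. f (z + t *s d)) 0 else f z / L z)"
  have "holo_on F W"
  proof (rule holo_on_locally)
    fix z0 assume z0: "z0 \<in> W"
    show "\<exists>V. z0 \<in> V \<and> holo_on F V"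
    proof (cases "L z0 = 0")
      case True
      obtain r E where E: "r > 0" "ball z0 r \<subseteq> W" "holo_on E (ball z0 r)"
        "\<And>z. z \<in> ball z0 r \<Longrightarrow> f z = L z * E z"
        using divide_local[OF W z0 f True 0] by blast
      have "E z = F z" if z: "z \<in> ball z0 r" for z
      proof (cases "L z = 0")
        case True
        have T: "open {t. z + t *s d \<in> ball z0 r}" by (rule open_line_preimage) simp
        have 0: "0 \<in> {t. z + t *s d \<in> ball z0 r}" using z by simp
        obtain D where D: "((\<lambda>t. E (z + t *s d)) has_field_derivative D) (at 0)"
          using holomorphic_derivI[OF holo_on_line[OF E(3)] T 0] by blast
        have "((\<lambda>t. t * E (z + t *s d)) has_field_derivative E z) (at 0)"
          using DERIV_mult[OF DERIV_ident D] by simp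
        then have "((\<lambda>t. f (z + t *s d)) has_field_derivative E z) (at 0)"
          by (rule has_field_derivative_transform_within_open[OF _ T 0]) (simp add: E(4) L_add True)
        then show ?thesis using True by (simp add: F_def DERIV_imp_deriv)
      next
        case False
        then show ?thesis using E(4)[OF z] by (simp add: F_def)
      qed
      then have "holo_on F (ball z0 r)"
        by (intro holo_on_transform[OF E(3)]) (use open_ball in blast)
      then show ?thesis using E(1) by (intro exI[of _ "ball z0 r"]) simp
    next
      case False
      define V where "V = {z \<in> W. L z \<noteq> 0}"
      have "continuous_on W L" using continuous_on_subset[OF holo_on_imp_continuous_on[OF holo_L]] by simp
      from continuous_open_preimage[OF this W open_Compl[OF closed_singleton[of 0]]]
      have "open (W \<inter> L -` (- {0}))" by blast
      moreover have "W \<inter> L -` (- {0}) = V" by (auto simp: V_def)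
      ultimately have V: "open V" by simp
      have "holo_on (\<lambda>z. f z / L z) V"
        by (intro holo_on_divide holo_on_subset[OF f] holo_on_subset[OF holo_L]) (auto simp: V_def)
      then have "holo_on F V"
        by (rule holo_on_transform) (use V in \<open>auto intro!: exI[of _ V] simp: V_def F_def\<close>)
      then show ?thesis using False z0 by (intro exI[of _ V]) (simp add: V_def)
    qed
  qed
  moreover have "f z = L z * F z" if "z \<in> W" for z
    using 0[OF that] by (simp add: F_def)
  ultimately show ?thesis using that by blast
qed

end

section \<open>Meromorphic functions on subspaces\<close>

text \<open>A ball supplies the convexity that the identity theorem requires, and density of the
  nonzero set, being local, survives the shrinking.\<close>

lemma mero_on_ball:
  assumes M: "mero_on M H" and p: "p \<in> H"
  obtains r g h where "r > 0" "holo_on g (ball p r)" "holo_on h (ball p r)"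
    "ball p r \<inter> H \<subseteq> closure {z \<in> ball p r \<inter> H. h z \<noteq> 0}"
    "\<And>z. z \<in> ball p r \<inter> H \<Longrightarrow> h z \<noteq> 0 \<Longrightarrow> M z = g z / h z"
proof -
  define Q where "Q = (\<lambda>W g h. open W \<and> p \<in> W \<and> holo_on g W \<and> holo_on h W \<and>
      W \<inter> H \<subseteq> closure {z \<in> W \<inter> H. h z \<noteq> 0} \<and>
      (\<forall>z \<in> W \<inter> H. h z \<noteq> 0 \<longrightarrow> M z = g z / h z))"
  have "\<exists>W g h. Q W g h"
    using bspec[OF M[unfolded mero_on_def] p] by (simp only: Q_def)
  then obtain W g h where "Q W g h" by blast
  then have W: "open W" "p \<in> W" "holo_on g W" "holo_on h W"
      "W \<inter> H \<subseteq> closure {z \<in> W \<inter> H. h z \<noteq> 0}"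
      "\<forall>z \<in> W \<inter> H. h z \<noteq> 0 \<longrightarrow> M z = g z / h z"
    unfolding Q_def by - (elim conjE, assumption)+
  obtain r where r: "r > 0" "ball p r \<subseteq> W" using W(1,2) openE by blast
  show ?thesis
  proof (rule that[of r g h])
    show "ball p r \<inter> H \<subseteq> closure {z \<in> ball p r \<inter> H. h z \<noteq> 0}"
    proof
      fix z assume z: "z \<in> ball p r \<inter> H"
      show "z \<in> closure {z \<in> ball p r \<inter> H. h z \<noteq> 0}"
        unfolding closure_iff_nhds_not_empty
      proof (intro allI impI)
        fix N T assume *: "T \<subseteq> N" "open T" "z \<in> T"
        have "T \<inter> ball p r \<inter> {z \<in> W \<inter> H. h z \<noteq> 0} \<noteq> {}"
          using open_Int_closure_eq_empty[of "T \<inter> ball p r" "{z \<in> W \<inter> H. h z \<noteq> 0}"] z * W(5) r(2) by blast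
        then show "{z \<in> ball p r \<inter> H. h z \<noteq> 0} \<inter> N \<noteq> {}" using *(1) by blast
      qed
    qed
  qed (use r W(6) holo_on_subset[OF W(3) r(2)] holo_on_subset[OF W(4) r(2)] in auto)
qed

lemma dense_nonempty:
  assumes "A \<subseteq> closure {z \<in> A. P z}" "p \<in> A" "open U" "p \<in> U"
  obtains z where "z \<in> A" "P z" "z \<in> U"
  using assms open_Int_closure_eq_empty[of U "{z \<in> A. P z}"] by blast

lemma mero_onI_ball:
  assumes H: "complex_affine H"
    and loc: "\<And>p. p \<in> H \<Longrightarrow> \<exists>r g h. r > 0 \<and> holo_on g (ball p r) \<and> holo_on h (ball p r) \<and>
      (\<exists>z\<in>ball p r \<inter> H. h z \<noteq> 0) \<and> (\<forall>z\<in>ball p r \<inter> H. h z \<noteq> 0 \<longrightarrow> M z = g z / h z)"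
  shows "mero_on M H"
  unfolding mero_on_def
proof
  fix p assume "p \<in> H"
  then obtain r g h w where *: "r > 0" "holo_on g (ball p r)" "holo_on h (ball p r)"
      "w \<in> ball p r \<inter> H" "h w \<noteq> 0" "\<forall>z\<in>ball p r \<inter> H. h z \<noteq> 0 \<longrightarrow> M z = g z / h z"
    using loc by blast
  have "ball p r \<inter> H \<subseteq> closure {z \<in> ball p r \<inter> H. h z \<noteq> 0}"
    by (rule holo_on_nonzero_dense[OF *(3) open_ball convex_ball H _ _ *(5)]) (use *(4) in auto)
  then show "\<exists>W g h. open W \<and> p \<in> W \<and> holo_on g W \<and> holo_on h W \<and>
        W \<inter> H \<subseteq> closure {z \<in> W \<inter> H. h z \<noteq> 0} \<and> (\<forall>z \<in> W \<inter> H. h z \<noteq> 0 \<longrightarrow> M z = g z / h z)"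
    using * by (intro exI[of _ "ball p r"] exI[of _ g] exI[of _ h]) simp
qed

lemma holo_on_imp_mero_on:
  assumes "complex_affine H" "holo_on f UNIV"
  shows "mero_on f H"
proof (rule mero_onI_ball[OF assms(1)])
  fix p assume "p \<in> H"
  then show "\<exists>r g h. r > 0 \<and> holo_on g (ball p r) \<and> holo_on h (ball p r) \<and>
      (\<exists>z\<in>ball p r \<inter> H. h z \<noteq> 0) \<and> (\<forall>z\<in>ball p r \<inter> H. h z \<noteq> 0 \<longrightarrow> f z = g z / h z)"
    by (intro exI[of _ "1::real"] exI[of _ f] exI[of _ "\<lambda>_. 1"] conjI bexI[of _ p]
        holo_on_subset[OF assms(2)] holo_on_const) auto
qed

lemma nonzero_both:
  fixes h :: "complex ^ 'n \<Rightarrow> complex"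
  assumes h: "holo_on h W" "z1 \<in> W \<inter> H" "h z1 \<noteq> 0" "open W"
    and k: "W \<inter> H \<subseteq> closure {z \<in> W \<inter> H. k z \<noteq> 0}"
  obtains z where "z \<in> W \<inter> H" "h z \<noteq> 0" "k z \<noteq> 0"
proof -
  from continuous_open_preimage[OF holo_on_imp_continuous_on[OF h(1)] h(4) open_Compl[OF closed_singleton[of 0]]]
  have "open (W \<inter> h -` (- {0}))" .
  from dense_nonempty[OF k h(2) this] h obtain z where
    "z \<in> W \<inter> H" "k z \<noteq> 0" "z \<in> W \<inter> h -` (- {0})" by auto
  then show ?thesis using that by auto
qed

lemma mero_on_mult:
  assumes H: "complex_affine H" and M: "mero_on M1 H" "mero_on M2 H"
  shows "mero_on (\<lambda>z. M1 z * M2 z) H"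
proof (rule mero_onI_ball[OF H])
  fix p assume p: "p \<in> H"
  obtain r1 g1 h1 where 1: "r1 > 0" "holo_on g1 (ball p r1)" "holo_on h1 (ball p r1)"
    "ball p r1 \<inter> H \<subseteq> closure {z \<in> ball p r1 \<inter> H. h1 z \<noteq> 0}"
    "\<And>z. z \<in> ball p r1 \<inter> H \<Longrightarrow> h1 z \<noteq> 0 \<Longrightarrow> M1 z = g1 z / h1 z"
    using mero_on_ball[OF M(1) p] by blast
  obtain r2 g2 h2 where 2: "r2 > 0" "holo_on g2 (ball p r2)" "holo_on h2 (ball p r2)"
    "ball p r2 \<inter> H \<subseteq> closure {z \<in> ball p r2 \<inter> H. h2 z \<noteq> 0}"
    "\<And>z. z \<in> ball p r2 \<inter> H \<Longrightarrow> h2 z \<noteq> 0 \<Longrightarrow> M2 z = g2 z / h2 z"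
    using mero_on_ball[OF M(2) p] by blast
  define r where "r = min r1 r2"
  have r: "r > 0" "ball p r \<subseteq> ball p r1" "ball p r \<subseteq> ball p r2" using 1(1) 2(1) by (auto simp: r_def)
  obtain z1 where z1: "z1 \<in> ball p r1 \<inter> H" "h1 z1 \<noteq> 0" "z1 \<in> ball p r"
    using dense_nonempty[OF 1(4) _ open_ball[of p r]] p r 1(1) by (metis IntI centre_in_ball)
  have "ball p r \<inter> H \<subseteq> closure {z \<in> ball p r \<inter> H. h2 z \<noteq> 0}"
  proof -
    obtain z2 where "z2 \<in> ball p r2 \<inter> H" "h2 z2 \<noteq> 0" "z2 \<in> ball p r"
      using dense_nonempty[OF 2(4) _ open_ball[of p r]] p r 2(1) by (metis IntI centre_in_ball)
    then show ?thesis
      using holo_on_nonzero_dense[OF holo_on_subset[OF 2(3) r(3)] open_ball convex_ball H, of z2] by blast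
  qed
  then obtain z where "z \<in> ball p r \<inter> H" "h1 z \<noteq> 0" "h2 z \<noteq> 0"
    using nonzero_both[OF holo_on_subset[OF 1(3) r(2)] _ z1(2) open_ball] z1 by blast
  then show "\<exists>r g h. r > 0 \<and> holo_on g (ball p r) \<and> holo_on h (ball p r) \<and>
      (\<exists>z\<in>ball p r \<inter> H. h z \<noteq> 0) \<and> (\<forall>z\<in>ball p r \<inter> H. h z \<noteq> 0 \<longrightarrow> M1 z * M2 z = g z / h z)"
    using r 1(5) 2(5)
    by (intro exI[of _ r] exI[of _ "\<lambda>z. g1 z * g2 z"] exI[of _ "\<lambda>z. h1 z * h2 z"])
      (auto intro!: holo_on_mult holo_on_subset[OF 1(2)] holo_on_subset[OF 1(3)]
        holo_on_subset[OF 2(2)] holo_on_subset[OF 2(3)] bexI[of _ z] simp: subset_iff)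
qed

lemma mero_on_const: "complex_affine H \<Longrightarrow> mero_on (\<lambda>_. c) H"
  by (rule holo_on_imp_mero_on) (auto intro: holo_on_const)

lemma mero_on_prod:
  assumes "complex_affine H" "\<And>i. i \<in> I \<Longrightarrow> mero_on (M i) H"
  shows "mero_on (\<lambda>z. \<Prod>i\<in>I. M i z) H"
  using assms(2)
  by (induction I rule: infinite_finite_induct) (auto intro: mero_on_mult mero_on_const assms(1))

text \<open>On a ball the cross-multiplied difference of the two quotients vanishes wherever the
  functions agree on an open piece, hence throughout, so agreement spreads from ball to ball. It
  holds only generically, since nothing is known where a denominator vanishes.\<close>

lemma mero_on_identity:
  assumes H: "complex_affine H" and M: "mero_on M1 H" "mero_on M2 H"
    and U0: "open U0" "q \<in> U0" "q \<in> H" and eq: "\<And>z. z \<in> U0 \<inter> H \<Longrightarrow> M1 z = M2 z"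
  shows "generically_on H (\<lambda>z. M1 z = M2 z)"
proof -
  define R where "R = \<Union>{U. open U \<and> (\<forall>z\<in>U \<inter> H. M1 z = M2 z)}"
  have R: "open R" unfolding R_def by auto
  have "H \<inter> R \<noteq> {}" using U0 eq unfolding R_def by blast
  moreover have "connected H" using complex_affine_convex[OF H] convex_connected by blast
  ultimately have "H \<subseteq> closure (H \<inter> R)"
  proof (intro dense_propagation R)
    fix p assume p: "p \<in> H"
    obtain r1 g1 h1 where 1: "r1 > 0" "holo_on g1 (ball p r1)" "holo_on h1 (ball p r1)"
      "ball p r1 \<inter> H \<subseteq> closure {z \<in> ball p r1 \<inter> H. h1 z \<noteq> 0}"
      "\<And>z. z \<in> ball p r1 \<inter> H \<Longrightarrow> h1 z \<noteq> 0 \<Longrightarrow> M1 z = g1 z / h1 z"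
      using mero_on_ball[OF M(1) p] by blast
    obtain r2 g2 h2 where 2: "r2 > 0" "holo_on g2 (ball p r2)" "holo_on h2 (ball p r2)"
      "ball p r2 \<inter> H \<subseteq> closure {z \<in> ball p r2 \<inter> H. h2 z \<noteq> 0}"
      "\<And>z. z \<in> ball p r2 \<inter> H \<Longrightarrow> h2 z \<noteq> 0 \<Longrightarrow> M2 z = g2 z / h2 z"
      using mero_on_ball[OF M(2) p] by blast
    define r where "r = min r1 r2"
    define W where "W = ball p r"
    have r: "r > 0" "W \<subseteq> ball p r1" "W \<subseteq> ball p r2" "open W" "convex W" "p \<in> W"
      using 1(1) 2(1) by (auto simp: r_def W_def)
    obtain z1 where z1: "z1 \<in> ball p r1 \<inter> H" "h1 z1 \<noteq> 0" "z1 \<in> W"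
      using dense_nonempty[OF 1(4) _ r(4)] p r 1(1) by (metis IntI centre_in_ball)
    obtain z2 where z2: "z2 \<in> ball p r2 \<inter> H" "h2 z2 \<noteq> 0" "z2 \<in> W"
      using dense_nonempty[OF 2(4) _ r(4)] p r 2(1) by (metis IntI centre_in_ball)
    have holo: "holo_on g1 W" "holo_on h1 W" "holo_on g2 W" "holo_on h2 W"
      using 1(2,3) 2(2,3) r(2,3) holo_on_subset by blast+
    have d2: "W \<inter> H \<subseteq> closure {z \<in> W \<inter> H. h2 z \<noteq> 0}"
      using holo_on_nonzero_dense[OF holo(4) r(4,5) H z2(3) _ z2(2)] z2(1) by blast
    obtain z3 where z3: "z3 \<in> W \<inter> H" "h1 z3 \<noteq> 0" "h2 z3 \<noteq> 0"
      using nonzero_both[OF holo(2) _ z1(2) r(4) d2] z1 by blast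
    have hh: "holo_on (\<lambda>z. h1 z * h2 z) W" by (intro holo_on_mult holo)
    have dense: "W \<inter> H \<subseteq> closure {z \<in> W \<inter> H. h1 z * h2 z \<noteq> 0}"
      by (rule holo_on_nonzero_dense[OF hh r(4,5) H, of z3]) (use z3 in auto)
    have "W \<inter> H \<subseteq> closure (H \<inter> R)" if ne: "W \<inter> H \<inter> R \<noteq> {}"
    proof -
      obtain U q' where U: "open U" "q' \<in> U" "q' \<in> W" "q' \<in> H" "\<And>z. z \<in> U \<inter> H \<Longrightarrow> M1 z = M2 z"
        using ne unfolding R_def by blast
      \<comment> \<open>The extra factor \<open>h1 z * h2 z\<close> makes f vanish also at the
        points of U where a denominator is zero and the given agreement says nothing about the
        numerators.\<close>
      define f where "f = (\<lambda>z. (g1 z * h2 z - g2 z * h1 z) * (h1 z * h2 z))"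
      have f: "holo_on f W" unfolding f_def by (intro holo_on_mult holo_on_diff holo)
      have f0: "f z = 0" if z: "z \<in> W" "z \<in> H" for z
      proof (rule holo_on_identity[OF f r(4,5) H U(1-4) z])
        fix w assume w: "w \<in> U \<inter> W \<inter> H"
        show "f w = 0"
        proof (cases "h1 w = 0 \<or> h2 w = 0")
          case False
          have "w \<in> ball p r1 \<inter> H" "w \<in> ball p r2 \<inter> H" "w \<in> U \<inter> H" using w r(2,3) by blast+
          then have "g1 w / h1 w = g2 w / h2 w" using U(5)[of w] 1(5)[of w] 2(5)[of w] False by simp
          then show ?thesis using False by (simp add: f_def field_simps)
        qed (auto simp: f_def)
      qed
      have cont: "continuous_on W (\<lambda>z. h1 z * h2 z)" by (rule holo_on_imp_continuous_on[OF hh])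
      from continuous_open_preimage[OF this r(4) open_Compl[OF closed_singleton[of 0]]]
      have op: "open (W \<inter> (\<lambda>z. h1 z * h2 z) -` (- {0}))" .
      have "M1 z = M2 z" if z: "z \<in> W \<inter> (\<lambda>z. h1 z * h2 z) -` (- {0}) \<inter> H" for z
      proof -
        have nz: "h1 z \<noteq> 0" "h2 z \<noteq> 0" using z by auto
        have "z \<in> ball p r1 \<inter> H" "z \<in> ball p r2 \<inter> H" "z \<in> W" "z \<in> H" using z r(2,3) by blast+
        then have "M1 z = g1 z / h1 z" "M2 z = g2 z / h2 z" "g1 z * h2 z = g2 z * h1 z"
          using f0[of z] 1(5)[of z] 2(5)[of z] nz by (simp_all add: f_def)
        then show ?thesis using nz by (simp add: frac_eq_eq)
      qed
      then have "W \<inter> (\<lambda>z. h1 z * h2 z) -` (- {0}) \<subseteq> R" unfolding R_def using op by blast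
      then have "{z \<in> W \<inter> H. h1 z * h2 z \<noteq> 0} \<subseteq> H \<inter> R" by auto
      then show ?thesis using dense closure_mono by blast
    qed
    then show "\<exists>W. open W \<and> p \<in> W \<and> (W \<inter> H \<inter> R \<noteq> {} \<longrightarrow> W \<inter> H \<subseteq> closure (H \<inter> R))"
      using r by blast
  qed auto
  then show ?thesis unfolding generically_on_def using R unfolding R_def by blast
qed

lemma generically_on_conj:
  assumes "generically_on H P" "generically_on H Q"
  shows "generically_on H (\<lambda>z. P z \<and> Q z)"
proof -
  obtain U where U: "open U" "H \<subseteq> closure (H \<inter> U)" "\<forall>z\<in>H \<inter> U. P z"
    using assms(1) unfolding generically_on_def by blast
  obtain V where V: "open V" "H \<subseteq> closure (H \<inter> V)" "\<forall>z\<in>H \<inter> V. Q z"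
    using assms(2) unfolding generically_on_def by blast
  have "H \<subseteq> closure (H \<inter> (U \<inter> V))"
  proof
    fix z assume z: "z \<in> H"
    show "z \<in> closure (H \<inter> (U \<inter> V))"
      unfolding closure_iff_nhds_not_empty
    proof (intro allI impI)
      fix N T assume *: "T \<subseteq> N" "open T" "z \<in> T"
      obtain w where "w \<in> H \<inter> U \<inter> T" using open_Int_closure_eq_empty[of T "H \<inter> U"] * z U by blast
      then have "T \<inter> U \<inter> (H \<inter> V) \<noteq> {}"
        using open_Int_closure_eq_empty[of "T \<inter> U" "H \<inter> V"] *(2) U(1) V(2) by blast
      then show "H \<inter> (U \<inter> V) \<inter> N \<noteq> {}" using *(1) by blast
    qed
  qed
  then show ?thesis using U V unfolding generically_on_def by (intro exI[of _ "U \<inter> V"]) auto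
qed

lemma generically_on_ball:
  assumes "finite A" "\<And>k. k \<in> A \<Longrightarrow> generically_on H (P k)"
  shows "generically_on H (\<lambda>z. \<forall>k\<in>A. P k z)"
  using assms
proof (induction A)
  case empty
  then show ?case using closure_subset[of H] by (auto simp: generically_on_def intro!: exI[of _ UNIV])
next
  case (insert k A)
  then show ?case by (simp add: generically_on_conj)
qed

section \<open>Values at regular points and the order of a pole along a hyperplane\<close>

lemma has_mero_value_imp_mero_value: "has_mero_value M p c \<Longrightarrow> mero_value M p = c"
  unfolding mero_value_def by (rule the_equality) (auto intro: has_mero_value_unique)

lemma open_regular: "open {p. regular_at M p}"
  unfolding open_subopen[of "{p. regular_at M p}"]
proof
  fix p assume "p \<in> {p. regular_at M p}"
  then obtain W F where "open W" "p \<in> W" "holo_on F W" "W \<subseteq> closure (interior {z \<in> W. F z = M z})"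
    unfolding regular_at_def has_mero_value_def by blast
  then show "\<exists>T. open T \<and> p \<in> T \<and> T \<subseteq> {p. regular_at M p}"
    unfolding regular_at_def has_mero_value_def by (intro exI[of _ W]) blast
qed

lemma has_mero_valueI:
  assumes "open W" "p \<in> W" "holo_on F W" "open A" "W \<subseteq> closure A" "A \<subseteq> W"
    "\<And>z. z \<in> A \<Longrightarrow> F z = M z"
  shows "has_mero_value M p (F p)"
proof -
  have "A \<subseteq> interior {z \<in> W. F z = M z}" using assms by (intro interior_maximal) auto
  then have "W \<subseteq> closure (interior {z \<in> W. F z = M z})" using assms(5) closure_mono by blast
  then show ?thesis unfolding has_mero_value_def using assms by blast
qed

context linear_form
begin

text \<open>The order of vanishing of h along L = 0 is finite. Otherwise every power of L divides h,
  and on a line in direction d on which h is not identically zero this contradicts the finite order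
  of its zero at the hyperplane.\<close>

lemma power_factor:
  assumes W: "open W" "convex W" and p: "p \<in> W" "L p = 0" and h: "holo_on h W"
    and dense: "W \<subseteq> closure {z \<in> W. h z \<noteq> 0}"
  obtains b h1 w where "holo_on h1 W" "\<And>z. z \<in> W \<Longrightarrow> h z = L z ^ b * h1 z" "w \<in> W" "L w = 0" "h1 w \<noteq> 0"
proof (rule ccontr)
  assume neg: "\<not> thesis"
  note concl = that
  have fac: "\<exists>hb. holo_on hb W \<and> (\<forall>z\<in>W. h z = L z ^ b * hb z)" for b
  proof (induction b)
    case 0
    then show ?case using h by auto
  next
    case (Suc b)
    then obtain hb where hb: "holo_on hb W" "\<forall>z\<in>W. h z = L z ^ b * hb z" by blast
    have "hb z = 0" if z: "z \<in> W" "L z = 0" for z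
    proof (rule ccontr)
      assume "hb z \<noteq> 0"
      then have thesis by (intro concl[OF hb(1) _ z]) (use hb(2) in auto)
      with neg show False by simp
    qed
    then obtain F where "holo_on F W" "\<And>z. z \<in> W \<Longrightarrow> hb z = L z * F z"
      using divide[OF W(1) hb(1)] by blast
    then show ?case using hb(2) by (intro exI[of _ F]) simp
  qed
  \<comment> \<open>Points whose projection along d to the hyperplane stays in W; a nonzero point of
    h chosen here lies on a line that meets the hyperplane inside W.\<close>
  define V where "V = (\<lambda>z. z - L z *s d) -` W"
  have "continuous_on UNIV (\<lambda>z. z - L z *s d)"
    by (intro continuous_intros holo_on_imp_continuous_on[OF holo_L])
  then have "open V" unfolding V_def by (rule open_vimage[OF W(1)])
  moreover have "p \<in> V" using p by (simp add: V_def)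
  ultimately obtain w where w: "w \<in> W" "h w \<noteq> 0" "w \<in> V"
    using dense_nonempty[OF dense p(1)] by blast
  define q where "q = w - L w *s d"
  have q: "q \<in> W" "L q = 0" "q + L w *s d = w"
    using w(3) L_add[of w "- L w"] by (simp_all add: V_def q_def vec_eq_iff)
  have Lq: "L (q + t *s d) = t" for t using L_add[of q t] q(2) by simp
  define T where "T = {t. q + t *s d \<in> W}"
  define \<phi> where "\<phi> = (\<lambda>t. h (q + t *s d))"
  have T: "open T" "connected T" "0 \<in> T" "L w \<in> T"
    using open_line_preimage[OF W(1)] convex_connected[OF convex_line_preimage[OF W(2)]] q w
    by (simp_all add: T_def)
  have \<phi>: "\<phi> holomorphic_on T" unfolding \<phi>_def T_def by (rule holo_on_line[OF h])
  have \<phi>0: "\<phi> 0 = 0"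
  proof -
    obtain hb where "holo_on hb W" "\<forall>z\<in>W. h z = L z ^ 1 * hb z" using fac[of 1] by blast
    then show ?thesis using q Lq[of 0] by (simp add: \<phi>_def)
  qed
  have "\<not> \<phi> constant_on T"
    using T(3,4) \<phi>0 w(2) q(3) unfolding constant_on_def \<phi>_def by metis
  then obtain g r n where g: "0 < n" "0 < r" "ball 0 r \<subseteq> T" "g holomorphic_on ball 0 r"
      "\<And>t. t \<in> ball 0 r \<Longrightarrow> \<phi> t = (t - 0) ^ n * g t" "\<And>t. t \<in> ball 0 r \<Longrightarrow> g t \<noteq> 0"
    by (rule holomorphic_factor_zero_nonconstant[OF \<phi> T(1,2,3) \<phi>0]) (rule that)
  \<comment> \<open>One power more than the order n of the zero: the nonvanishing cofactor g would
    then equal t times a holomorphic function and vanish at 0.\<close>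
  obtain hb where hb: "holo_on hb W" "\<forall>z\<in>W. h z = L z ^ Suc n * hb z" using fac by blast
  define \<psi> where "\<psi> = (\<lambda>t. t * hb (q + t *s d))"
  have \<psi>: "\<psi> holomorphic_on T" unfolding \<psi>_def T_def
    by (intro holomorphic_intros holo_on_line[OF hb(1)])
  have eq: "g t = \<psi> t" if "t \<in> ball 0 r" "t \<noteq> 0" for t
  proof -
    have "t ^ n * g t = t ^ Suc n * hb (q + t *s d)"
      using g(5)[OF that(1)] hb(2) g(3) that(1) Lq[of t] unfolding \<phi>_def T_def by auto
    then show ?thesis using that(2) by (simp add: \<psi>_def)
  qed
  have "continuous_on (ball 0 r) g" "continuous_on (ball 0 r) \<psi>"
    using g(3,4) \<psi> holomorphic_on_imp_continuous_on holomorphic_on_subset by blast+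
  then have "isCont g 0" "isCont \<psi> 0"
    using g(2) by (simp_all add: continuous_on_eq_continuous_at)
  then have 1: "(g \<longlongrightarrow> g 0) (at 0)" and 2: "(\<psi> \<longlongrightarrow> \<psi> 0) (at 0)" by (auto simp: isCont_def)
  have "eventually (\<lambda>t. t \<in> ball 0 r \<and> t \<noteq> 0) (at (0::complex))"
    using g(2) by (auto simp: eventually_at dist_commute intro!: exI[of _ r])
  then have "eventually (\<lambda>t. g t = \<psi> t) (at 0)" by eventually_elim (use eq in blast)
  then have "(g \<longlongrightarrow> \<psi> 0) (at 0)" using 2 tendsto_cong by blast
  then have "g 0 = \<psi> 0" using 1 tendsto_unique trivial_limit_at by blast
  then show False using g(2) g(6)[of 0] by (simp add: \<psi>_def)
qed

text \<open>Each factor L forces G to vanish on the hyperplane near q, hence, by the identity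
  theorem inside the hyperplane, on all of it in W, so G can be divided globally. Cancelling L in
  the local equation uses continuity and the density of L \<noteq> 0.\<close>

lemma power_divide:
  assumes W: "open W" "convex W" and U: "open U" "q \<in> U" "q \<in> W" "L q = 0"
    and G: "holo_on G W" and E: "continuous_on (U \<inter> W) E" and eq: "\<And>z. z \<in> U \<inter> W \<Longrightarrow> G z = L z ^ b * E z"
  shows "\<exists>G1. holo_on G1 W \<and> (\<forall>z\<in>W. G z = L z ^ b * G1 z)"
  using G eq
proof (induction b arbitrary: G)
  case 0
  then show ?case by auto
next
  case (Suc b)
  have "G z = 0" if "z \<in> W" "L z = 0" for z
    by (rule holo_on_identity[OF Suc.prems(1) W affine U(1-3)]) (use that U Suc.prems(2) in auto)
  then obtain F where F: "holo_on F W" "\<And>z. z \<in> W \<Longrightarrow> G z = L z * F z"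
    using divide[OF W(1) Suc.prems(1)] by blast
  have op: "open (U \<inter> W)" using U W by blast
  have "F z = L z ^ b * E z" if z: "z \<in> U \<inter> W" for z
  proof (rule continuous_eq_on_dense[OF op _ _ _ z])
    show "continuous_on (U \<inter> W) F"
      using holo_on_imp_continuous_on[OF F(1)] continuous_on_subset by blast
    show "continuous_on (U \<inter> W) (\<lambda>z. L z ^ b * E z)"
      by (intro continuous_intros E continuous_on_subset[OF holo_on_imp_continuous_on[OF holo_L]]) auto
    have "{z \<in> U \<inter> W. L z \<noteq> 0} \<subseteq> {z \<in> U \<inter> W. F z = L z ^ b * E z}"
      using F(2) Suc.prems(2) by (auto simp: mult.assoc)
    then show "U \<inter> W \<subseteq> closure {z \<in> U \<inter> W. F z = L z ^ b * E z}"
      using L_nonzero_dense[OF op] closure_mono by blast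
  qed
  then obtain G1 where "holo_on G1 W" "\<forall>z\<in>W. F z = L z ^ b * G1 z" using Suc.IH[OF F(1)] by blast
  then show ?case using F(2) by (intro exI[of _ G1]) (simp add: mult.assoc)
qed

text \<open>Near the regular point g = F h, so g carries at least the power of L that divides h, and
  by \<open>power_divide\<close> this holds throughout W. After cancellation the denominator is not
  identically zero on the hyperplane.\<close>

lemma regular_local:
  assumes W: "open W" "convex W" and gh: "holo_on g W" "holo_on h W"
    and dense: "W \<subseteq> closure {z \<in> W. h z \<noteq> 0}" and M: "\<And>z. z \<in> W \<Longrightarrow> h z \<noteq> 0 \<Longrightarrow> M z = g z / h z"
    and q: "q \<in> W" "L q = 0" "regular_at M q"
  obtains g1 h1 w where "holo_on g1 W" "holo_on h1 W" "w \<in> W" "L w = 0" "h1 w \<noteq> 0"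
    "\<And>z. z \<in> W \<Longrightarrow> L z = 0 \<Longrightarrow> h1 z \<noteq> 0 \<Longrightarrow> has_mero_value M z (g1 z / h1 z)"
proof -
  obtain b h1 w where h1: "holo_on h1 W" "\<And>z. z \<in> W \<Longrightarrow> h z = L z ^ b * h1 z" "w \<in> W" "L w = 0" "h1 w \<noteq> 0"
    by (rule power_factor[OF W q(1,2) gh(2) dense]) (rule that)
  obtain U F where U: "open U" "q \<in> U" "holo_on F U" "U \<subseteq> closure (interior {z \<in> U. F z = M z})"
    using q(3) unfolding regular_at_def has_mero_value_def by blast
  have op: "open (U \<inter> W)" using U W by blast
  have cF: "continuous_on (U \<inter> W) F" "continuous_on (U \<inter> W) h" "continuous_on (U \<inter> W) g"
      "continuous_on (U \<inter> W) h1"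
    using holo_on_imp_continuous_on U(3) gh h1(1) continuous_on_subset by (metis inf_le1 inf_le2)+
  have "g z = F z * h z" if z: "z \<in> U \<inter> W" for z
  proof (rule continuous_eq_on_dense[OF op cF(3) _ _ z])
    show "continuous_on (U \<inter> W) (\<lambda>z. F z * h z)" by (intro continuous_intros cF)
    have "U \<inter> W \<subseteq> closure ((U \<inter> W) \<inter> interior {z \<in> U. F z = M z} \<inter> {z \<in> W. h z \<noteq> 0})"
      by (rule dense_Int) (use op U dense in auto)
    moreover have "(U \<inter> W) \<inter> interior {z \<in> U. F z = M z} \<inter> {z \<in> W. h z \<noteq> 0} \<subseteq> {z \<in> U \<inter> W. g z = F z * h z}"
      using interior_subset[of "{z \<in> U. F z = M z}"] M by auto
    ultimately show "U \<inter> W \<subseteq> closure {z \<in> U \<inter> W. g z = F z * h z}" using closure_mono by blast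
  qed
  then have "g z = L z ^ b * (h1 z * F z)" if "z \<in> U \<inter> W" for z
    using that h1(2)[of z] by (simp add: algebra_simps)
  moreover have "continuous_on (U \<inter> W) (\<lambda>z. h1 z * F z)" by (intro continuous_intros cF)
  ultimately obtain g1 where g1: "holo_on g1 W" "\<forall>z\<in>W. g z = L z ^ b * g1 z"
    using power_divide[OF W U(1,2) q(1,2) gh(1)] by blast
  have "has_mero_value M z (g1 z / h1 z)" if z: "z \<in> W" "L z = 0" "h1 z \<noteq> 0" for z
  proof -
    define V where "V = W \<inter> h1 -` (- {0})"
    have V: "open V" unfolding V_def
      by (rule continuous_open_preimage[OF holo_on_imp_continuous_on[OF h1(1)] W(1) open_Compl[OF closed_singleton]])
    have cL: "continuous_on V L" using continuous_on_subset[OF holo_on_imp_continuous_on[OF holo_L]] by simp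
    define A where "A = V \<inter> L -` (- {0})"
    have A: "open A" unfolding A_def
      by (rule continuous_open_preimage[OF cL V open_Compl[OF closed_singleton]])
    have "V \<subseteq> closure A"
      using L_nonzero_dense[OF V] by (simp add: A_def vimage_def Int_def)
    show ?thesis
    proof (rule has_mero_valueI[OF V _ _ A \<open>V \<subseteq> closure A\<close>, of z "\<lambda>z. g1 z / h1 z"])
      show "z \<in> V" "A \<subseteq> V" using z by (auto simp: V_def A_def)
      show "holo_on (\<lambda>z. g1 z / h1 z) V"
        by (intro holo_on_divide holo_on_subset[OF g1(1)] holo_on_subset[OF h1(1)]) (auto simp: V_def)
      fix x assume "x \<in> A"
      then have x: "x \<in> W" "h1 x \<noteq> 0" "L x \<noteq> 0" by (auto simp: A_def V_def)
      then show "g1 x / h1 x = M x" using M[of x] h1(2)[of x] g1(2) by simp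
    qed
  qed
  then show ?thesis using that h1 g1 by blast
qed

text \<open>
  Regularity at a single point of a hyperplane rules out a pole along the whole hyperplane, because
  the pole order is locally constant along it.
\<close>

lemma mero_value_on_hyperplane:
  assumes M: "mero_on M UNIV" and q: "L q = 0" "regular_at M q"
  shows "mero_on (mero_value M) {z. L z = 0}" "generically_on {z. L z = 0} (regular_at M)"
proof -
  define H where "H = {z. L z = 0}"
  have affH: "complex_affine H" using affine by (simp add: H_def)
  define R where "R = {p. regular_at M p}"
  have R: "open R" unfolding R_def by (rule open_regular)
  \<comment> \<open>Stated as an implication because it is first used to prove that every such ball
    meets \<open>R\<close>; the premise is discharged only afterwards.\<close>
  have step: "\<exists>r g1 h1. r > 0 \<and> (ball p r \<inter> H \<inter> R \<noteq> {} \<longrightarrow>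
      holo_on g1 (ball p r) \<and> holo_on h1 (ball p r) \<and> (\<exists>w\<in>ball p r \<inter> H. h1 w \<noteq> 0) \<and>
      (\<forall>z\<in>ball p r \<inter> H. h1 z \<noteq> 0 \<longrightarrow> has_mero_value M z (g1 z / h1 z)))" if p: "p \<in> H" for p
  proof -
    obtain r g h where r: "r > 0" "holo_on g (ball p r)" "holo_on h (ball p r)"
      "ball p r \<inter> UNIV \<subseteq> closure {z \<in> ball p r \<inter> UNIV. h z \<noteq> 0}"
      "\<And>z. z \<in> ball p r \<inter> UNIV \<Longrightarrow> h z \<noteq> 0 \<Longrightarrow> M z = g z / h z"
      using mero_on_ball[OF M, of p] by blast
    show ?thesis
    proof (cases "ball p r \<inter> H \<inter> R = {}")
      case True
      then show ?thesis using r(1) by blast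
    next
      case False
      then obtain q' where q': "q' \<in> ball p r" "L q' = 0" "regular_at M q'" by (auto simp: H_def R_def)
      obtain g1 h1 w where "holo_on g1 (ball p r)" "holo_on h1 (ball p r)" "w \<in> ball p r" "L w = 0" "h1 w \<noteq> 0"
        "\<And>z. z \<in> ball p r \<Longrightarrow> L z = 0 \<Longrightarrow> h1 z \<noteq> 0 \<Longrightarrow> has_mero_value M z (g1 z / h1 z)"
        by (rule regular_local[OF open_ball convex_ball r(2,3) _ _ q']) (use r(4,5) in auto)
      then show ?thesis using r(1) by (intro exI[of _ r] exI[of _ g1] exI[of _ h1]) (auto simp: H_def)
    qed
  qed
  have dense: "H \<subseteq> closure (H \<inter> R)"
  proof (rule dense_propagation[OF _ R])
    show "connected H" using complex_affine_convex[OF affH] convex_connected by blast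
    show "H \<inter> R \<noteq> {}" using q by (auto simp: H_def R_def)
    fix p assume p: "p \<in> H"
    obtain r g1 h1 where r: "r > 0" "ball p r \<inter> H \<inter> R \<noteq> {} \<longrightarrow>
      holo_on g1 (ball p r) \<and> holo_on h1 (ball p r) \<and> (\<exists>w\<in>ball p r \<inter> H. h1 w \<noteq> 0) \<and>
      (\<forall>z\<in>ball p r \<inter> H. h1 z \<noteq> 0 \<longrightarrow> has_mero_value M z (g1 z / h1 z))"
      using step[OF p] by blast
    have "ball p r \<inter> H \<subseteq> closure (H \<inter> R)" if "ball p r \<inter> H \<inter> R \<noteq> {}"
    proof -
      note rr = mp[OF r(2) that]
      note h1 = rr[THEN conjunct2, THEN conjunct1]
      note v = rr[THEN conjunct2, THEN conjunct2, THEN conjunct2]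
      obtain w where w: "w \<in> ball p r" "w \<in> H" "h1 w \<noteq> 0"
        using rr[THEN conjunct2, THEN conjunct2, THEN conjunct1] by blast
      have "ball p r \<inter> H \<subseteq> closure {z \<in> ball p r \<inter> H. h1 z \<noteq> 0}"
        by (rule holo_on_nonzero_dense[OF h1 open_ball convex_ball affH w])
      also have "\<dots> \<subseteq> closure (H \<inter> R)"
        by (rule closure_mono) (use v in \<open>auto simp: R_def regular_at_def\<close>)
      finally show ?thesis .
    qed
    then show "\<exists>W. open W \<and> p \<in> W \<and> (W \<inter> H \<inter> R \<noteq> {} \<longrightarrow> W \<inter> H \<subseteq> closure (H \<inter> R))"
      using r(1) by (intro exI[of _ "ball p r"]) auto
  qed
  show "generically_on {z. L z = 0} (regular_at M)"
    unfolding generically_on_def using R dense by (intro exI[of _ R]) (auto simp: H_def R_def)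
  show "mero_on (mero_value M) {z. L z = 0}"
  proof (rule mero_onI_ball[OF affine])
    fix p assume "p \<in> {z. L z = 0}"
    then have p: "p \<in> H" by (simp add: H_def)
    obtain r g1 h1 where r: "r > 0" "ball p r \<inter> H \<inter> R \<noteq> {} \<longrightarrow>
      holo_on g1 (ball p r) \<and> holo_on h1 (ball p r) \<and> (\<exists>w\<in>ball p r \<inter> H. h1 w \<noteq> 0) \<and>
      (\<forall>z\<in>ball p r \<inter> H. h1 z \<noteq> 0 \<longrightarrow> has_mero_value M z (g1 z / h1 z))"
      using step[OF p] by blast
    have "ball p r \<inter> (H \<inter> R) \<noteq> {}"
    proof -
      have "p \<in> ball p r \<inter> closure (H \<inter> R)" using p r(1) subsetD[OF dense p] by simp
      then show ?thesis using open_Int_closure_eq_empty[OF open_ball[of p r], of "H \<inter> R"] by blast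
    qed
    then show "\<exists>r g h. r > 0 \<and> holo_on g (ball p r) \<and> holo_on h (ball p r) \<and>
      (\<exists>z\<in>ball p r \<inter> {z. L z = 0}. h z \<noteq> 0) \<and>
      (\<forall>z\<in>ball p r \<inter> {z. L z = 0}. h z \<noteq> 0 \<longrightarrow> mero_value M z = g z / h z)"
      using r has_mero_value_imp_mero_value
      by (intro exI[of _ r] exI[of _ g1] exI[of _ h1]) (auto simp: H_def Int_assoc)
  qed
qed

end

section \<open>Finite products of Lebesgue measure\<close>

abbreviation lbs :: "'i set \<Rightarrow> ('i \<Rightarrow> real) measure" where
  "lbs I \<equiv> Pi\<^sub>M I (\<lambda>_. lborel)"

interpretation lb: product_sigma_finite "\<lambda>_::'i. lborel :: real measure"
  by standard

lemma measurable_component_lbs [measurable]: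
  "(\<lambda>\<tau>. \<tau> i) \<in> borel_measurable (lbs I)"
proof (cases "i \<in> I")
  case True
  then show ?thesis using measurable_component_singleton[of i I "\<lambda>_. lborel"] by simp
next
  case False
  \<comment> \<open>Outside I every point of the product space takes the default value
    \<open>undefined\<close>, so the coordinate is constant there.\<close>
  have "(\<lambda>_. undefined :: real) \<in> borel_measurable (lbs I)" by simp
  then show ?thesis
    by (rule measurable_cong[THEN iffD1, rotated]) (use False in \<open>auto simp: space_PiM PiE_def extensional_def\<close>)
qed

lemma emeasure_space_lbs_nonzero:
  assumes "finite I"
  shows "emeasure (lbs I) (space (lbs I)) \<noteq> 0"
proof -
  have "emeasure (lbs I) (Pi\<^sub>E I (\<lambda>_. UNIV)) = (\<Prod>i\<in>I. emeasure lborel (UNIV :: real set))"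
    by (rule lb.emeasure_PiM[OF assms]) simp
  then show ?thesis by (simp add: space_PiM)
qed

lemma AE_imp_ex:
  assumes "emeasure M (space M) \<noteq> 0" "AE x in M. P x"
  shows "\<exists>x\<in>space M. P x"
proof (rule ccontr)
  assume neg: "\<not> ?thesis"
  have "AE x in M. P x \<and> x \<in> space M"
    using assms(2) AE_space by (rule eventually_conj)
  then have "AE x in M. False" by (rule eventually_mono) (use neg in blast)
  then show False using assms(1) by (simp add: eventually_False ae_filter_eq_bot_iff)
qed

text \<open>With the other coordinates frozen, shifting one coordinate by g is a translation of the
  line, so Fubini gives invariance one coordinate at a time. It serves to make a leaf relative to
  its neighbour, and S relative to its reference vertex.\<close>

lemma lbs_shift_invariant:
  assumes I: "finite I" and B: "B \<subseteq> I"
    and g: "g \<in> borel_measurable (lbs I)" and indep: "\<And>\<tau> i x. i \<in> B \<Longrightarrow> g (\<tau>(i := x)) = g \<tau>"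
  shows "distr (lbs I) (lbs I) (\<lambda>\<tau>. \<lambda>i\<in>I. if i \<in> B then \<tau> i + g \<tau> else \<tau> i) = lbs I"
  using finite_subset[OF B I] B indep
proof (induction B)
  case empty
  have "distr (lbs I) (lbs I) (\<lambda>\<tau>. \<lambda>i\<in>I. \<tau> i) = distr (lbs I) (lbs I) (\<lambda>\<tau>. \<tau>)"
    by (rule distr_cong) (auto simp: space_PiM PiE_def extensional_def fun_eq_iff)
  then show ?case by (simp add: distr_id restrict_def)
next
  case (insert j B)
  define T where "T = (\<lambda>B \<tau>. \<lambda>i\<in>I. if i \<in> B then \<tau> i + g \<tau> else \<tau> i)"
  have T: "T B \<in> measurable (lbs I) (lbs I)" for B
    unfolding T_def using g
    by (intro measurable_restrict) (auto intro: measurable_component_lbs)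
  have j: "j \<in> I" using insert.prems by blast
  have one: "distr (lbs I) (lbs I) (T {j}) = lbs I"
  proof (rule measure_eqI)
    fix A assume "A \<in> sets (distr (lbs I) (lbs I) (T {j}))"
    then have A[measurable]: "A \<in> sets (lbs I)" by simp
    have T1[measurable]: "T {j} \<in> measurable (lbs I) (lbs I)" by (rule T)
    have fI: "finite (I - {j})" "j \<notin> I - {j}" "insert j (I - {j}) = I" using I j by auto
    have "emeasure (distr (lbs I) (lbs I) (T {j})) A = (\<integral>\<^sup>+ \<tau>. indicator A \<tau> \<partial>distr (lbs I) (lbs I) (T {j}))"
      by simp
    also have "\<dots> = (\<integral>\<^sup>+ \<tau>. indicator A (T {j} \<tau>) \<partial>lbs I)"
      by (rule nn_integral_distr) measurable
    also have "\<dots> = (\<integral>\<^sup>+ \<tau>. indicator A (T {j} \<tau>) \<partial>lbs (insert j (I - {j})))"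
      by (simp only: fI)
    also have "\<dots> = (\<integral>\<^sup>+ x. (\<integral>\<^sup>+ y. indicator A (T {j} (x(j := y))) \<partial>lborel) \<partial>lbs (I - {j}))"
      by (rule lb.product_nn_integral_insert[OF fI(1,2)]) (simp only: fI, measurable)
    also have "\<dots> = (\<integral>\<^sup>+ x. (\<integral>\<^sup>+ y. indicator A (x(j := y)) \<partial>lborel) \<partial>lbs (I - {j}))"
    proof (rule nn_integral_cong)
      fix x assume x: "x \<in> space (lbs (I - {j}))"
      have gx: "g (x(j := y)) = g x" for y by (rule insert.prems(2)) simp
      have "T {j} (x(j := y)) = x(j := g x + y)" for y
        using x j unfolding T_def gx
        by (auto simp: space_PiM PiE_def extensional_def fun_eq_iff)
      then have "(\<integral>\<^sup>+ y. indicator A (T {j} (x(j := y))) \<partial>lborel)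
          = (\<integral>\<^sup>+ y. (\<lambda>y. indicator A (x(j := y))) (g x + y) \<partial>lborel)" by simp
      also have "\<dots> = (\<integral>\<^sup>+ y. indicator A (x(j := y)) \<partial>distr lborel borel ((+) (g x)))"
      proof (rule nn_integral_distr[symmetric])
        have "(\<lambda>y. x(j := y)) \<in> measurable lborel (lbs (insert j (I - {j})))"
          using x by (intro measurable_fun_upd[where J = "I - {j}"]) (auto simp: measurable_const)
        then have "(\<lambda>y. x(j := y)) \<in> measurable lborel (lbs I)" by (simp only: fI)
        then have "(\<lambda>y. indicator A (x(j := y)) :: ennreal) \<in> borel_measurable lborel"
          using A by measurable
        then show "(\<lambda>y. indicator A (x(j := y)) :: ennreal) \<in> borel_measurable (distr lborel borel ((+) (g x)))"
          by simp
      qed simp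
      also have "\<dots> = (\<integral>\<^sup>+ y. indicator A (x(j := y)) \<partial>lborel)"
        by (simp add: lborel_distr_plus)
      finally show "(\<integral>\<^sup>+ y. indicator A (T {j} (x(j := y))) \<partial>lborel)
          = (\<integral>\<^sup>+ y. indicator A (x(j := y)) \<partial>lborel)" .
    qed
    also have "\<dots> = (\<integral>\<^sup>+ \<tau>. indicator A \<tau> \<partial>lbs (insert j (I - {j})))"
      by (rule lb.product_nn_integral_insert[OF fI(1,2), symmetric]) (simp only: fI, measurable)
    also have "\<dots> = emeasure (lbs I) A" unfolding fI(3) by simp
    finally show "emeasure (distr (lbs I) (lbs I) (T {j})) A = emeasure (lbs I) A" .
  qed simp
  \<comment> \<open>Since g ignores the coordinates in B and j, it has the same value after the
    earlier shifts, and the single shifts compose to the joint one.\<close>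
  have comp: "T (insert j B) \<tau> = (T {j} \<circ> T B) \<tau>" if "\<tau> \<in> space (lbs I)" for \<tau>
  proof -
    have "g (T B \<tau>) = g \<tau>"
    proof -
      have "finite C \<Longrightarrow> C \<subseteq> B \<Longrightarrow> g (T C \<tau>) = g \<tau>" for C
      proof (induction C rule: finite_induct)
        case empty
        have "T {} \<tau> = \<tau>" using that by (auto simp: T_def space_PiM PiE_def extensional_def fun_eq_iff)
        then show ?case by simp
      next
        case (insert k C)
        have "T (insert k C) \<tau> = (T C \<tau>)(k := \<tau> k + g \<tau>)"
          using insert.prems \<open>insert j B \<subseteq> I\<close> by (auto simp: T_def fun_eq_iff)
        moreover have "g ((T C \<tau>)(k := \<tau> k + g \<tau>)) = g (T C \<tau>)"
          by (rule \<open>\<And>\<tau> i x. i \<in> insert j B \<Longrightarrow> g (\<tau>(i := x)) = g \<tau>\<close>) (use insert.prems in simp)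
        moreover have "g (T C \<tau>) = g \<tau>" using insert by blast
        ultimately show ?case by (simp only:)
      qed
      then show ?thesis using \<open>finite B\<close> by blast
    qed
    then show ?thesis using insert.hyps by (auto simp: T_def fun_eq_iff)
  qed
  have "distr (lbs I) (lbs I) (T (insert j B)) = distr (lbs I) (lbs I) (T {j} \<circ> T B)"
    by (rule distr_cong) (auto simp: comp)
  also have "\<dots> = distr (distr (lbs I) (lbs I) (T B)) (lbs I) (T {j})"
    by (rule distr_distr[symmetric]) (auto intro: T)
  also have "distr (lbs I) (lbs I) (T B) = lbs I"
    unfolding T_def by (rule insert.IH) (use insert.prems in blast)+
  finally show ?case using one by (simp only: T_def)
qed

lemma lbs_reflect:
  assumes I: "finite I"
  shows "distr (lbs I) (lbs I) (\<lambda>\<tau>. \<lambda>i\<in>I. - \<tau> i) = lbs I"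
proof (rule lb.PiM_eqI[OF I])
  show "sets (distr (lbs I) (lbs I) (\<lambda>\<tau>. \<lambda>i\<in>I. - \<tau> i)) = sets (lbs I)" by simp
  fix A :: "'a \<Rightarrow> real set" assume A: "\<And>i. i \<in> I \<Longrightarrow> A i \<in> sets lborel"
  have m: "(\<lambda>\<tau>. \<lambda>i\<in>I. - \<tau> i) \<in> measurable (lbs I) (lbs I)"
    by (intro measurable_restrict) (simp add: measurable_component_lbs)
  have mA: "uminus -` A i \<in> sets lborel" if "i \<in> I" for i
  proof -
    have "uminus \<in> borel_measurable (borel :: real measure)" by simp
    from measurable_sets[OF this, of "A i"] show ?thesis using A[OF that] by simp
  qed
  have "emeasure (distr (lbs I) (lbs I) (\<lambda>\<tau>. \<lambda>i\<in>I. - \<tau> i)) (Pi\<^sub>E I A)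
      = emeasure (lbs I) ((\<lambda>\<tau>. \<lambda>i\<in>I. - \<tau> i) -` Pi\<^sub>E I A \<inter> space (lbs I))"
    by (rule emeasure_distr[OF m]) (use A I in auto)
  also have "(\<lambda>\<tau>. \<lambda>i\<in>I. - \<tau> i) -` Pi\<^sub>E I A \<inter> space (lbs I) = Pi\<^sub>E I (\<lambda>i. uminus -` A i)"
    by (auto simp: space_PiM PiE_def Pi_def)
  also have "emeasure (lbs I) \<dots> = (\<Prod>i\<in>I. emeasure lborel (uminus -` A i))"
    by (rule lb.emeasure_PiM[OF I]) (use mA in auto)
  also have "\<dots> = (\<Prod>i\<in>I. emeasure lborel (A i))"
  proof (rule prod.cong[OF refl])
    fix i assume i: "i \<in> I"
    have "emeasure lborel (A i) = emeasure (distr lborel borel uminus) (A i)" by (simp add: lborel_distr_uminus)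
    also have "\<dots> = emeasure lborel (uminus -` A i)"
      using A[OF i] by (subst emeasure_distr) auto
    finally show "emeasure lborel (uminus -` A i) = emeasure lborel (A i)" ..
  qed
  finally show "emeasure (distr (lbs I) (lbs I) (\<lambda>\<tau>. \<lambda>i\<in>I. - \<tau> i)) (Pi\<^sub>E I A) = (\<Prod>i\<in>I. emeasure lborel (A i))" .
qed

section \<open>Splitting integrals over disjoint sets of coordinates\<close>

text \<open>Almost every section of the product is integrable and is a nonzero multiple of one
  factor. Thus convergence of the whole integral yields convergence of its factors, which is how the
  internal block is shown to converge.\<close>

lemma pair_integrable_factors:
  fixes f :: "'a \<Rightarrow> complex" and g :: "'b \<Rightarrow> complex"
  assumes M: "sigma_finite_measure M" "sigma_finite_measure N"
    and nz: "\<And>x. x \<in> space M \<Longrightarrow> f x \<noteq> 0" "\<And>y. y \<in> space N \<Longrightarrow> g y \<noteq> 0"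
    and ne: "emeasure M (space M) \<noteq> 0" "emeasure N (space N) \<noteq> 0"
    and int: "integrable (M \<Otimes>\<^sub>M N) (\<lambda>(x, y). f x * g y)"
  shows "integrable M f" "integrable N g"
    "(LINT p|(M \<Otimes>\<^sub>M N). (case p of (x, y) \<Rightarrow> f x * g y)) = (LINT x|M. f x) * (LINT y|N. g y)"
proof -
  interpret M: sigma_finite_measure M by fact
  interpret N: sigma_finite_measure N by fact
  interpret P: pair_sigma_finite M N by standard
  have "AE x in M. integrable N (\<lambda>y. f x * g y)" using P.AE_integrable_fst[OF int] .
  from AE_imp_ex[OF ne(1) this] obtain x where
    "f x \<noteq> 0" "integrable N (\<lambda>y. f x * g y)" using nz(1) by blast
  then show "integrable N g"
    using integrable_mult_right[of "inverse (f x)" N "\<lambda>y. f x * g y"] by (simp add: field_simps)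
  have "AE y in N. integrable M (\<lambda>x. f x * g y)" using P.AE_integrable_snd[OF int] .
  from AE_imp_ex[OF ne(2) this] obtain y where
    "g y \<noteq> 0" "integrable M (\<lambda>x. f x * g y)" using nz(2) by blast
  then show "integrable M f"
    using integrable_mult_left[of "inverse (g y)" M "\<lambda>x. f x * g y"] by (simp add: field_simps)
  have "(LINT p|(M \<Otimes>\<^sub>M N). (case p of (x, y) \<Rightarrow> f x * g y)) = (LINT x|M. LINT y|N. f x * g y)"
    using P.integral_fst[OF int] by simp
  then show "(LINT p|(M \<Otimes>\<^sub>M N). (case p of (x, y) \<Rightarrow> f x * g y)) = (LINT x|M. f x) * (LINT y|N. g y)"
    by simp
qed

text \<open>Invariance under \<open>restrict\<close> expresses that a function depends only on the
  coordinates of its block, so \<open>merge\<close> turns the integrand into a product on a product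
  space.\<close>

lemma lbs_integrable_factors:
  fixes f g :: "('i \<Rightarrow> real) \<Rightarrow> complex"
  assumes I: "finite I" "finite J" "I \<inter> J = {}"
    and nz: "\<And>\<tau>. f \<tau> \<noteq> 0" "\<And>\<tau>. g \<tau> \<noteq> 0"
    and dep: "\<And>\<tau>. f (restrict \<tau> I) = f \<tau>" "\<And>\<tau>. g (restrict \<tau> J) = g \<tau>"
    and int: "integrable (lbs (I \<union> J)) (\<lambda>\<tau>. f \<tau> * g \<tau>)"
  shows "integrable (lbs I) f" "integrable (lbs J) g"
    "(LINT \<tau>|lbs (I \<union> J). f \<tau> * g \<tau>) = (LINT \<tau>|lbs I. f \<tau>) * (LINT \<tau>|lbs J. g \<tau>)"
proof -
  have eq: "f (merge I J (x, y)) * g (merge I J (x, y)) = f x * g y" if "x \<in> space (lbs I)" "y \<in> space (lbs J)" for x y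
  proof -
    have "restrict (merge I J (x, y)) I = restrict x I" "restrict (merge I J (x, y)) J = restrict y J"
      using I(3) by (auto simp: merge_def fun_eq_iff)
    then show ?thesis using dep by metis
  qed
  have mm: "merge I J \<in> measurable (lbs I \<Otimes>\<^sub>M lbs J) (lbs (I \<union> J))" by (rule measurable_merge)
  have D: "distr (lbs I \<Otimes>\<^sub>M lbs J) (lbs (I \<union> J)) (merge I J) = lbs (I \<union> J)"
    by (rule lb.distr_merge[OF I(3,1,2)])
  have "integrable (lbs I \<Otimes>\<^sub>M lbs J) (\<lambda>p. f (merge I J p) * g (merge I J p))"
    using int by (intro integrable_distr[OF mm]) (simp only: D)
  then have int': "integrable (lbs I \<Otimes>\<^sub>M lbs J) (\<lambda>(x, y). f x * g y)"
    by (rule Bochner_Integration.integrable_cong[THEN iffD1, rotated 2])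
      (auto simp: eq space_pair_measure)
  have sI: "sigma_finite_measure (lbs I)" and sJ: "sigma_finite_measure (lbs J)"
    using lb.sigma_finite I by blast+
  note F = pair_integrable_factors[OF sI sJ nz(1) nz(2) emeasure_space_lbs_nonzero[OF I(1)] emeasure_space_lbs_nonzero[OF I(2)] int']
  show "integrable (lbs I) f" "integrable (lbs J) g" using F by blast+
  have "(LINT \<tau>|lbs (I \<union> J). f \<tau> * g \<tau>) = (LINT \<tau>|distr (lbs I \<Otimes>\<^sub>M lbs J) (lbs (I \<union> J)) (merge I J). f \<tau> * g \<tau>)"
    by (simp only: D)
  also have "\<dots> = (LINT p|(lbs I \<Otimes>\<^sub>M lbs J). f (merge I J p) * g (merge I J p))"
    by (rule integral_distr[OF mm]) (use int borel_measurable_integrable in blast)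
  also have "\<dots> = (LINT p|(lbs I \<Otimes>\<^sub>M lbs J). (case p of (x, y) \<Rightarrow> f x * g y))"
    by (rule Bochner_Integration.integral_cong) (auto simp: eq space_pair_measure)
  finally show "(LINT \<tau>|lbs (I \<union> J). f \<tau> * g \<tau>) = (LINT \<tau>|lbs I. f \<tau>) * (LINT \<tau>|lbs J. g \<tau>)"
    using F(3) by simp
qed

lemma lbs_integral_prod_blocks:
  fixes f :: "'i set \<Rightarrow> ('i \<Rightarrow> real) \<Rightarrow> complex"
  assumes \<K>: "finite \<K>" "\<And>K. K \<in> \<K> \<Longrightarrow> finite K" "\<And>K K'. K \<in> \<K> \<Longrightarrow> K' \<in> \<K> \<Longrightarrow> K \<noteq> K' \<Longrightarrow> K \<inter> K' = {}"
    and nz: "\<And>K \<tau>. f K \<tau> \<noteq> 0" and dep: "\<And>K \<tau>. f K (restrict \<tau> K) = f K \<tau>"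
    and int: "integrable (lbs (\<Union>\<K>)) (\<lambda>\<tau>. \<Prod>K\<in>\<K>. f K \<tau>)"
  shows "(LINT \<tau>|lbs (\<Union>\<K>). (\<Prod>K\<in>\<K>. f K \<tau>)) = (\<Prod>K\<in>\<K>. (LINT \<tau>|lbs K. f K \<tau>))"
  using \<K> int
proof (induction \<K>)
  case empty
  have "(LINT \<tau>|lbs ({} :: 'i set). (1::complex)) = 1"
    by (simp add: PiM_empty lebesgue_integral_count_space_finite)
  then show ?case by simp
next
  case (insert K \<K>)
  define g where "g = (\<lambda>\<tau>. \<Prod>K\<in>\<K>. f K \<tau>)"
  have disj: "K \<inter> \<Union>\<K> = {}" using insert.prems(2) insert.hyps(2) by fastforce
  have g: "g (restrict \<tau> (\<Union>\<K>)) = g \<tau>" for \<tau>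
    unfolding g_def
  proof (rule prod.cong[OF refl])
    fix K' assume "K' \<in> \<K>"
    then have "restrict (restrict \<tau> (\<Union>\<K>)) K' = restrict \<tau> K'" by (auto simp: fun_eq_iff restrict_def)
    then show "f K' (restrict \<tau> (\<Union>\<K>)) = f K' \<tau>" using dep by metis
  qed
  have g0: "g \<tau> \<noteq> 0" for \<tau> using insert.hyps(1) nz by (simp add: g_def)
  have "integrable (lbs (K \<union> \<Union>\<K>)) (\<lambda>\<tau>. f K \<tau> * g \<tau>)"
    using insert.prems(3) insert.hyps by (simp add: g_def)
  note F = lbs_integrable_factors[OF _ _ disj nz g0 dep g this]
  have "finite (\<Union>\<K>)" using insert by auto
  then have "integrable (lbs (\<Union>\<K>)) g"
      "(LINT \<tau>|lbs (K \<union> \<Union>\<K>). f K \<tau> * g \<tau>) = (LINT \<tau>|lbs K. f K \<tau>) * (LINT \<tau>|lbs (\<Union>\<K>). g \<tau>)"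
    using F insert.prems(1) by auto
  moreover have "(LINT \<tau>|lbs (\<Union>\<K>). g \<tau>) = (\<Prod>K\<in>\<K>. (LINT \<tau>|lbs K. f K \<tau>))"
    unfolding g_def by (rule insert.IH) (use insert.prems calculation(1) in \<open>auto simp: g_def\<close>)
  ultimately show ?case using insert.hyps by (simp add: g_def)
qed

lemma integrable_exp_abs:
  assumes "\<kappa> > (0::real)"
  shows "integrable lborel (\<lambda>x::real. exp (- \<kappa> * \<bar>x\<bar>))"
proof -
  define f where "f = (\<lambda>x::real. indicator {0..} x *\<^sub>R exp (- \<kappa> * x))"
  have [measurable]: "f \<in> borel_measurable borel" unfolding f_def by measurable
  have "(\<lambda>x. exp (- \<kappa> * x)) absolutely_integrable_on {0..}"
    by (intro nonnegative_absolutely_integrable_1 integrable_on_exp_minus_to_infinity assms) auto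
  then have "integrable lebesgue f" by (simp add: set_integrable_def f_def)
  then have f: "integrable lborel f" by (subst (asm) integrable_completion) auto
  have "integrable lborel (\<lambda>x. f (0 + (- 1) * x))"
    by (rule lborel_integrable_real_affine[OF f]) simp
  then have "integrable lborel (\<lambda>x. f x + f (- x))" using f by simp
  then show ?thesis
    by (rule Bochner_Integration.integrable_bound) (auto simp: f_def indicator_def)
qed

lemma lbs_integrable_exp:
  assumes "finite I" "\<kappa> > 0"
  shows "integrable (lbs I) (\<lambda>\<tau>. exp (- \<kappa> * (\<Sum>i\<in>I. \<bar>\<tau> i\<bar>)))"
proof -
  have "integrable (lbs I) (\<lambda>\<tau>. \<Prod>i\<in>I. exp (- \<kappa> * \<bar>\<tau> i\<bar>))"
    by (intro lb.product_integrable_prod assms integrable_exp_abs)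
  then show ?thesis using assms(1) by (simp add: exp_sum sum_distrib_left)
qed

section \<open>The Beta integral\<close>

text \<open>Powers of 2 cosh u become exponentials of multiples of this function, which exceeds
  \<bar>u\<bar> by at most ln 2; the estimates of decay and growth rest on that comparison.\<close>

definition lcosh :: "real \<Rightarrow> real" where
  "lcosh u = ln (2 * cosh u)"

lemma lcosh_minus [simp]: "lcosh (- u) = lcosh u"
  by (simp add: lcosh_def)

lemma exp_lcosh: "exp (lcosh u) = exp u + exp (- u)"
proof -
  have "exp (lcosh u) = 2 * cosh u" by (simp add: lcosh_def cosh_real_pos)
  then show ?thesis by (simp add: cosh_def)
qed

lemma lcosh_ge: "\<bar>u\<bar> \<le> lcosh u"
proof -
  have "exp \<bar>u\<bar> \<le> exp (lcosh u)" unfolding exp_lcosh by (cases "u \<ge> 0") auto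
  then show ?thesis by simp
qed

lemma lcosh_le: "lcosh u \<le> \<bar>u\<bar> + ln 2"
proof -
  have "exp (lcosh u) \<le> exp \<bar>u\<bar> + exp \<bar>u\<bar>" unfolding exp_lcosh by (intro add_mono) auto
  also have "\<dots> = exp (\<bar>u\<bar> + ln 2)" by (simp add: exp_add)
  finally show ?thesis by simp
qed

lemma lcosh_nonneg: "0 \<le> lcosh u"
  using lcosh_ge[of u] by linarith

lemma DERIV_lcosh: "(lcosh has_real_derivative tanh u) (at u)"
proof -
  have "((\<lambda>u. ln (2 * cosh u)) has_real_derivative (2 * sinh u) / (2 * cosh u)) (at u)"
    by (auto intro!: derivative_eq_intros simp: cosh_real_pos)
  then show ?thesis unfolding lcosh_def[abs_def] by (simp add: tanh_def)
qed

lemma continuous_on_lcosh [continuous_intros]: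
  "continuous_on A f \<Longrightarrow> continuous_on A (\<lambda>x. lcosh (f x))"
proof (rule continuous_on_compose2[of UNIV lcosh])
  show "continuous_on UNIV lcosh"
    using DERIV_lcosh DERIV_isCont continuous_at_imp_continuous_on by blast
qed auto

lemma measurable_lcosh [measurable]: "lcosh \<in> borel_measurable borel"
  by (intro borel_measurable_continuous_onI continuous_intros)

lemma of_real_cosh_powr: "complex_of_real (2 * cosh u) powr c = exp (c * of_real (lcosh u))"
  by (simp add: powr_def lcosh_def cosh_real_pos Ln_of_real[of "2 * cosh u", simplified] cosh_real_nonzero)

definition beta_kernel :: "complex \<Rightarrow> complex \<Rightarrow> real \<Rightarrow> complex" where
  "beta_kernel a b s = exp ((a - b) * of_real s - (a + b) * of_real (lcosh s))"

lemma beta_kernel_nonzero [simp]: "beta_kernel a b s \<noteq> 0"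
  by (simp add: beta_kernel_def)

lemma beta_kernel_measurable [measurable]: "beta_kernel a b \<in> borel_measurable borel"
  unfolding beta_kernel_def by (intro borel_measurable_continuous_onI continuous_intros)

lemma norm_beta_kernel: "norm (beta_kernel a b s) = exp (Re (a - b) * s - Re (a + b) * lcosh s)"
  by (simp add: beta_kernel_def)

lemma norm_beta_kernel_le:
  assumes "r > 0" "Re a \<ge> r" "Re b \<ge> r"
  shows "norm (beta_kernel a b s) \<le> exp (- (2 * r) * \<bar>s\<bar>)"
proof -
  have "Re (a + b) * \<bar>s\<bar> \<le> Re (a + b) * lcosh s"
    using assms by (intro mult_left_mono lcosh_ge) auto
  moreover have "Re (a - b) * s - Re (a + b) * \<bar>s\<bar> \<le> - (2 * r) * \<bar>s\<bar>"
  proof (cases "s \<ge> 0")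
    case True
    have "r * s \<le> Re b * s" using True assms by (intro mult_right_mono) auto
    then show ?thesis using True by (simp add: algebra_simps)
  next
    case False
    have "r * (- s) \<le> Re a * (- s)" using False assms by (intro mult_right_mono) auto
    then show ?thesis using False by (simp add: algebra_simps)
  qed
  ultimately show ?thesis unfolding norm_beta_kernel by simp
qed

lemma integrable_beta_kernel:
  assumes "Re a > 0" "Re b > 0"
  shows "integrable lborel (beta_kernel a b)"
proof (rule Bochner_Integration.integrable_bound)
  define r where "r = min (Re a) (Re b)"
  have r: "r > 0" "Re a \<ge> r" "Re b \<ge> r" using assms by (auto simp: r_def)
  show "integrable lborel (\<lambda>s. exp (- (2 * r) * \<bar>s\<bar>))" using integrable_exp_abs[of "2 * r"] r by simp
  show "AE s in lborel. norm (beta_kernel a b s) \<le> norm (exp (- (2 * r) * \<bar>s\<bar>))"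
    using norm_beta_kernel_le[OF r] by simp
qed simp

text \<open>The substitution is the logistic function t = exp(s - lcosh s). It has 1 - t = exp(-s -
  lcosh s) and dt = 2 t (1 - t) ds, so Euler's integrand becomes twice the kernel.\<close>

lemma integral_beta_kernel_real:
  fixes a b :: real
  assumes a: "a > 0" and b: "b > 0"
  shows "(LINT s|lborel. beta_kernel (of_real a) (of_real b) s) = of_real (Beta a b / 2)"
proof -
  define k where "k = (\<lambda>s. exp ((a - b) * s - (a + b) * lcosh s))"
  have kk: "beta_kernel (of_real a) (of_real b) s = of_real (k s)" for s
    unfolding beta_kernel_def k_def exp_of_real[symmetric] by simp
  have ik: "integrable lborel k"
  proof -
    have "integrable lborel (\<lambda>s. complex_of_real (k s))"
      using integrable_beta_kernel[of "of_real a" "of_real b"] a b by (simp add: kk[abs_def] kk cong: Bochner_Integration.integrable_cong)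
    then have "integrable lborel (\<lambda>s. Re (complex_of_real (k s)))" by (rule integrable_Re)
    then show ?thesis by simp
  qed
  define f where "f = (\<lambda>t::real. t powr (a - 1) * (1 - t) powr (b - 1))"
  define g where "g = (\<lambda>s. exp (s - lcosh s))"
  define g' where "g' = (\<lambda>s. 2 * exp (- 2 * lcosh s))"
  have g1: "1 - g s = exp (- s - lcosh s)" for s
  proof -
    have "exp s + exp (- s) > 0" by (intro add_pos_pos) auto
    then show ?thesis
      by (simp add: g_def exp_diff exp_lcosh field_simps)
  qed
  have g01: "0 < g s" "g s < 1" for s
  proof -
    show "0 < g s" by (simp add: g_def)
    have "1 - g s > 0" unfolding g1 by simp
    then show "g s < 1" by simp
  qed
  have Dg: "(g has_real_derivative g' s) (at s)" for s
  proof -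
    have "(g has_real_derivative exp (s - lcosh s) * (1 - tanh s)) (at s)"
      unfolding g_def by (auto intro!: derivative_eq_intros DERIV_chain2[OF DERIV_lcosh])
    moreover have "exp (s - lcosh s) * (1 - tanh s) = g' s"
    proof -
      have "1 - tanh s = 2 * exp (- s - lcosh s)"
      proof -
        have p: "exp s + exp (- s) > 0" by (intro add_pos_pos) auto
        show ?thesis using p by (simp add: tanh_altdef exp_diff exp_lcosh field_simps)
      qed
      then show ?thesis by (simp add: g'_def flip: exp_add)
    qed
    ultimately show ?thesis by simp
  qed
  have fg: "f (g s) * g' s = 2 * k s" for s
  proof -
    have "f (g s) = exp ((a - 1) * (s - lcosh s)) * exp ((b - 1) * (- s - lcosh s))"
      unfolding f_def g1 by (simp add: g_def powr_def)
    then show ?thesis by (simp add: g'_def k_def flip: exp_add) (simp add: algebra_simps)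
  qed
  have lim0: "((\<lambda>s. g s) \<longlongrightarrow> 0) at_bot"
  proof (rule tendsto_sandwich[where f = "\<lambda>_. 0" and h = "\<lambda>s. exp (2 * s)"])
    show "eventually (\<lambda>s. g s \<le> exp (2 * s)) at_bot"
      using eventually_le_at_bot[of 0]
    proof eventually_elim
      case (elim s)
      then show ?case using lcosh_ge[of s] by (simp add: g_def)
    qed
    show "((\<lambda>s::real. exp (2 * s)) \<longlongrightarrow> 0) at_bot"
      by (rule filterlim_compose[OF exp_at_bot])
        (rule filterlim_tendsto_pos_mult_at_bot[OF tendsto_const _ filterlim_ident], simp)
  qed (auto simp: g_def)
  have lim1: "((\<lambda>s. g s) \<longlongrightarrow> 1) at_top"
  proof -
    have "((\<lambda>s. exp (- s - lcosh s)) \<longlongrightarrow> 0) at_top"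
    proof (rule tendsto_sandwich[where f = "\<lambda>_. 0" and h = "\<lambda>s. exp (- s)"])
      show "eventually (\<lambda>s. exp (- s - lcosh s) \<le> exp (- s)) at_top"
        using lcosh_nonneg by (intro always_eventually) auto
      show "((\<lambda>s::real. exp (- s)) \<longlongrightarrow> 0) at_top"
        by (rule filterlim_compose[OF exp_at_bot filterlim_uminus_at_bot_at_top])
    qed auto
    then have "((\<lambda>s. 1 - exp (- s - lcosh s)) \<longlongrightarrow> 1 - 0) at_top" by (intro tendsto_diff tendsto_const)
    moreover have "1 - exp (- s - lcosh s) = g s" for s using g1[of s] by linarith
    ultimately show ?thesis by simp
  qed
  have cf: "isCont f (g x)" for x
    unfolding f_def using g01[of x] by (auto intro!: continuous_intros)
  have cg': "isCont g' x" for x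
    unfolding g'_def by (auto intro!: continuous_intros isCont_o2[OF _ DERIV_isCont[OF DERIV_lcosh]])
  have si: "set_integrable lborel (einterval (-\<infinity>) \<infinity>) (\<lambda>x. f (g x) * g' x)"
    using ik by (simp add: fg set_integrable_def)
  have A: "((ereal \<circ> g \<circ> real_of_ereal) \<longlongrightarrow> 0) (at_right (-\<infinity>))"
  proof -
    have "((ereal \<circ> g) \<longlongrightarrow> 0) at_bot" using lim0 by (simp add: zero_ereal_def o_def)
    then show ?thesis by (simp only: ereal_tendsto_simps)
  qed
  have B: "((ereal \<circ> g \<circ> real_of_ereal) \<longlongrightarrow> 1) (at_left \<infinity>)"
  proof -
    have "((ereal \<circ> g) \<longlongrightarrow> 1) at_top" using lim1 by (simp add: one_ereal_def o_def)
    then show ?thesis by (simp only: ereal_tendsto_simps)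
  qed
  note S = interval_integral_substitution_nonneg[where a = "-\<infinity>" and b = \<infinity> and f = f and g = g and g' = g', OF _ Dg cf cg' _ _ A B si]
  have S1: "set_integrable lborel (einterval 0 1) f"
    and S2: "(LBINT x=0..1. f x) = (LBINT x=-\<infinity>..\<infinity>. f (g x) * g' x)"
    by (rule S; simp add: f_def g'_def)+
  have e01: "einterval 0 1 = {0<..<1::real}" by (auto simp: einterval_def zero_ereal_def one_ereal_def)
  have "(LBINT x=0..1. f x) = (LINT x:{0<..<1}|lborel. f x)"
    by (simp add: interval_lebesgue_integral_def e01)
  also have "\<dots> = integral {0<..<1} f"
    using S1 by (intro set_borel_integral_eq_integral) (simp add: e01)
  also have "\<dots> = Beta a b"
    using has_integral_Beta_real[OF a b] has_integral_Icc_iff_Ioo unfolding f_def by (metis integral_unique)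
  finally have "Beta a b = (LINT x|lborel. 2 * k x)"
    unfolding S2 fg by (simp add: interval_lebesgue_integral_def set_lebesgue_integral_def)
  then have "(LINT s|lborel. k s) = Beta a b / 2" by simp
  then show ?thesis unfolding kk by (simp only: integral_complex_of_real)
qed

text \<open>Both sides are holomorphic in the pair of exponents on a convex domain, so the real case
  extends by the identity theorem from real points.\<close>

lemma integral_beta_kernel:
  assumes "Re a > 0" "Re b > 0"
  shows "(LINT s|lborel. beta_kernel a b s) = Beta a b / 2"
proof -
  define W where "W = {z :: complex ^ 2. Re (z $ 1) > 0 \<and> Re (z $ 2) > 0}"
  define f where "f = (\<lambda>z :: complex ^ 2. (LINT s|lborel. beta_kernel (z $ 1) (z $ 2) s) - Beta (z $ 1) (z $ 2) / 2)"
  have W: "open W" "convex W"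
  proof -
    have "W = {z. Re (z $ 1) > 0} \<inter> {z. Re (z $ 2) > 0}" by (auto simp: W_def)
    moreover have "open {z :: complex ^ 2. Re (z $ i) > 0}" for i
      by (intro open_Collect_less continuous_intros)
    ultimately show "open W" by (metis open_Int)
    show "convex W" unfolding W_def
    proof (rule convexI, clarify, intro conjI)
      fix x y :: "complex ^ 2" and u v :: real
      assume *: "0 < Re (x $ 1)" "0 < Re (x $ 2)" "0 < Re (y $ 1)" "0 < Re (y $ 2)" "0 \<le> u" "0 \<le> v" "u + v = 1"
      have "0 < u * p + v * q" if "0 < p" "0 < q" for p q :: real
        using that *(5-7) by (cases "u = 0") (auto intro: add_pos_nonneg)
      then show "0 < Re ((u *\<^sub>R x + v *\<^sub>R y) $ 1)" "0 < Re ((u *\<^sub>R x + v *\<^sub>R y) $ 2)" using * by auto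
    qed
  qed
  have h1: "holo_on (\<lambda>z :: complex ^ 2. LINT s|lborel. beta_kernel (z $ 1) (z $ 2) s) W"
  proof (rule holo_on_integral[OF W(1)])
    show "holo_on (\<lambda>z :: complex ^ 2. beta_kernel (z $ 1) (z $ 2) s) W" for s
      unfolding beta_kernel_def
      by (intro holo_on_exp holo_on_diff holo_on_mult holo_on_add holo_on_component holo_on_const)
    fix z0 :: "complex ^ 2" assume z0: "z0 \<in> W"
    define r where "r = min (Re (z0 $ 1)) (Re (z0 $ 2)) / 2"
    have r: "r > 0" "Re (z0 $ 1) \<ge> 2 * r" "Re (z0 $ 2) \<ge> 2 * r" using z0 by (auto simp: r_def W_def)
    have "norm (beta_kernel (z $ 1) (z $ 2) s) \<le> exp (- (2 * r) * \<bar>s\<bar>)" if z: "z \<in> ball z0 r" for z :: "complex ^ 2" and s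
    proof (rule norm_beta_kernel_le[OF r(1)])
      have "Re (z $ i) \<ge> Re (z0 $ i) - r" for i
      proof -
        have "Re ((z0 - z) $ i) \<le> norm ((z0 - z) $ i)" by (rule complex_Re_le_cmod)
        also have "\<dots> \<le> norm (z0 - z)" by (rule Finite_Cartesian_Product.norm_nth_le)
        also have "\<dots> \<le> r" using z by (simp add: dist_norm)
        finally show ?thesis by simp
      qed
      from this[of 1] this[of 2] show "r \<le> Re (z $ 1)" "r \<le> Re (z $ 2)" using r by linarith+
    qed
    moreover have "integrable lborel (\<lambda>s. exp (- (2 * r) * \<bar>s\<bar>))" using integrable_exp_abs[of "2 * r"] r by simp
    ultimately show "\<exists>r>0. \<exists>B. integrable lborel B \<and> (\<forall>z\<in>ball z0 r \<inter> W. \<forall>s\<in>space lborel.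
        norm (beta_kernel (z $ 1) (z $ 2) s) \<le> B s)" using r(1) by blast
  qed simp
  have np: "z \<notin> \<int>\<^sub>\<le>\<^sub>0" if "Re z > 0" for z :: complex
    using that by (auto elim!: nonpos_Ints_cases)
  have h2: "holo_on (\<lambda>z :: complex ^ 2. Beta (z $ 1) (z $ 2) / 2) W"
    unfolding Beta_altdef
    by (intro holo_on_divide holo_on_mult holo_on_const holo_on_compose[where g = Gamma]
        holo_on_compose[where g = rGamma] holo_on_add holo_on_component
        field_differentiable_Gamma field_differentiable_rGamma np) (auto simp: W_def)
  have "f (vector [a, b]) = 0"
  proof (rule holo_on_identity_real[OF _ W, where U = UNIV and q = "\<chi> i. 1"])
    show "holo_on f W" unfolding f_def by (intro holo_on_diff h1 h2)
    show "(\<chi> i. 1) \<in> W" "(\<chi> i. 1) \<in> real_points" by (simp_all add: W_def real_points_def)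
    show "vector [a, b] \<in> W" using assms by (simp add: W_def)
    fix w :: "complex ^ 2" assume w: "w \<in> UNIV \<inter> W \<inter> real_points"
    then obtain x y where xy: "w $ 1 = of_real x" "w $ 2 = of_real y"
      unfolding real_points_def by (metis (mono_tags, lifting) Int_iff Reals_cases mem_Collect_eq)
    have "x > 0" "y > 0" using w xy by (auto simp: W_def)
    then show "f w = 0" unfolding f_def xy integral_beta_kernel_real[OF \<open>x > 0\<close> \<open>y > 0\<close>]
      by (simp add: Beta_def Gamma_complex_of_real flip: of_real_add)
  qed auto
  then show ?thesis by (simp add: f_def)
qed

text \<open>Towards plus infinity the modulus behaves like exp(-2 Re b s), which is not integrable
  unless Re b > 0; reflection exchanges a and b. This supplies the positivity at each leaf when only
  integrability of the whole block is given.\<close>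

lemma integrable_beta_kernel_imp_pos:
  assumes "integrable lborel (beta_kernel a b)"
  shows "Re a > 0" "Re b > 0"
proof -
  have *: "Re b > 0" if int: "integrable lborel (beta_kernel a b)" for a b
  proof (rule ccontr)
    assume neg: "\<not> Re b > 0"
    \<comment> \<open>For s \<ge> 0 the exponent is -2 Re b s up to an error Re(a + b) (lcosh s -
      s), and lcosh s - s lies between 0 and ln 2.\<close>
    define c where "c = exp (- \<bar>Re (a + b)\<bar> * ln 2)"
    have lb: "c \<le> norm (beta_kernel a b s)" if s: "s \<ge> 0" for s
    proof -
      have \<delta>: "0 \<le> lcosh s - s" "lcosh s - s \<le> ln 2" using lcosh_ge[of s] lcosh_le[of s] s by auto
      have "- \<bar>Re (a + b)\<bar> * ln 2 \<le> - Re (a + b) * (lcosh s - s)"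
      proof -
        have "Re (a + b) * (lcosh s - s) \<le> \<bar>Re (a + b)\<bar> * (lcosh s - s)"
          using \<delta> by (intro mult_right_mono) auto
        also have "\<dots> \<le> \<bar>Re (a + b)\<bar> * ln 2" using \<delta> by (intro mult_left_mono) auto
        finally show ?thesis by (simp only: mult_minus_left neg_le_iff_le)
      qed
      moreover have "0 \<le> - 2 * Re b * s" using neg s by (simp add: mult_nonpos_nonneg)
      ultimately have "- \<bar>Re (a + b)\<bar> * ln 2 \<le> Re (a - b) * s - Re (a + b) * lcosh s"
        by (simp add: algebra_simps)
      then show ?thesis unfolding c_def norm_beta_kernel by simp
    qed
    have cp: "c > 0" by (simp add: c_def)
    have "integrable lborel (\<lambda>s::real. c * indicator {0..} s :: real)"
      by (rule Bochner_Integration.integrable_bound[OF int])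
        (use lb cp in \<open>auto simp: indicator_def intro!: AE_I2\<close>)
    then have "integrable lborel (indicator {0::real..} :: real \<Rightarrow> real)"
      using cp by simp
    then have "emeasure lborel {0::real..} < \<infinity>" by (simp add: integrable_indicator_iff)
    then obtain n :: nat where n: "emeasure lborel {0::real..} < of_nat n"
      using ennreal_Ex_less_of_nat by auto
    have "of_nat n = emeasure lborel {0..real n}" by (simp add: ennreal_of_nat_eq_real_of_nat)
    also have "\<dots> \<le> emeasure lborel {0::real..}" by (intro emeasure_mono) auto
    finally show False using n by simp
  qed
  show "Re b > 0" by (rule *[OF assms])
  have "integrable lborel (\<lambda>x. beta_kernel a b (0 + (- 1) * x))"
    by (rule lborel_integrable_real_affine[OF assms]) simp
  moreover have "beta_kernel a b (0 + (- 1) * x) = beta_kernel b a x" for x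
    by (simp add: beta_kernel_def algebra_simps)
  ultimately show "Re a > 0" by (intro *[of b a]) simp
qed

section \<open>The internal block of a tree\<close>

definition edge_len :: "('v, 'e) multigraph \<Rightarrow> ('v \<Rightarrow> real) \<Rightarrow> 'e \<Rightarrow> real" where
  "edge_len G \<tau> e = ln (2 * edge_cosh G \<tau> e)"

lemma edge_len_eq: "ends G e = {u, v} \<Longrightarrow> edge_len G \<tau> e = lcosh (\<tau> u - \<tau> v)"
  by (simp add: edge_len_def edge_cosh_eq lcosh_def)

lemma edges_induced: "edges (induced G A) = {e \<in> edges G. ends G e \<subseteq> A}"
  by (simp add: induced_def)

lemma ends_induced [simp]: "ends (induced G A) = ends G"
  by (simp add: induced_def)

lemma verts_induced [simp]: "verts (induced G A) = A"
  by (simp add: induced_def)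

lemma edge_cosh_induced [simp]: "edge_cosh (induced G A) = edge_cosh G"
  by (simp add: edge_cosh_def fun_eq_iff)

lemma adj_sym: "(u, v) \<in> adj G \<Longrightarrow> (v, u) \<in> adj G"
  by (auto simp: adj_def insert_commute)

lemma conn_components_closed:
  "C \<in> conn_components H \<Longrightarrow> x \<in> C \<Longrightarrow> (x, y) \<in> adj H \<Longrightarrow> y \<in> C"
  by (auto simp: conn_components_def intro: rtrancl_into_rtrancl)

lemma conn_components_nonempty: "C \<in> conn_components H \<Longrightarrow> C \<noteq> {}"
  by (auto simp: conn_components_def)

lemma closed_set_of_connected:
  assumes conn: "connected_graph H" and x: "x \<in> A" "x \<in> verts H"
    and cl: "\<And>x y. x \<in> A \<Longrightarrow> (x, y) \<in> adj H \<Longrightarrow> y \<in> A"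
  shows "verts H \<subseteq> A"
proof
  fix y assume "y \<in> verts H"
  then have "(x, y) \<in> (adj H)\<^sup>*" using conn x by (auto simp: connected_graph_def)
  then show "y \<in> A" by (induction rule: rtrancl_induct) (use x cl in auto)
qed

locale loopless =
  fixes G :: "('v::finite, 'e::finite) multigraph"
  assumes loopless: "loopless_multigraph G"
begin

lemma ends_pair:
  assumes "e \<in> edges G"
  obtains u v where "ends G e = {u, v}" "u \<noteq> v" "u \<in> verts G" "v \<in> verts G"
  using loopless assms unfolding loopless_multigraph_def card_2_iff by (metis insert_subset)

lemma edge_len_cong:
  assumes "e \<in> edges G" "\<And>v. v \<in> ends G e \<Longrightarrow> \<tau> v = \<tau>' v"
  shows "edge_len G \<tau> e = edge_len G \<tau>' e"
  by (rule ends_pair[OF assms(1)]) (use assms(2) in \<open>simp add: edge_len_eq\<close>)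

lemma edge_len_nonneg: "e \<in> edges G \<Longrightarrow> 0 \<le> edge_len G \<tau> e"
  by (erule ends_pair) (simp add: edge_len_eq lcosh_nonneg)

lemma edge_cosh_pos: "e \<in> edges G \<Longrightarrow> 0 < edge_cosh G \<tau> e"
  by (erule ends_pair) (simp add: edge_cosh_eq cosh_real_pos)

lemma edge_product_exp:
  "edge_product (induced G A) \<alpha> z \<tau> =
     exp (- of_real \<alpha> * (\<Sum>e\<in>edges (induced G A). yen z e * of_real (edge_len G \<tau> e)))"
proof -
  have "of_real (2 * edge_cosh G \<tau> e) powr (- of_real \<alpha> * yen z e)
     = exp (- of_real \<alpha> * (yen z e * of_real (edge_len G \<tau> e)))" if "e \<in> edges (induced G A)" for e
  proof -
    have "0 < 2 * edge_cosh G \<tau> e" using that edge_cosh_pos by (simp add: edges_induced)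
    then have "complex_of_real (2 * edge_cosh G \<tau> e) \<noteq> 0"
        "Ln (complex_of_real (2 * edge_cosh G \<tau> e)) = of_real (edge_len G \<tau> e)"
      by (simp_all add: edge_len_def flip: Ln_of_real)
    then show ?thesis by (simp add: powr_def mult.assoc)
  qed
  then show ?thesis
    unfolding edge_product_def sum_distrib_left by (simp add: exp_sum)
qed

lemma vertex_product_exp:
  "vertex_product (induced G A) \<alpha> z \<tau> =
     exp (- of_real \<alpha> * (\<Sum>v\<in>A. xen z v * of_real (lcosh (\<tau> v))))"
  unfolding vertex_product_def sum_distrib_left of_real_cosh_powr
  by (simp add: exp_sum mult.assoc)

lemma edge_boundary_pair:
  assumes "ends G e = {u, v}" "u \<noteq> v" "e \<in> edges G"
  shows "e \<in> edge_boundary G A \<longleftrightarrow> (u \<in> A) \<noteq> (v \<in> A)"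
proof -
  have "{u, v} \<inter> A = (if u \<in> A then {u} else {}) \<union> (if v \<in> A then {v} else {})" by auto
  then show ?thesis using assms by (auto simp: edge_boundary_def)
qed

text \<open>Exchanging the sums counts a boundary edge once per endpoint in A. Its endpoints lie on
  different sides of S, so a set A on one side contains at most one of them.\<close>

lemma sum_eta:
  assumes "A \<subseteq> S \<or> A \<inter> S = {}"
  shows "(\<Sum>v\<in>A. eta G S v z) = (\<Sum>e\<in>{e \<in> edge_boundary G S. ends G e \<inter> A \<noteq> {}}. yen z e)"
proof -
  have "(\<Sum>v\<in>A. eta G S v z) = (\<Sum>v\<in>A. \<Sum>e\<in>edge_boundary G S. if v \<in> ends G e then yen z e else 0)"
    unfolding eta_def by (simp add: sum.inter_filter)
  also have "\<dots> = (\<Sum>e\<in>edge_boundary G S. \<Sum>v\<in>A. if v \<in> ends G e then yen z e else 0)"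
    by (rule sum.swap)
  also have "\<dots> = (\<Sum>e\<in>edge_boundary G S. if ends G e \<inter> A \<noteq> {} then yen z e else 0)"
  proof (rule sum.cong[OF refl])
    fix e assume e: "e \<in> edge_boundary G S"
    then have eG: "e \<in> edges G" by (simp add: edge_boundary_def)
    obtain u v where uv: "ends G e = {u, v}" "u \<noteq> v" using ends_pair[OF eG] by metis
    have "(u \<in> S) \<noteq> (v \<in> S)" using e edge_boundary_pair[OF uv eG] by blast
    then have "\<not> (u \<in> A \<and> v \<in> A)" using assms by blast
    then have *: "{w \<in> A. w \<in> ends G e} = (if u \<in> A then {u} else if v \<in> A then {v} else {})"
      using uv by auto
    have "(\<Sum>w\<in>A. if w \<in> ends G e then yen z e else 0) = (\<Sum>w\<in>{w \<in> A. w \<in> ends G e}. yen z e)"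
      by (rule sum.inter_filter[symmetric]) simp
    also have "\<dots> = (if ends G e \<inter> A \<noteq> {} then yen z e else 0)" unfolding * using uv by auto
    finally show "(\<Sum>w\<in>A. if w \<in> ends G e then yen z e else 0) = (if ends G e \<inter> A \<noteq> {} then yen z e else 0)" .
  qed
  also have "\<dots> = (\<Sum>e\<in>{e \<in> edge_boundary G S. ends G e \<inter> A \<noteq> {}}. yen z e)"
    by (simp add: sum.inter_filter)
  finally show ?thesis .
qed

end

text \<open>The tree structure enters through \<open>D\<close>: deleting any edge of G[S] leaves
  exactly the two components \<open>D e\<close> and \<open>S - D e\<close>, so every edge is a
  bridge.\<close>

locale tree_block = loopless G for G :: "('v::finite, 'e::finite) multigraph" +
  fixes \<alpha> :: real and S :: "'v set" and a :: 'v and D :: "'e \<Rightarrow> 'v set"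
  assumes connG: "connected_graph G" and \<alpha>: "\<alpha> > 0" and S_verts: "S \<subseteq> verts G"
    and connS: "connected_graph (induced G S)" and a: "a \<in> S"
    and D: "\<And>e. e \<in> edges (induced G S) \<Longrightarrow> conn_components (delete_edge (induced G S) e) = {D e, S - D e}"
begin

abbreviation ES where "ES \<equiv> edges (induced G S)"

lemma ES: "e \<in> ES \<longleftrightarrow> e \<in> edges G \<and> ends G e \<subseteq> S"
  by (simp add: edges_induced)

lemma D_subset:
  assumes "e \<in> ES" shows "D e \<subseteq> S"
proof -
  let ?H = "delete_edge (induced G S) e"
  have "D e \<in> conn_components ?H" using D[OF assms] by simp
  then obtain u where u: "u \<in> S" "D e = (adj ?H)\<^sup>* `` {u}"
    by (auto simp: conn_components_def delete_edge_def)
  have "y \<in> S" if "(u, y) \<in> (adj ?H)\<^sup>*" for y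
    using that u(1) by (induction rule: rtrancl_induct) (auto simp: adj_def delete_edge_def edges_induced)
  then show ?thesis using u(2) by auto
qed

lemma D_closed:
  assumes "e \<in> ES" "e' \<in> ES" "e' \<noteq> e" "ends G e' = {x, y}" "x \<in> D e" shows "y \<in> D e"
proof (rule conn_components_closed)
  show "D e \<in> conn_components (delete_edge (induced G S) e)" using D[OF assms(1)] by simp
  show "(x, y) \<in> adj (delete_edge (induced G S) e)"
    using assms by (auto simp: adj_def delete_edge_def)
qed fact

lemma D_no_cross:
  assumes "e \<in> ES" "e' \<in> ES" "e' \<noteq> e" "ends G e' = {x, y}" shows "x \<in> D e \<longleftrightarrow> y \<in> D e"
  using D_closed[OF assms] D_closed[OF assms(1-3), of y x] assms(4) by (auto simp: insert_commute)

text \<open>If e did not join the two sides, then \<open>D e\<close> would be closed under adjacency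
  in all of G[S], and connectedness would make the other side empty.\<close>

lemma D_cross:
  assumes e: "e \<in> ES" "ends G e = {u, v}" shows "(u \<in> D e) \<noteq> (v \<in> D e)"
proof
  assume eq: "(u \<in> D e) = (v \<in> D e)"
  have cl: "y \<in> D e" if xy: "x \<in> D e" "(x, y) \<in> adj (induced G S)" for x y
  proof -
    obtain e' where e': "e' \<in> ES" "ends G e' = {x, y}" using xy(2) by (auto simp: adj_def)
    show ?thesis
    proof (cases "e' = e")
      case True
      then have "(x = u \<and> y = v) \<or> (x = v \<and> y = u)" using e' e by (auto simp: doubleton_eq_iff)
      then show ?thesis using eq xy by auto
    next
      case False
      then show ?thesis using D_no_cross[OF e(1) e'(1) _ e'(2)] xy by blast
    qed
  qed
  have "D e \<noteq> {}" "S - D e \<noteq> {}" using conn_components_nonempty D[OF e(1)] by blast+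
  moreover have "S \<subseteq> D e" if "x \<in> D e" for x
    using closed_set_of_connected[OF connS that] D_subset[OF e(1)] that cl by auto
  ultimately show False by blast
qed

section \<open>Growing the tree and integrating its leaves\<close>

inductive grow :: "'v set \<Rightarrow> bool" where
  root: "grow {a}"
| step: "grow A \<Longrightarrow> e \<in> ES \<Longrightarrow> ends G e = {u, l} \<Longrightarrow> u \<in> A \<Longrightarrow> l \<notin> A \<Longrightarrow> grow (insert l A)"

lemma grow_subset: "grow A \<Longrightarrow> a \<in> A \<and> A \<subseteq> S"
  by (induction rule: grow.induct) (auto simp: a ES)

text \<open>Every edge used to grow A has both ends in A, hence differs from e and does not cross
  between the sides of e.\<close>

lemma grow_side:
  assumes "grow A" "e \<in> ES" "\<not> ends G e \<subseteq> A"
  shows "A \<subseteq> D e \<or> A \<inter> D e = {}"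
  using assms
proof (induction rule: grow.induct)
  case root
  then show ?case by auto
next
  case (step A e1 u l)
  have "e1 \<noteq> e" using step by auto
  then have "u \<in> D e \<longleftrightarrow> l \<in> D e" using D_no_cross[of e e1 u l] step by blast
  then show ?case using step by auto
qed

text \<open>A grown set of largest cardinality exhausts S, since connectedness would otherwise
  provide an edge leaving it.\<close>

lemma grow_all: "grow S"
proof -
  have "\<exists>A. grow A \<and> (\<forall>B. grow B \<longrightarrow> card B \<le> card A)"
    by (rule ex_has_greatest_nat[of grow "{a}" card "Suc (card (UNIV :: 'v set))"])
      (use root card_mono[OF finite subset_UNIV] in \<open>auto simp: less_Suc_eq_le\<close>)
  then obtain A where A: "grow A" "\<And>B. grow B \<Longrightarrow> card B \<le> card A" by blast
  have "S \<subseteq> A"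
  proof (rule ccontr)
    assume neg: "\<not> S \<subseteq> A"
    have "\<not> (\<forall>x y. x \<in> A \<longrightarrow> (x, y) \<in> adj (induced G S) \<longrightarrow> y \<in> A)"
      using closed_set_of_connected[OF connS, of a A] grow_subset[OF A(1)] a neg by auto
    then obtain x y e where "x \<in> A" "y \<notin> A" "e \<in> ES" "ends G e = {x, y}" by (auto simp: adj_def)
    then have "grow (insert y A)" using step A(1) by blast
    then show False using A(2)[of "insert y A"] \<open>y \<notin> A\<close> by simp
  qed
  then show ?thesis using A(1) grow_subset by (metis subset_antisym)
qed

definition EA :: "'v set \<Rightarrow> 'e set" where "EA A = {e \<in> edges G. ends G e \<subseteq> A}"

text \<open>A new leaf l hangs on A by a single edge. A second edge from l to some w in A, parallel
  or not, would put w and l on the same side of e; but e separates u from l, and A lies on one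
  side.\<close>

lemma EA_insert:
  assumes "grow A" "e \<in> ES" "ends G e = {u, l}" "u \<in> A" "l \<notin> A"
  shows "EA (insert l A) = insert e (EA A)" "e \<notin> EA A"
proof -
  have lS: "l \<in> S" "A \<subseteq> S" using assms(2,3) ES grow_subset[OF assms(1)] by auto
  show "e \<notin> EA A" using assms by (auto simp: EA_def)
  show "EA (insert l A) = insert e (EA A)"
  proof
    show "insert e (EA A) \<subseteq> EA (insert l A)" using assms ES by (auto simp: EA_def)
    show "EA (insert l A) \<subseteq> insert e (EA A)"
    proof
      fix e' assume e': "e' \<in> EA (insert l A)"
      then have e'S: "e' \<in> ES" "e' \<in> edges G" using lS by (auto simp: EA_def ES)
      show "e' \<in> insert e (EA A)"
      proof (rule ccontr)
        assume neg: "e' \<notin> insert e (EA A)"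
        obtain x y where xy: "ends G e' = {x, y}" "x \<noteq> y" using ends_pair[OF e'S(2)] by metis
        have "(x = l \<and> y \<in> A) \<or> (y = l \<and> x \<in> A)" using e' neg xy by (auto simp: EA_def)
        then obtain w where w: "w \<in> A" "ends G e' = {w, l}" using xy by (auto simp: insert_commute)
        have "w \<in> D e \<longleftrightarrow> l \<in> D e" using D_no_cross[OF assms(2) e'S(1) _ w(2)] neg by blast
        moreover have "(u \<in> D e) \<noteq> (l \<in> D e)" by (rule D_cross[OF assms(2,3)])
        moreover have "A \<subseteq> D e \<or> A \<inter> D e = {}" using grow_side[OF assms(1,2)] assms(3,5) by auto
        ultimately show False using w(1) assms(4) by blast
      qed
    qed
  qed
qed

lemma card_EA: "grow A \<Longrightarrow> card (EA A) = card A - 1"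
proof (induction rule: grow.induct)
  case root
  have "EA {a} = {}"
  proof (rule ccontr)
    assume "EA {a} \<noteq> {}"
    then obtain e where "e \<in> edges G" "ends G e \<subseteq> {a}" by (auto simp: EA_def)
    then show False using ends_pair[of e] by (metis insert_subset singletonD)
  qed
  then show ?case by simp
next
  case (step A e u l)
  have "card A > 0" using grow_subset[OF step(1)] by (auto simp: card_gt_0_iff)
  then show ?case using EA_insert[OF step(1-5)] step by simp
qed

text \<open>The internal integrand on a grown set, with free vertex coefficients c: removing a leaf
  transfers its coefficient to its neighbour, so the original energies are not preserved by the
  induction.\<close>

definition peel :: "'v set \<Rightarrow> ('v \<Rightarrow> complex) \<Rightarrow> ('e \<Rightarrow> complex) \<Rightarrow> ('v \<Rightarrow> real) \<Rightarrow> complex" where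
  "peel A c y \<sigma> = exp (- of_real \<alpha> * (\<Sum>v\<in>A. c v * of_real (\<sigma> v))
     - of_real \<alpha> * (\<Sum>e\<in>EA A. y e * of_real (edge_len G \<sigma> e)))"

lemma peel_cong:
  assumes "\<And>v. v \<in> A \<Longrightarrow> \<sigma> v = \<sigma>' v"
  shows "peel A c y \<sigma> = peel A c y \<sigma>'"
proof -
  have "edge_len G \<sigma> e = edge_len G \<sigma>' e" if "e \<in> EA A" for e
    using that assms by (intro edge_len_cong) (auto simp: EA_def)
  then show ?thesis using assms by (simp add: peel_def)
qed

text \<open>Measuring the leaf relative to its neighbour u separates its variable and adds
  \<open>c l\<close> to the coefficient of u. The total stays zero, and no side sum of an older edge
  changes, because u and l lie on the same side of it. Zero total also makes the other side of e
  contribute the opposite sum, hence the two signs in the Beta arguments.\<close>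

lemma peel_integral:
  assumes "grow A" "(\<Sum>v\<in>A. c v) = 0"
    and "integrable (lbs (A - {a})) (\<lambda>\<tau>. peel A c y (\<tau>(a := 0)))"
  shows "(LINT \<tau>|lbs (A - {a}). peel A c y (\<tau>(a := 0))) =
    (\<Prod>e\<in>EA A. Beta (of_real (\<alpha> / 2) * (sum c (A \<inter> D e) + y e)) (of_real (\<alpha> / 2) * (y e - sum c (A \<inter> D e))) / 2)"
  using assms
proof (induction arbitrary: c rule: grow.induct)
  case root
  have "card (EA {a}) = 0" using card_EA[OF grow.root] by simp
  then have "EA {a} = {}" by simp
  then show ?case by (simp add: peel_def PiM_empty lebesgue_integral_count_space_finite)
next
  case (step A e0 u l)
  note A = grow_subset[OF step.hyps(1)]
  note EAi = EA_insert[OF step.hyps(1-5)]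
  define I where "I = A - {a}"
  have la: "l \<noteq> a" "l \<notin> I" using step.hyps A by (auto simp: I_def)
  have I': "insert l A - {a} = insert l I" using la by (auto simp: I_def)
  define c' where "c' = c(u := c u + c l)"
  \<comment> \<open>Solves \<open>aa - bb = - \<alpha> * c l\<close> and
    \<open>aa + bb = \<alpha> * y e0\<close>, which makes the leaf factor exactly
    \<open>beta_kernel aa bb\<close>.\<close>
  define aa where "aa = of_real (\<alpha> / 2) * (y e0 - c l)"
  define bb where "bb = of_real (\<alpha> / 2) * (y e0 + c l)"
  \<comment> \<open>The update at a covers both cases of u: the shift is the variable of u, or 0 if
    u is the reference vertex.\<close>
  define g where "g = (\<lambda>\<tau> :: 'v \<Rightarrow> real. (\<tau>(a := 0)) u)"
  define T where "T = (\<lambda>\<tau> :: 'v \<Rightarrow> real. \<lambda>i\<in>insert l I. if i \<in> {l} then \<tau> i + g \<tau> else \<tau> i)"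
  define f where "f = (\<lambda>\<tau>. peel (insert l A) c y (\<tau>(a := 0)))"
  define F where "F = (\<lambda>\<tau>. peel A c' y (\<tau>(a := 0)))"
  define K where "K = (\<lambda>\<tau> :: 'v \<Rightarrow> real. beta_kernel aa bb (\<tau> l))"
  have finA: "finite A" "finite (EA A)" by simp_all
  have sumc': "(\<Sum>v\<in>B. c' v) = (\<Sum>v\<in>B. c v) + (if u \<in> B then c l else 0)" for B
  proof -
    have "(\<Sum>v\<in>B. c' v) = (\<Sum>v\<in>B. c v + (if v = u then c l else 0))"
      by (rule sum.cong) (auto simp: c'_def)
    then show ?thesis by (simp add: sum.distrib)
  qed
  have fT: "f (T \<tau>) = F \<tau> * K \<tau>" for \<tau>
  proof -
    define \<sigma> where "\<sigma> = \<tau>(a := 0)"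
    define \<sigma>' where "\<sigma>' = (T \<tau>)(a := 0)"
    have \<sigma>A: "\<sigma>' v = \<sigma> v" if "v \<in> A" for v
      using that step.hyps(5) by (auto simp: \<sigma>_def \<sigma>'_def T_def I_def)
    have \<sigma>l: "\<sigma>' l = \<tau> l + \<sigma> u" using la by (simp add: \<sigma>'_def T_def g_def \<sigma>_def)
    have s1: "(\<Sum>v\<in>insert l A. c v * of_real (\<sigma>' v))
       = (\<Sum>v\<in>A. c v * of_real (\<sigma> v)) + c l * (of_real (\<tau> l) + of_real (\<sigma> u))"
      using step.hyps(5) \<sigma>A \<sigma>l by simp
    have s2: "(\<Sum>v\<in>A. c' v * of_real (\<sigma> v)) = (\<Sum>v\<in>A. c v * of_real (\<sigma> v)) + c l * of_real (\<sigma> u)"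
    proof -
      have "(\<Sum>v\<in>A. c' v * of_real (\<sigma> v)) = (\<Sum>v\<in>A. c v * of_real (\<sigma> v) + (if v = u then c l * of_real (\<sigma> u) else 0))"
        by (rule sum.cong) (auto simp: c'_def algebra_simps)
      then show ?thesis using step.hyps(4) by (simp add: sum.distrib)
    qed
    have "edge_len G \<sigma>' e = edge_len G \<sigma> e" if "e \<in> EA A" for e
      using that \<sigma>A by (intro edge_len_cong) (auto simp: EA_def)
    moreover have "edge_len G \<sigma>' e0 = lcosh (\<tau> l)"
      using edge_len_eq[OF step.hyps(3), of \<sigma>'] \<sigma>A[OF step.hyps(4)] \<sigma>l lcosh_minus[of "\<tau> l"] by simp
    ultimately have s3: "(\<Sum>e\<in>EA (insert l A). y e * of_real (edge_len G \<sigma>' e))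
       = (\<Sum>e\<in>EA A. y e * of_real (edge_len G \<sigma> e)) + y e0 * of_real (lcosh (\<tau> l))"
      unfolding EAi(1) using EAi(2) by simp
    have kk: "aa - bb = - of_real \<alpha> * c l" "aa + bb = of_real \<alpha> * y e0"
      by (simp_all add: aa_def bb_def algebra_simps add_divide_distrib[symmetric] diff_divide_distrib[symmetric])
    have "f (T \<tau>) = peel (insert l A) c y \<sigma>'" by (simp add: f_def \<sigma>'_def)
    also have "\<dots> = peel A c' y \<sigma> * beta_kernel aa bb (\<tau> l)"
      unfolding peel_def s1 s2 s3 beta_kernel_def kk exp_add[symmetric] by (simp add: algebra_simps)
    finally show ?thesis by (simp add: F_def K_def \<sigma>_def)
  qed
  have T: "T \<in> measurable (lbs (insert l I)) (lbs (insert l I))"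
    unfolding T_def g_def by (intro measurable_restrict) (auto intro!: borel_measurable_add measurable_component_lbs)
  have TD: "distr (lbs (insert l I)) (lbs (insert l I)) T = lbs (insert l I)"
    unfolding T_def
  proof (rule lbs_shift_invariant)
    show "g \<in> borel_measurable (lbs (insert l I))" unfolding g_def by (cases "u = a") simp_all
    show "g (\<tau>(i := x)) = g \<tau>" if "i \<in> {l}" for \<tau> i x
      using that la step.hyps(4,5) by (auto simp: g_def)
  qed auto
  have int: "integrable (lbs (insert l I)) f" using step.prems(2) unfolding f_def I' .
  have intT: "integrable (lbs (insert l I)) (\<lambda>\<tau>. f (T \<tau>))"
    by (rule integrable_distr[OF T]) (simp only: TD int)
  have disj: "I \<inter> {l} = {}" using la by auto
  have Il: "I \<union> {l} = insert l I" by auto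
  have FI: "F (restrict \<tau> I) = F \<tau>" for \<tau>
    unfolding F_def by (rule peel_cong) (auto simp: I_def)
  have Kl: "K (restrict \<tau> {l}) = K \<tau>" for \<tau> by (simp add: K_def)
  have intFK: "integrable (lbs (I \<union> {l})) (\<lambda>\<tau>. F \<tau> * K \<tau>)" using intT unfolding fT Il .
  have nz: "F \<tau> \<noteq> 0" "K \<tau> \<noteq> 0" for \<tau> by (simp_all add: F_def peel_def K_def)
  have FK: "integrable (lbs I) F" "integrable (lbs {l}) K"
      "(LINT \<tau>|lbs (I \<union> {l}). F \<tau> * K \<tau>) = (LINT \<tau>|lbs I. F \<tau>) * (LINT \<tau>|lbs {l}. K \<tau>)"
    using lbs_integrable_factors[OF _ _ disj nz FI Kl intFK] by simp_all
  \<comment> \<open>Integrability of the leaf factor comes from that of the whole integrand; it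
    yields the positive real parts that the Beta integral requires.\<close>
  have kint: "integrable lborel (beta_kernel aa bb)"
  proof -
    have "integrable (distr (lbs {l}) lborel (\<lambda>\<tau>. \<tau> l)) (beta_kernel aa bb)"
      by (subst integrable_distr_eq) (use FK(2) in \<open>auto simp: K_def\<close>)
    then show ?thesis using lb.distr_singleton[of l] by simp
  qed
  have Kval: "(LINT \<tau>|lbs {l}. K \<tau>) = Beta aa bb / 2"
    unfolding K_def by (subst lb.product_integral_singleton)
      (auto simp: integral_beta_kernel[OF integrable_beta_kernel_imp_pos[OF kint]])
  have c'0: "(\<Sum>v\<in>A. c' v) = 0"
    using step.prems(1) step.hyps(4,5) by (simp add: sumc' add.commute)
  have Fval: "(LINT \<tau>|lbs I. F \<tau>) = (\<Prod>e\<in>EA A. Beta (of_real (\<alpha> / 2) * (sum c' (A \<inter> D e) + y e))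
      (of_real (\<alpha> / 2) * (y e - sum c' (A \<inter> D e))) / 2)"
    using step.IH[OF c'0] FK(1) unfolding F_def I_def by blast
  have side: "sum c' (A \<inter> D e) = sum c (insert l A \<inter> D e)" if e: "e \<in> EA A" for e
  proof -
    have eE: "e \<in> ES" "e \<noteq> e0" using e A EAi(2) by (auto simp: EA_def ES)
    have "u \<in> D e \<longleftrightarrow> l \<in> D e" using D_no_cross[OF eE(1) step.hyps(2) _ step.hyps(3)] eE(2) by blast
    then show ?thesis using step.hyps(4,5) by (auto simp: sumc' Int_insert_left)
  qed
  \<comment> \<open>Either \<open>D e0\<close> contains all of A, whose coefficients sum to
    \<open>- c l\<close>, or it meets the grown set only in the leaf; the second case gives the
    arguments in reverse order, and Beta is symmetric.\<close>
  have last: "Beta (of_real (\<alpha> / 2) * (sum c (insert l A \<inter> D e0) + y e0))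
      (of_real (\<alpha> / 2) * (y e0 - sum c (insert l A \<inter> D e0))) = Beta aa bb"
  proof -
    have cr: "(u \<in> D e0) \<noteq> (l \<in> D e0)" by (rule D_cross[OF step.hyps(2,3)])
    have "A \<subseteq> D e0 \<or> A \<inter> D e0 = {}" using grow_side[OF step.hyps(1,2)] step.hyps(3,5) by auto
    then consider "A \<subseteq> D e0" "l \<notin> D e0" | "A \<inter> D e0 = {}" "l \<in> D e0" using cr step.hyps(4) by blast
    then show ?thesis
    proof cases
      case 1
      then have "insert l A \<inter> D e0 = A" by auto
      moreover have "sum c A = - c l" using step.prems(1) step.hyps(5) by (simp add: eq_neg_iff_add_eq_0 add.commute)
      ultimately show ?thesis by (simp add: aa_def bb_def)
    next
      case 2
      then have "insert l A \<inter> D e0 = {l}" by auto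
      then show ?thesis by (simp add: aa_def bb_def Beta_commute add.commute)
    qed
  qed
  have "(LINT \<tau>|lbs (insert l I). f \<tau>) = (LINT \<tau>|distr (lbs (insert l I)) (lbs (insert l I)) T. f \<tau>)"
    by (simp only: TD)
  also have "\<dots> = (LINT \<tau>|lbs (insert l I). f (T \<tau>))"
    by (rule integral_distr[OF T]) (use int in auto)
  also have "\<dots> = (LINT \<tau>|lbs I. F \<tau>) * (Beta aa bb / 2)"
    unfolding fT using FK(3) unfolding Il Kval .
  finally show ?case unfolding I' f_def[symmetric] EAi(1)
    by (simp only: Fval side last prod.insert[OF finA(2) EAi(2)] mult.commute cong: prod.cong)
qed

section \<open>From side sums to the energies X and the value of the internal block\<close>

definition cc :: "('v, 'e) energies \<Rightarrow> 'v \<Rightarrow> complex" where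
  "cc z v = xen z v + eta G S v z"

lemma Xsum_S: "Xsum G S z = (\<Sum>v\<in>S. cc z v)"
proof -
  have "{e \<in> edge_boundary G S. ends G e \<inter> S \<noteq> {}} = edge_boundary G S"
    by (auto simp: edge_boundary_def)
  then show ?thesis using sum_eta[of S S z] by (simp add: Xsum_def cc_def sum.distrib)
qed

text \<open>An edge leaving one side of e is e itself or an edge leaving S from a vertex of that
  side, because no other edge of G[S] crosses between the sides.\<close>

lemma Xsum_side:
  assumes e: "e \<in> ES" and A: "A = D e \<or> A = S - D e"
  shows "Xsum G A z = (\<Sum>v\<in>A. cc z v) + yen z e"
proof -
  have AS: "A \<subseteq> S" using A D_subset[OF e] by auto
  have eG: "e \<in> edges G" "ends G e \<subseteq> S" using e by (auto simp: ES)
  have 1: "edge_boundary G A = insert e {e' \<in> edge_boundary G S. ends G e' \<inter> A \<noteq> {}}"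
  proof (rule set_eqI)
    fix e'
    show "e' \<in> edge_boundary G A \<longleftrightarrow> e' \<in> insert e {e' \<in> edge_boundary G S. ends G e' \<inter> A \<noteq> {}}"
    proof (cases "e' \<in> edges G")
      case False
      then show ?thesis using eG by (auto simp: edge_boundary_def)
    next
      case True
      obtain u v where uv: "ends G e' = {u, v}" "u \<noteq> v" using ends_pair[OF True] by metis
      note bd = edge_boundary_pair[OF uv True]
      show ?thesis
      proof (cases "e' = e")
        case True
        then show ?thesis using bd[of A] D_cross[OF e, of u v] uv eG A by auto
      next
        case False
        show ?thesis
        proof (cases "e' \<in> ES")
          case True
          then show ?thesis using bd[of A] bd[of S] D_no_cross[OF e True False uv(1)] False A uv ES[of e'] by auto
        next
          case F: False
          then have "u \<notin> S \<or> v \<notin> S" using True uv ES[of e'] by auto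
          then show ?thesis using bd[of A] bd[of S] False AS uv by auto
        qed
      qed
    qed
  qed
  have 2: "e \<notin> edge_boundary G S"
  proof -
    obtain u v where uv: "ends G e = {u, v}" "u \<noteq> v" using ends_pair[OF eG(1)] by metis
    then show ?thesis using edge_boundary_pair[OF uv eG(1), of S] eG(2) by auto
  qed
  have "(\<Sum>e\<in>edge_boundary G A. yen z e) = yen z e + (\<Sum>v\<in>A. eta G S v z)"
    unfolding 1 sum_eta[OF disjI1[OF AS]] using 2 by simp
  then show ?thesis by (simp add: Xsum_def cc_def sum.distrib)
qed

lemma C_integrand_peel: "C_integrand G \<alpha> S z \<tau> = peel S (cc z) (yen z) \<tau>"
  unfolding C_integrand_def edge_product_exp peel_def EA_def edges_induced cc_def
  by (simp add: exp_diff exp_minus field_simps flip: exp_add)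

lemma C_integral_beta:
  assumes z: "z \<in> Xplane G S" "z \<in> C_domain G \<alpha> S a"
  shows "C_integral G \<alpha> S a z = beta_product G \<alpha> S D z"
proof -
  have s0: "(\<Sum>v\<in>S. cc z v) = 0" using z(1) Xsum_S[of z] by (simp add: Xplane_def)
  have int: "integrable (lbs (S - {a})) (\<lambda>\<tau>. peel S (cc z) (yen z) (\<tau>(a := 0)))"
    using z(2) by (simp add: C_domain_def C_integrand_peel)
  have EE: "EA S = ES" by (simp add: EA_def edges_induced)
  have "C_integral G \<alpha> S a z = of_real \<alpha> ^ (card S - 1) * (\<Prod>e\<in>ES.
      Beta (of_real (\<alpha> / 2) * (sum (cc z) (S \<inter> D e) + yen z e)) (of_real (\<alpha> / 2) * (yen z e - sum (cc z) (S \<inter> D e))) / 2)"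
    unfolding C_integral_def C_integrand_peel peel_integral[OF grow_all s0 int] EE ..
  \<comment> \<open>A tree has one edge fewer than vertices, so each edge receives exactly one
    factor \<alpha>; the 1/2 of the Beta integral completes it to \<alpha>/2.\<close>
  also have "card S - 1 = card ES" using card_EA[OF grow_all] EE by simp
  also have "of_real \<alpha> ^ card ES * (\<Prod>e\<in>ES.
      Beta (of_real (\<alpha> / 2) * (sum (cc z) (S \<inter> D e) + yen z e)) (of_real (\<alpha> / 2) * (yen z e - sum (cc z) (S \<inter> D e))) / 2)
    = (\<Prod>e\<in>ES. of_real \<alpha> * (
      Beta (of_real (\<alpha> / 2) * (sum (cc z) (S \<inter> D e) + yen z e)) (of_real (\<alpha> / 2) * (yen z e - sum (cc z) (S \<inter> D e))) / 2))"
    by (simp only: prod.distrib prod_constant)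
  also have "\<dots> = beta_product G \<alpha> S D z"
    unfolding beta_product_def
  proof (rule prod.cong[OF refl])
    fix e assume e: "e \<in> ES"
    have De: "S \<inter> D e = D e" using D_subset[OF e] by auto
    have "(\<Sum>v\<in>S - D e. cc z v) = - (\<Sum>v\<in>D e. cc z v)"
      using s0 sum.subset_diff[OF D_subset[OF e], of "cc z"] by (simp add: eq_neg_iff_add_eq_0)
    then have "Xsum G (S - D e) z = yen z e - sum (cc z) (D e)" "Xsum G (D e) z = sum (cc z) (D e) + yen z e"
      using Xsum_side[OF e, of "S - D e" z] Xsum_side[OF e, of "D e" z] by simp_all
    then show "of_real \<alpha> * (Beta (of_real (\<alpha> / 2) * (sum (cc z) (S \<inter> D e) + yen z e))
        (of_real (\<alpha> / 2) * (yen z e - sum (cc z) (S \<inter> D e))) / 2)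
      = of_real (\<alpha> / 2) * Beta (of_real (\<alpha> / 2) * Xsum G (D e) z) (of_real (\<alpha> / 2) * Xsum G (S - D e) z)"
      by (simp add: De)
  qed
  finally show ?thesis .
qed

end

lemma Xsum_line: "Xsum G A (z + t *s h) = Xsum G A z + t * Xsum G A h"
  by (simp add: Xsum_def sum.distrib sum_distrib_left algebra_simps)

lemma holo_on_Xsum: "holo_on (Xsum G A) U"
  unfolding Xsum_def[abs_def] by (intro holo_on_add holo_on_sum holo_on_component)

lemma complex_affine_Xplane:
  fixes G :: "('v::finite, 'e::finite) multigraph"
  shows "complex_affine (Xplane G A)"
  unfolding complex_affine_def Xplane_def
proof (intro ballI allI)
  fix z w :: "('v, 'e) energies" and t :: complex
  assume *: "z \<in> {z. Xsum G A z = 0}" "w \<in> {z. Xsum G A z = 0}"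
  have "Xsum G A (z + 1 *s (w - z)) = Xsum G A z + 1 * Xsum G A (w - z)" by (rule Xsum_line)
  then have "Xsum G A (w - z) = 0" using * by simp
  then show "z + t *s (w - z) \<in> {z. Xsum G A z = 0}" using * by (simp only: Xsum_line mem_Collect_eq) simp
qed

context tree_block
begin

text \<open>Since a lies in S, varying x_a alone changes X_S at unit rate.\<close>

lemma linear_form_Xsum: "linear_form (Xsum G S) (axis (Inl a) 1)"
proof
  show "holo_on (Xsum G S) UNIV" by (rule holo_on_Xsum)
  have "Xsum G S (axis (Inl a) 1) = 1"
    using a by (simp add: Xsum_def axis_def)
  then show "Xsum G S (z + t *s axis (Inl a) 1) = Xsum G S z + t" for z t
    by (simp add: Xsum_line)
  show "complex_affine {z. Xsum G S z = 0}"
    using complex_affine_Xplane[of G S] by (simp add: Xplane_def)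
qed

section \<open>Meromorphy of the Beta product on the hyperplane\<close>

text \<open>Raising the energies of all tree edges stays in the hyperplane, as internal edges do not
  enter X_S, yet raises every X_A for a side A of an edge at unit rate. It is a direction in which
  all poles can be avoided at once.\<close>

definition tree_dir :: "('v, 'e) energies" where
  "tree_dir = (\<chi> i. case i of Inl v \<Rightarrow> 0 | Inr e \<Rightarrow> if e \<in> ES then 1 else 0)"

lemma boundary_not_ES: "e \<in> edge_boundary G S \<Longrightarrow> e \<notin> ES"
proof
  assume *: "e \<in> edge_boundary G S" "e \<in> ES"
  then have eG: "e \<in> edges G" by (simp add: ES)
  obtain u v where uv: "ends G e = {u, v}" "u \<noteq> v" using ends_pair[OF eG] by metis
  show False using edge_boundary_pair[OF uv eG, of S] * uv ES by auto
qed

lemma cc_tree_dir: "cc tree_dir v = 0"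
  unfolding cc_def eta_def tree_dir_def using boundary_not_ES by (auto intro!: sum.neutral)

text \<open>In terms of the entire function \<open>rGamma\<close>, numerator and denominator are
  holomorphic everywhere. It remains to find, near each point of the hyperplane, another point of it
  at which no denominator vanishes.\<close>

lemma mero_on_beta_product: "mero_on (beta_product G \<alpha> S D) (Xplane G S)"
proof (rule mero_onI_ball[OF complex_affine_Xplane])
  fix p assume p: "p \<in> Xplane G S"
  define X where "X = (\<lambda>A z. of_real (\<alpha> / 2) * Xsum G A z)"
  define g where "g = (\<lambda>z. \<Prod>e\<in>ES. of_real (\<alpha> / 2) * rGamma (X (D e) z + X (S - D e) z))"
  define h where "h = (\<lambda>z. \<Prod>e\<in>ES. rGamma (X (D e) z) * rGamma (X (S - D e) z))"
  have hX: "holo_on (X A) U" for A U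
    unfolding X_def by (intro holo_on_mult holo_on_const holo_on_Xsum)
  have gh: "holo_on g U" "holo_on h U" for U
    unfolding g_def h_def
    by (intro holo_on_prod holo_on_mult holo_on_const holo_on_compose[where g = rGamma] holo_on_add hX
        field_differentiable_rGamma)+
  \<comment> \<open>Valid at the poles as well, since \<open>Gamma\<close> is the inverse of
    \<open>rGamma\<close> and the inverse of 0 is 0.\<close>
  have val: "beta_product G \<alpha> S D z = g z / h z" for z
    unfolding beta_product_def g_def h_def prod_dividef[symmetric]
    by (rule prod.cong) (simp_all add: Beta_altdef Gamma_def X_def field_simps)
  define \<A> where "\<A> = D ` ES \<union> (\<lambda>e. S - D e) ` ES"
  have one: "Xsum G A tree_dir = 1" if A: "A \<in> \<A>" for A
  proof -
    obtain e where e: "e \<in> ES" "A = D e \<or> A = S - D e" using A by (auto simp: \<A>_def)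
    have "yen tree_dir e = 1" using e(1) by (simp add: tree_dir_def)
    then show ?thesis using Xsum_side[OF e] by (simp add: cc_tree_dir)
  qed
  \<comment> \<open>Each argument moves injectively in t and has to avoid only the countable set of
    nonpositive integers, so the bad parameters are countable while every interval is not.\<close>
  define bad where "bad = (\<Union>A\<in>\<A>. {t::real. X A p + of_real (\<alpha> / 2) * of_real t \<in> \<int>\<^sub>\<le>\<^sub>0})"
  have "countable bad"
    unfolding bad_def
  proof (rule countable_UN)
    fix A
    have inj: "inj_on (\<lambda>t::real. X A p + of_real (\<alpha> / 2) * of_real t) T" for T
      using \<alpha> by (auto simp: inj_on_def)
    have "(\<int>\<^sub>\<le>\<^sub>0 :: complex set) \<subseteq> \<int>" by (rule nonpos_Ints_subset_Ints)
    then have "countable (\<int>\<^sub>\<le>\<^sub>0 :: complex set)"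
      using countable_subset countable_int Ints_def by (metis countable_image uncountable_def countableI_type)
    then have "countable ((\<lambda>t::real. X A p + of_real (\<alpha> / 2) * of_real t) `
        {t. X A p + of_real (\<alpha> / 2) * of_real t \<in> \<int>\<^sub>\<le>\<^sub>0})"
      by (rule countable_subset[rotated]) auto
    then show "countable {t::real. X A p + of_real (\<alpha> / 2) * of_real t \<in> \<int>\<^sub>\<le>\<^sub>0}"
      by (rule countable_image_inj_on[OF _ inj])
  qed simp
  define r where "r = 1 / (norm tree_dir + 1)"
  have r: "r > 0" by (simp add: r_def add_nonneg_pos)
  then have "uncountable {0<..<r}" by (simp add: uncountable_open_interval)
  then obtain t where t: "0 < t" "t < r" "t \<notin> bad"
    using \<open>countable bad\<close> by (metis countable_subset greaterThanLessThan_iff subsetI)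
  define z where "z = p + of_real t *s tree_dir"
  have "norm (of_real t *s tree_dir) < 1"
  proof -
    have "t * norm tree_dir \<le> r * norm tree_dir" using t by (intro mult_right_mono) auto
    also have "\<dots> < 1"
    proof -
      have "norm tree_dir + 1 > 0" by (simp add: add_nonneg_pos)
      then show ?thesis by (simp add: r_def)
    qed
    finally show ?thesis using t by (simp add: norm_smult)
  qed
  then have zb: "z \<in> ball p 1" by (simp add: z_def dist_norm)
  have "Xsum G S tree_dir = 0" by (simp add: Xsum_S cc_tree_dir)
  then have zH: "z \<in> Xplane G S" using p by (simp add: Xplane_def z_def Xsum_line)
  have "rGamma (X A z) \<noteq> 0" if A: "A \<in> \<A>" for A
  proof -
    have "X A z = X A p + of_real (\<alpha> / 2) * of_real t"
      by (simp add: X_def z_def Xsum_line one[OF A] algebra_simps)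
    then have "X A z \<notin> \<int>\<^sub>\<le>\<^sub>0" using t(3) A by (auto simp: bad_def)
    then show ?thesis by (simp add: rGamma_eq_zero_iff)
  qed
  then have "h z \<noteq> 0" by (auto simp: h_def \<A>_def)
  then show "\<exists>r g h. r > 0 \<and> holo_on g (ball p r) \<and> holo_on h (ball p r) \<and>
      (\<exists>z\<in>ball p r \<inter> Xplane G S. h z \<noteq> 0) \<and>
      (\<forall>z\<in>ball p r \<inter> Xplane G S. h z \<noteq> 0 \<longrightarrow> beta_product G \<alpha> S D z = g z / h z)"
    using gh val zb zH by (intro exI[of _ 1] exI[of _ g] exI[of _ h]) auto
qed

end

section \<open>Integration along the cluster direction\<close>

text \<open>The defect of tanh t tanh(t + s) from 1. It equals cosh s / (cosh t cosh(t + s)) and so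
  decays like exp(-2 \<bar>t\<bar>) once t dominates s.\<close>

definition rho :: "real \<Rightarrow> real \<Rightarrow> real" where
  "rho s t = 1 - tanh t * tanh (t + s)"

lemma abs_tanh_less: "\<bar>tanh (x::real)\<bar> < 1"
  using tanh_real_lt_1[of x] tanh_real_gt_neg1[of x] by linarith

lemma rho_bounds: "0 \<le> rho s t" "rho s t \<le> 2"
proof -
  have "\<bar>tanh t * tanh (t + s)\<bar> \<le> 1 * 1"
    unfolding abs_mult using abs_tanh_less less_imp_le by (intro mult_mono) auto
  then show "0 \<le> rho s t" "rho s t \<le> 2" by (auto simp: rho_def abs_le_iff)
qed

lemma cosh_ge_exp: "exp \<bar>x\<bar> / 2 \<le> cosh (x::real)"
  by (cases "x \<ge> 0") (auto simp: cosh_def)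

text \<open>For \<bar>s\<bar> \<le> \<bar>t\<bar> the quotient of cosh values gives rate 2;
  otherwise the exponential is at least 1 and the bound 2 suffices. The rate \<delta> is left free
  because it is paid for by growth exp(\<delta> L) in the relative coordinates.\<close>

lemma rho_le:
  assumes "0 \<le> \<delta>" "\<delta> \<le> 2" "\<bar>s\<bar> \<le> L"
  shows "rho s t \<le> 4 * exp (\<delta> * (L - \<bar>t\<bar>))"
proof (cases "\<bar>s\<bar> \<le> \<bar>t\<bar>")
  case True
  have eq: "rho s t = cosh s / (cosh t * cosh (t + s))"
  proof -
    have "cosh t * cosh (t + s) - sinh t * sinh (t + s) = cosh ((t + s) - t)"
      unfolding cosh_diff by (simp add: algebra_simps)
    moreover have "rho s t = (cosh t * cosh (t + s) - sinh t * sinh (t + s)) / (cosh t * cosh (t + s))"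
      by (simp add: rho_def tanh_def diff_divide_distrib)
    ultimately show ?thesis by simp
  qed
  have cs: "cosh s \<le> exp \<bar>s\<bar>" by (cases "s \<ge> 0") (auto simp: cosh_def)
  have "exp \<bar>t\<bar> / 2 * (exp (\<bar>t\<bar> - \<bar>s\<bar>) / 2) \<le> cosh t * cosh (t + s)"
  proof (rule mult_mono)
    have "exp (\<bar>t\<bar> - \<bar>s\<bar>) \<le> exp \<bar>t + s\<bar>" by simp
    then show "exp (\<bar>t\<bar> - \<bar>s\<bar>) / 2 \<le> cosh (t + s)" using cosh_ge_exp[of "t + s"] by linarith
    show "exp \<bar>t\<bar> / 2 \<le> cosh t" by (rule cosh_ge_exp)
  qed auto
  then have "rho s t \<le> exp \<bar>s\<bar> / (exp \<bar>t\<bar> / 2 * (exp (\<bar>t\<bar> - \<bar>s\<bar>) / 2))"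
    unfolding eq using cs by (intro frac_le) auto
  also have "\<dots> = 4 * exp (2 * (\<bar>s\<bar> - \<bar>t\<bar>))"
    by (simp add: exp_diff exp_add[symmetric] field_simps flip: exp_add)
  also have "\<dots> \<le> 4 * exp (\<delta> * (\<bar>s\<bar> - \<bar>t\<bar>))"
    using mult_right_mono_neg[OF assms(2), of "\<bar>s\<bar> - \<bar>t\<bar>"] True by simp
  also have "\<dots> \<le> 4 * exp (\<delta> * (L - \<bar>t\<bar>))" using assms by (simp add: mult_left_mono)
  finally show ?thesis .
next
  case False
  have "0 \<le> \<delta> * (L - \<bar>t\<bar>)" using False assms by simp
  then have "1 \<le> exp (\<delta> * (L - \<bar>t\<bar>))" by simp
  then show ?thesis using rho_bounds(2)[of s t] by linarith
qed

lemma lcosh_shift_tendsto: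
  "((\<lambda>t. lcosh (s + t) - t) \<longlongrightarrow> s) at_top" "((\<lambda>t. lcosh (s + t) + t) \<longlongrightarrow> - s) at_bot"
proof -
  have *: "((\<lambda>t. lcosh (s + t) - t) \<longlongrightarrow> s) at_top" for s
  proof -
    have eq: "lcosh (s + t) - t = s + ln (1 + exp (- 2 * (s + t)))" for t
    proof -
      have p: "1 + exp (- 2 * (s + t)) > 0" by (simp add: add_pos_pos)
      have "exp (lcosh (s + t)) = exp ((s + t) + ln (1 + exp (- 2 * (s + t))))"
        unfolding exp_lcosh exp_add[of "s + t" "ln _"] using p
        by (simp add: distrib_left flip: exp_add)
      then show ?thesis by simp
    qed
    have "((\<lambda>t. exp (- 2 * (s + t))) \<longlongrightarrow> 0) at_top"
    proof (rule filterlim_compose[OF exp_at_bot])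
      have "filterlim (\<lambda>t. s + t) at_top at_top"
        by (rule filterlim_tendsto_add_at_top[OF tendsto_const filterlim_ident])
      then show "filterlim (\<lambda>t. - 2 * (s + t)) at_bot at_top"
        by (intro filterlim_tendsto_neg_mult_at_bot[OF tendsto_const]) auto
    qed
    then have "((\<lambda>t. s + ln (1 + exp (- 2 * (s + t)))) \<longlongrightarrow> s + ln (1 + 0)) at_top"
      by (intro tendsto_intros) auto
    then show ?thesis unfolding eq by simp
  qed
  show "((\<lambda>t. lcosh (s + t) - t) \<longlongrightarrow> s) at_top" by (rule *)
  have "lcosh (- s + t) - t = lcosh (s + - t) + - t" for t
    using lcosh_minus[of "- s + t"] by simp
  then show "((\<lambda>t. lcosh (s + t) + t) \<longlongrightarrow> - s) at_bot"
    using *[of "- s"] unfolding filterlim_at_bot_mirror[of "\<lambda>t. lcosh (s + t) + t"] by simp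
qed

lemma integral_FTC_real_line:
  fixes F f :: "real \<Rightarrow> complex"
  assumes D: "\<And>t. (F has_vector_derivative f t) (at t)" and c: "\<And>t. isCont f t"
    and i: "integrable lborel f"
    and l: "(F \<longlongrightarrow> A) at_bot" and u: "(F \<longlongrightarrow> B) at_top"
  shows "(LINT t|lborel. f t) = B - A"
proof -
  have "(LBINT x=-\<infinity>..\<infinity>. f x) = B - A"
  proof (rule interval_integral_FTC_integrable)
    show "set_integrable lborel (einterval (-\<infinity>) \<infinity>) f" using i by (simp add: set_integrable_def)
    show "((F \<circ> real_of_ereal) \<longlongrightarrow> A) (at_right (-\<infinity>))" using l by (simp only: ereal_tendsto_simps)
    show "((F \<circ> real_of_ereal) \<longlongrightarrow> B) (at_left \<infinity>)" using u by (simp only: ereal_tendsto_simps)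
  qed (use D c in auto)
  then show ?thesis by (simp add: interval_lebesgue_integral_def set_lebesgue_integral_def)
qed

text \<open>
  The integrand along a direction in which finitely many factors \<open>(2 cosh (s i + t)) powr (- \<alpha> * c i)\<close>
  move simultaneously. Multiplying by \<open>tanh t\<close> before differentiating produces a remainder that
  decays exponentially independently of the exponents, which continues the integral across
  \<open>(\<Sum>i\<in>J. c i) = 0\<close>.
\<close>

definition cluster :: "real \<Rightarrow> 'i set \<Rightarrow> ('i \<Rightarrow> complex) \<Rightarrow> ('i \<Rightarrow> real) \<Rightarrow> real \<Rightarrow> complex" where
  "cluster \<alpha> J c s t = exp (- of_real \<alpha> * (\<Sum>i\<in>J. c i * of_real (lcosh (s i + t))))"

text \<open>The quotient by \<open>cluster\<close> of what is left of the derivative of tanh t times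
  \<open>cluster\<close> once the multiple of the exponent sum is removed. Every term carries a
  factor \<open>rho\<close>.\<close>

definition remainder :: "real \<Rightarrow> 'i set \<Rightarrow> ('i \<Rightarrow> complex) \<Rightarrow> ('i \<Rightarrow> real) \<Rightarrow> real \<Rightarrow> complex" where
  "remainder \<alpha> J c s t = of_real (rho 0 t) + of_real \<alpha> * (\<Sum>i\<in>J. c i * of_real (rho (s i) t))"

text \<open>Each product tanh t tanh(s i + t) is 1 minus \<open>rho (s i) t\<close>: the ones
  collect into the sum of the exponents, the rest into \<open>remainder\<close>.\<close>

lemma cluster_derivative:
  assumes "finite J"
  shows "((\<lambda>t. of_real (tanh t) * cluster \<alpha> J c s t) has_vector_derivative
    cluster \<alpha> J c s t * remainder \<alpha> J c s t - of_real \<alpha> * (\<Sum>i\<in>J. c i) * cluster \<alpha> J c s t) (at t)"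
proof -
  have dt: "((\<lambda>t. complex_of_real (tanh t)) has_vector_derivative of_real (rho 0 t)) (at t)"
  proof -
    have "(tanh has_real_derivative rho 0 t) (at t)"
      using DERIV_ident[THEN has_field_derivative_tanh[rotated], of t UNIV]
      by (auto simp: rho_def power2_eq_square)
    then show ?thesis
      by (intro has_vector_derivative_of_real) (simp add: has_real_derivative_iff_has_vector_derivative)
  qed
  have dl: "((\<lambda>t. complex_of_real (lcosh (s i + t))) has_vector_derivative of_real (tanh (s i + t))) (at t)" for i
  proof -
    have "((\<lambda>t. lcosh (s i + t)) has_real_derivative tanh (s i + t) * 1) (at t)"
      by (rule DERIV_chain2[OF DERIV_lcosh]) (auto intro!: derivative_eq_intros)
    then show ?thesis
      by (intro has_vector_derivative_of_real) (simp add: has_real_derivative_iff_has_vector_derivative)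
  qed
  define E where "E = (\<lambda>t. - of_real \<alpha> * (\<Sum>i\<in>J. c i * of_real (lcosh (s i + t))))"
  have dE: "(E has_vector_derivative - of_real \<alpha> * (\<Sum>i\<in>J. c i * of_real (tanh (s i + t)))) (at t)"
    unfolding E_def by (intro has_vector_derivative_mult_right has_vector_derivative_sum dl)
  have dc: "(cluster \<alpha> J c s has_vector_derivative
      (- of_real \<alpha> * (\<Sum>i\<in>J. c i * of_real (tanh (s i + t)))) * cluster \<alpha> J c s t) (at t)"
  proof -
    have "(exp has_field_derivative exp (E t)) (at (E t))" by (rule DERIV_exp)
    from field_vector_diff_chain_at[OF dE this]
    show ?thesis by (simp add: o_def cluster_def[abs_def] E_def)
  qed
  have ti: "complex_of_real (tanh t) * of_real (tanh (s i + t)) = 1 - of_real (rho (s i) t)" for i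
    by (simp add: rho_def add.commute)
  have "of_real (tanh t) * (\<Sum>i\<in>J. c i * of_real (tanh (s i + t))) = (\<Sum>i\<in>J. c i) - (\<Sum>i\<in>J. c i * of_real (rho (s i) t))"
    unfolding sum_distrib_left sum_subtractf[symmetric]
  proof (rule sum.cong[OF refl])
    fix i
    have "of_real (tanh t) * (c i * of_real (tanh (s i + t))) = c i * (complex_of_real (tanh t) * of_real (tanh (s i + t)))"
      by (simp add: algebra_simps)
    then show "of_real (tanh t) * (c i * of_real (tanh (s i + t))) = c i - c i * of_real (rho (s i) t)"
      unfolding ti by (simp add: algebra_simps)
  qed
  note tT = this
  have eq: "of_real (tanh t) * ((- of_real \<alpha> * (\<Sum>i\<in>J. c i * of_real (tanh (s i + t)))) * cluster \<alpha> J c s t)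
      = - of_real \<alpha> * ((\<Sum>i\<in>J. c i) - (\<Sum>i\<in>J. c i * of_real (rho (s i) t))) * cluster \<alpha> J c s t"
    unfolding tT[symmetric] by (simp only: mult_ac mult_minus_left mult_minus_right)
  from has_vector_derivative_mult[OF dt dc]
  have "((\<lambda>t. of_real (tanh t) * cluster \<alpha> J c s t) has_vector_derivative
    of_real (tanh t) * ((- of_real \<alpha> * (\<Sum>i\<in>J. c i * of_real (tanh (s i + t)))) * cluster \<alpha> J c s t)
     + of_real (rho 0 t) * cluster \<alpha> J c s t) (at t)" .
  then show ?thesis unfolding eq by (rule has_vector_derivative_eq_rhs) (simp add: remainder_def algebra_simps)
qed

lemma continuous_cluster: "continuous_on UNIV (cluster \<alpha> J c s)"
  unfolding cluster_def by (intro continuous_intros)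

lemma continuous_remainder: "continuous_on UNIV (remainder \<alpha> J c s)"
  unfolding remainder_def rho_def
  by (intro continuous_intros) (auto simp: cosh_real_nonzero)

text \<open>Because the exponents sum to zero, t may be subtracted from, or added to, every
  \<open>lcosh (s i + t)\<close> without changing the value, and then each term has a finite
  limit.\<close>

lemma cluster_tendsto:
  assumes J: "finite J" and 0: "(\<Sum>i\<in>J. c i) = 0"
  shows "(cluster \<alpha> J c s \<longlongrightarrow> exp (- of_real \<alpha> * (\<Sum>i\<in>J. c i * of_real (s i)))) at_top"
    "(cluster \<alpha> J c s \<longlongrightarrow> exp (of_real \<alpha> * (\<Sum>i\<in>J. c i * of_real (s i)))) at_bot"
proof -
  have s0: "(\<Sum>i\<in>J. c i * w) = 0" for w using 0 by (simp flip: sum_distrib_right)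
  have 1: "cluster \<alpha> J c s = (\<lambda>t. exp (- of_real \<alpha> * (\<Sum>i\<in>J. c i * of_real (lcosh (s i + t) - t))))"
    unfolding cluster_def using s0 by (simp add: right_diff_distrib sum_subtractf)
  have 2: "cluster \<alpha> J c s = (\<lambda>t. exp (- of_real \<alpha> * (\<Sum>i\<in>J. c i * of_real (lcosh (s i + t) + t))))"
    unfolding cluster_def using s0 by (simp add: distrib_left sum.distrib)
  show "(cluster \<alpha> J c s \<longlongrightarrow> exp (- of_real \<alpha> * (\<Sum>i\<in>J. c i * of_real (s i)))) at_top"
    unfolding 1 by (intro tendsto_intros lcosh_shift_tendsto)
  have "(cluster \<alpha> J c s \<longlongrightarrow> exp (- of_real \<alpha> * (\<Sum>i\<in>J. c i * of_real (- s i)))) at_bot"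
    unfolding 2 by (intro tendsto_intros lcosh_shift_tendsto)
  then show "(cluster \<alpha> J c s \<longlongrightarrow> exp (of_real \<alpha> * (\<Sum>i\<in>J. c i * of_real (s i)))) at_bot"
    by (simp add: sum_negf)
qed

lemma norm_cluster: "norm (cluster \<alpha> J c s t) = exp (- \<alpha> * (\<Sum>i\<in>J. Re (c i) * lcosh (s i + t)))"
  by (simp add: cluster_def)

text \<open>Without a sign condition the factor may grow in t, but only at a rate proportional to
  \<epsilon>; near the base point this is slower than the decay of the remainder.\<close>

lemma norm_cluster_le:
  assumes J: "finite J" and \<alpha>: "\<alpha> > 0" and c: "\<And>i. i \<in> J \<Longrightarrow> norm (c i) \<le> \<epsilon>" and s: "\<And>i. i \<in> J \<Longrightarrow> \<bar>s i\<bar> \<le> L"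
  shows "norm (cluster \<alpha> J c s t) \<le> exp (\<alpha> * (real (card J) * \<epsilon>) * (L + \<bar>t\<bar> + ln 2))"
proof -
  have "- (\<Sum>i\<in>J. Re (c i) * lcosh (s i + t)) \<le> (\<Sum>i\<in>J. \<epsilon> * (L + \<bar>t\<bar> + ln 2))"
    unfolding sum_negf[symmetric]
  proof (rule sum_mono)
    fix i assume i: "i \<in> J"
    have "lcosh (s i + t) \<le> L + \<bar>t\<bar> + ln 2" using lcosh_le[of "s i + t"] s[OF i] by linarith
    moreover have "- Re (c i) \<le> \<epsilon>" using c[OF i] abs_Re_le_cmod[of "c i"] by linarith
    moreover have "0 \<le> \<epsilon>" using c[OF i] norm_ge_zero order_trans by blast
    ultimately have "- Re (c i) * lcosh (s i + t) \<le> \<epsilon> * (L + \<bar>t\<bar> + ln 2)"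
      by (intro mult_mono lcosh_nonneg)
    then show "- (Re (c i) * lcosh (s i + t)) \<le> \<epsilon> * (L + \<bar>t\<bar> + ln 2)" by simp
  qed
  then have "\<alpha> * - (\<Sum>i\<in>J. Re (c i) * lcosh (s i + t)) \<le> \<alpha> * (\<Sum>i\<in>J. \<epsilon> * (L + \<bar>t\<bar> + ln 2))"
    using \<alpha> by (intro mult_left_mono) auto
  then show ?thesis unfolding norm_cluster by (simp add: algebra_simps)
qed

lemma norm_cluster_le_pos:
  assumes J: "finite J" and \<alpha>: "\<alpha> > 0" and c: "\<And>i. i \<in> J \<Longrightarrow> Re (c i) \<ge> 0" and s: "\<And>i. i \<in> J \<Longrightarrow> \<bar>s i\<bar> \<le> L"
  shows "norm (cluster \<alpha> J c s t) \<le> exp (- \<alpha> * (\<Sum>i\<in>J. Re (c i)) * (\<bar>t\<bar> - L))"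
proof -
  have "(\<Sum>i\<in>J. Re (c i)) * (\<bar>t\<bar> - L) \<le> (\<Sum>i\<in>J. Re (c i) * lcosh (s i + t))"
    unfolding sum_distrib_right
  proof (rule sum_mono)
    fix i assume i: "i \<in> J"
    have "\<bar>t\<bar> - L \<le> lcosh (s i + t)" using lcosh_ge[of "s i + t"] s[OF i] by linarith
    then show "Re (c i) * (\<bar>t\<bar> - L) \<le> Re (c i) * lcosh (s i + t)" using c[OF i] by (rule mult_left_mono)
  qed
  then show ?thesis unfolding norm_cluster using \<alpha> by (simp add: mult.assoc mult_left_mono)
qed

lemma norm_remainder_le:
  assumes J: "finite J" and \<alpha>: "\<alpha> > 0" and c: "\<And>i. i \<in> J \<Longrightarrow> norm (c i) \<le> \<epsilon>" and s: "\<And>i. i \<in> J \<Longrightarrow> \<bar>s i\<bar> \<le> L"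
    and \<delta>: "0 \<le> \<delta>" "\<delta> \<le> 2" and L: "0 \<le> L"
  shows "norm (remainder \<alpha> J c s t) \<le> 4 * (1 + \<alpha> * (real (card J) * \<epsilon>)) * exp (\<delta> * (L - \<bar>t\<bar>))"
proof -
  define X where "X = 4 * exp (\<delta> * (L - \<bar>t\<bar>))"
  have "norm (remainder \<alpha> J c s t) \<le> norm (complex_of_real (rho 0 t)) + norm (of_real \<alpha> * (\<Sum>i\<in>J. c i * of_real (rho (s i) t)))"
    unfolding remainder_def by (rule norm_triangle_ineq)
  also have "\<dots> = rho 0 t + \<alpha> * norm (\<Sum>i\<in>J. c i * of_real (rho (s i) t))"
    using rho_bounds(1)[of 0 t] \<alpha> by (simp add: norm_mult)
  also have "\<dots> \<le> X + \<alpha> * (\<Sum>i\<in>J. \<epsilon> * X)"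
  proof (intro add_mono mult_left_mono)
    show "rho 0 t \<le> X" unfolding X_def using L by (intro rho_le \<delta>) simp
    show "norm (\<Sum>i\<in>J. c i * of_real (rho (s i) t)) \<le> (\<Sum>i\<in>J. \<epsilon> * X)"
    proof (rule sum_norm_le)
      fix i assume i: "i \<in> J"
      have "0 \<le> \<epsilon>" using c[OF i] norm_ge_zero order_trans by blast
      then show "norm (c i * complex_of_real (rho (s i) t)) \<le> \<epsilon> * X"
        unfolding norm_mult X_def using c[OF i] rho_bounds(1)[of "s i" t] rho_le[OF \<delta> s[OF i], of t]
        by (intro mult_mono) auto
    qed
  qed (use \<alpha> in simp)
  also have "\<dots> = (1 + \<alpha> * (real (card J) * \<epsilon>)) * X" by (simp add: algebra_simps)
  finally show ?thesis by (simp only: X_def mult_ac)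
qed

section \<open>The integral near the base point\<close>

lemma measurable_tanh: "(tanh :: real \<Rightarrow> real) \<in> borel_measurable borel"
  by (intro borel_measurable_continuous_onI continuous_intros) (auto simp: cosh_real_nonzero)

lemma measurable_rho [measurable (raw)]:
  assumes "s \<in> borel_measurable M" "t \<in> borel_measurable M"
  shows "(\<lambda>x. rho (s x) (t x)) \<in> borel_measurable M"
  unfolding rho_def using assms measurable_compose[OF _ measurable_tanh] by measurable

lemma measurable_lcosh_compose [measurable (raw)]:
  "s \<in> borel_measurable M \<Longrightarrow> (\<lambda>x. lcosh (s x)) \<in> borel_measurable M"
  using measurable_compose[OF _ measurable_lcosh] by blast

lemma measurable_upd_component [measurable]:
  "(\<lambda>\<tau>. (\<tau>(a := 0)) v) \<in> borel_measurable (lbs I)"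
  by (cases "v = a") simp_all

context loopless
begin

lemma induced_verts: "induced G (verts G) = G"
proof -
  have "{e \<in> edges G. ends G e \<subseteq> verts G} = edges G"
    using loopless by (auto simp: loopless_multigraph_def)
  then show ?thesis by (simp add: induced_def)
qed

lemma measurable_edge_len:
  assumes e: "e \<in> edges G" and f: "\<And>v. (\<lambda>x. f x v) \<in> borel_measurable M"
  shows "(\<lambda>x. edge_len G (f x) e) \<in> borel_measurable M"
proof -
  obtain u v where uv: "ends G e = {u, v}" using ends_pair[OF e] by metis
  show ?thesis unfolding edge_len_eq[OF uv] using f by measurable
qed

end

context tree_block
begin

abbreviation V where "V \<equiv> verts G"
abbreviation B where "B \<equiv> edge_boundary G S"

definition inn :: "'e \<Rightarrow> 'v" where "inn e = (SOME v. v \<in> ends G e \<inter> S)"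
definition out :: "'e \<Rightarrow> 'v" where "out e = (SOME v. v \<in> ends G e - S)"

lemma inn_out:
  assumes "e \<in> B"
  shows "ends G e = {inn e, out e}" "inn e \<in> S" "out e \<in> V - S"
proof -
  have e: "e \<in> edges G" using assms by (simp add: edge_boundary_def)
  obtain u v where uv: "ends G e = {u, v}" "u \<noteq> v" "u \<in> V" "v \<in> V" using ends_pair[OF e] by metis
  have x: "(u \<in> S) \<noteq> (v \<in> S)" using edge_boundary_pair[OF uv(1,2) e] assms by blast
  have i: "inn e \<in> ends G e \<inter> S" unfolding inn_def by (rule someI_ex) (use x uv in auto)
  have o: "out e \<in> ends G e - S" unfolding out_def by (rule someI_ex) (use x uv in auto)
  show "ends G e = {inn e, out e}" "inn e \<in> S" "out e \<in> V - S" using i o uv by auto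
qed

section \<open>Factors that feel the common translation of S, and coercivity of the others\<close>

text \<open>The indices whose cosh factor changes when S is translated as a whole; they are exactly
  the energies that add up to X_S. Other vertices and edges of G are \<open>rigid\<close>, and
  indices outside G belong to neither.\<close>

definition moving :: "('v + 'e) set" where "moving = S <+> B"
definition rigid :: "('v + 'e) set" where "rigid = (V - S) <+> (edges G - B)"

text \<open>The offset to which t is added. Boundary edges are oriented from the endpoint in S
  outwards, so that t enters with the same sign for vertices and edges.\<close>

definition shift :: "('v \<Rightarrow> real) \<Rightarrow> 'v + 'e \<Rightarrow> real" where
  "shift \<sigma> i = (case i of Inl v \<Rightarrow> \<sigma> v | Inr e \<Rightarrow> \<sigma> (inn e) - \<sigma> (out e))"

definition len :: "('v \<Rightarrow> real) \<Rightarrow> 'v + 'e \<Rightarrow> real" where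
  "len \<sigma> i = (case i of Inl v \<Rightarrow> lcosh (\<sigma> v) | Inr e \<Rightarrow> edge_len G \<sigma> e)"

definition rigid_factor :: "('v, 'e) energies \<Rightarrow> ('v \<Rightarrow> real) \<Rightarrow> complex" where
  "rigid_factor z \<sigma> = exp (- of_real \<alpha> * (\<Sum>i\<in>rigid. z $ i * of_real (len \<sigma> i)))"

abbreviation cl where "cl z \<sigma> \<equiv> cluster \<alpha> moving (($) z) (shift \<sigma>)"
abbreviation rem where "rem z \<sigma> \<equiv> remainder \<alpha> moving (($) z) (shift \<sigma>)"

definition L1 :: "('v \<Rightarrow> real) \<Rightarrow> real" where
  "L1 \<sigma> = (\<Sum>v\<in>V - {a}. \<bar>\<sigma> v\<bar>)"

lemma aV: "a \<in> V" using a S_verts by auto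

lemma L1_nonneg: "0 \<le> L1 \<sigma>"
  by (simp add: L1_def sum_nonneg)

lemma sum_abs_le_L1:
  assumes "\<sigma> a = 0" "A \<subseteq> V"
  shows "(\<Sum>v\<in>A. \<bar>\<sigma> v\<bar>) \<le> L1 \<sigma>"
proof -
  have "(\<Sum>v\<in>A. \<bar>\<sigma> v\<bar>) = (\<Sum>v\<in>A - {a}. \<bar>\<sigma> v\<bar>)"
    by (rule sum.mono_neutral_right) (use assms in auto)
  also have "\<dots> \<le> L1 \<sigma>" unfolding L1_def by (rule sum_mono2) (use assms in auto)
  finally show ?thesis .
qed

lemma shift_le:
  assumes \<sigma>: "\<sigma> a = 0" and i: "i \<in> moving"
  shows "\<bar>shift \<sigma> i\<bar> \<le> L1 \<sigma>"
proof (cases i)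
  case (Inl v)
  then have "v \<in> V" using i S_verts by (auto simp: moving_def)
  then show ?thesis using sum_abs_le_L1[where \<sigma> = \<sigma>, OF \<sigma>, of "{v}"] Inl by (simp add: shift_def)
next
  case (Inr e)
  then have e: "e \<in> B" using i by (auto simp: moving_def)
  have "\<bar>shift \<sigma> i\<bar> \<le> (\<Sum>v\<in>{inn e, out e}. \<bar>\<sigma> v\<bar>)"
    using inn_out[OF e] Inr by (cases "inn e = out e") (auto simp: shift_def)
  also have "\<dots> \<le> L1 \<sigma>" using inn_out[OF e] S_verts by (intro sum_abs_le_L1[where \<sigma> = \<sigma>, OF \<sigma>]) auto
  finally show ?thesis .
qed

lemma len_nonneg: "i \<in> rigid \<Longrightarrow> 0 \<le> len \<sigma> i"
  by (auto simp: rigid_def len_def lcosh_nonneg edge_len_nonneg)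

text \<open>Triangle inequality along the tree path from a, where the value is 0; each step is
  bounded by the length of its edge.\<close>

lemma grow_abs_le:
  assumes "grow A" "\<sigma> a = 0" "v \<in> A"
  shows "\<bar>\<sigma> v\<bar> \<le> (\<Sum>e\<in>EA A. edge_len G \<sigma> e)"
  using assms
proof (induction arbitrary: v rule: grow.induct)
  case root
  then show ?case by (auto simp: EA_def intro!: sum_nonneg edge_len_nonneg)
next
  case (step A e u l)
  note EAi = EA_insert[OF step.hyps(1-5)]
  have e: "0 \<le> edge_len G \<sigma> e" "\<bar>\<sigma> l\<bar> \<le> \<bar>\<sigma> u\<bar> + edge_len G \<sigma> e"
    using edge_len_eq[OF step.hyps(3), of \<sigma>] lcosh_ge[of "\<sigma> u - \<sigma> l"] lcosh_nonneg by auto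
  have "\<bar>\<sigma> w\<bar> \<le> (\<Sum>e\<in>EA A. edge_len G \<sigma> e)" if "w \<in> A" for w
    using step.IH that step.prems(1) by blast
  then show ?case using step.prems(2) e step.hyps(4) EAi by fastforce
qed

text \<open>Vertices of S are controlled through the tree edges leading to a, and each outer vertex
  by its own \<open>lcosh\<close> term. All of these are rigid; the factor \<open>card V\<close>
  comes from summing over the vertices.\<close>

lemma coercive:
  assumes \<sigma>: "\<sigma> a = 0"
  shows "L1 \<sigma> \<le> real (card V) * (\<Sum>i\<in>rigid. len \<sigma> i)"
proof -
  have split: "(\<Sum>i\<in>rigid. len \<sigma> i) = (\<Sum>v\<in>V - S. lcosh (\<sigma> v)) + (\<Sum>e\<in>edges G - B. edge_len G \<sigma> e)"
    unfolding rigid_def by (simp add: sum.Plus len_def o_def)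
  have "\<bar>\<sigma> v\<bar> \<le> (\<Sum>i\<in>rigid. len \<sigma> i)" if v: "v \<in> V" for v
  proof (cases "v \<in> S")
    case True
    have "\<bar>\<sigma> v\<bar> \<le> (\<Sum>e\<in>EA S. edge_len G \<sigma> e)" by (rule grow_abs_le[where \<sigma> = \<sigma>, OF grow_all \<sigma> True])
    also have "\<dots> \<le> (\<Sum>e\<in>edges G - B. edge_len G \<sigma> e)"
    proof (rule sum_mono2)
      show "EA S \<subseteq> edges G - B" using boundary_not_ES by (auto simp: EA_def ES)
    qed (auto simp: edge_len_nonneg)
    also have "\<dots> \<le> (\<Sum>i\<in>rigid. len \<sigma> i)" unfolding split by (simp add: sum_nonneg lcosh_nonneg)
    finally show ?thesis .
  next
    case False
    have "\<bar>\<sigma> v\<bar> \<le> lcosh (\<sigma> v)" by (rule lcosh_ge)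
    also have "\<dots> \<le> (\<Sum>v\<in>V - S. lcosh (\<sigma> v))"
      by (rule member_le_sum) (use v False in \<open>auto simp: lcosh_nonneg\<close>)
    also have "\<dots> \<le> (\<Sum>i\<in>rigid. len \<sigma> i)" unfolding split using sum_nonneg[of "edges G - B" "edge_len G \<sigma>"] by (simp add: edge_len_nonneg)
    finally show ?thesis .
  qed
  then have "L1 \<sigma> \<le> (\<Sum>v\<in>V - {a}. (\<Sum>i\<in>rigid. len \<sigma> i))" unfolding L1_def by (intro sum_mono) auto
  also have "\<dots> \<le> real (card V) * (\<Sum>i\<in>rigid. len \<sigma> i)"
    using card_mono[of V "V - {a}"] by (auto intro!: mult_right_mono sum_nonneg len_nonneg)
  finally show ?thesis .
qed

section \<open>Constants and bounds near the base point\<close>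

text \<open>Half the guaranteed decay rate of the rigid factors: real parts at least 1/2 and the
  coercivity constant \<open>card V\<close> give the rate \<alpha> / (2 card V).\<close>

definition kap :: real where "kap = \<alpha> / (4 * real (card V))"
text \<open>The rate requested from the remainder: at most 1, within the range allowed by
  \<open>rho_le\<close>, and at most \<open>kap / 2\<close>, so that its price in the relative
  coordinates is covered.\<close>

definition del :: real where "del = min 1 (kap / 2)"
text \<open>The first bound keeps each eta below 1/4 and rigid energies above 1/2 in real part; the
  second keeps the growth of the moving factors below rate \<open>del / 2\<close>. The
  \<open>+ 1\<close> keeps the denominators positive.\<close>

definition eps :: real where
  "eps = min (1 / (4 * (real (card moving) + 1))) (del / (2 * \<alpha> * (real (card moving) + 1)))"

text \<open>At the base point all energies entering \<open>X\<^sub>S\<close> vanish, and no other \<open>X\<^sub>A\<close> does.\<close>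

definition bp :: "('v, 'e) energies" where
  "bp = (\<chi> i. if i \<in> moving then 0 else 1)"

abbreviation W where "W \<equiv> ball bp eps"

lemma card_V: "0 < card V" using aV by (auto simp: card_gt_0_iff)

lemma kap_pos: "kap > 0" using \<alpha> card_V by (simp add: kap_def)
lemma del_pos: "del > 0" using kap_pos by (simp add: del_def)
lemma del_le: "del \<le> 1" "2 * del \<le> kap" by (auto simp: del_def)
lemma eps_pos: "eps > 0" using del_pos \<alpha> by (simp add: eps_def)

lemma eps_le: "real (card moving) * eps \<le> 1 / 4" "eps \<le> 1 / 4" "\<alpha> * (real (card moving) * eps) \<le> del / 2"
proof -
  define k where "k = real (card moving) + 1"
  have k: "k \<ge> 1" "real (card moving) \<le> k" by (simp_all add: k_def)
  have e: "eps \<le> 1 / (4 * k)" "eps \<le> del / (2 * \<alpha> * k)" by (simp_all add: eps_def k_def)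
  have "real (card moving) * eps \<le> k * eps" using k eps_pos by (intro mult_right_mono) auto
  moreover have "k * eps \<le> 1 / 4" "\<alpha> * (k * eps) \<le> del / 2"
    using e k \<alpha> by (simp_all add: field_simps)
  ultimately show "real (card moving) * eps \<le> 1 / 4" "\<alpha> * (real (card moving) * eps) \<le> del / 2"
    using \<alpha> mult_left_mono[of "real (card moving) * eps" "k * eps" \<alpha>] by linarith+
  have "eps \<le> k * eps" using k eps_pos by simp
  then show "eps \<le> 1 / 4" using \<open>k * eps \<le> 1 / 4\<close> by linarith
qed

lemma W_component:
  fixes z :: "('v, 'e) energies"
  assumes "z \<in> W" shows "norm (z $ i - bp $ i) < eps"
proof -
  have "norm ((z - bp) $ i) \<le> norm (z - bp)" by (rule Finite_Cartesian_Product.norm_nth_le)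
  then show ?thesis using assms by (simp add: dist_norm norm_minus_commute)
qed

lemma W_small: "z \<in> W \<Longrightarrow> i \<in> moving \<Longrightarrow> norm (z $ i) \<le> eps"
  using W_component[of z i] by (simp add: bp_def)

lemma W_big:
  fixes z :: "('v, 'e) energies"
  assumes "z \<in> W" "i \<notin> moving" shows "Re (z $ i) \<ge> 1 / 2"
proof -
  have "norm (1 - z $ i) < eps" using W_component[OF assms(1), of i] assms(2) by (simp add: bp_def norm_minus_commute)
  moreover have "Re (1 - z $ i) \<le> norm (1 - z $ i)" by (rule complex_Re_le_cmod)
  ultimately show ?thesis using eps_le(2) by simp
qed

lemma rigid_not_moving: "i \<in> rigid \<Longrightarrow> i \<notin> moving"
  by (auto simp: rigid_def moving_def)

lemma norm_rigid_factor_le: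
  assumes z: "z \<in> W" and \<sigma>: "\<sigma> a = 0"
  shows "norm (rigid_factor z \<sigma>) \<le> exp (- 2 * kap * L1 \<sigma>)"
proof -
  have "2 * kap * L1 \<sigma> \<le> 2 * kap * (real (card V) * (\<Sum>i\<in>rigid. len \<sigma> i))"
    using kap_pos by (intro mult_left_mono coercive[where \<sigma> = \<sigma>, OF \<sigma>]) auto
  also have "\<dots> = \<alpha> * (\<Sum>i\<in>rigid. 1 / 2 * len \<sigma> i)"
    using card_V aV by (auto simp: kap_def sum_divide_distrib[symmetric])
  also have "\<dots> \<le> \<alpha> * (\<Sum>i\<in>rigid. Re (z $ i) * len \<sigma> i)"
    using \<alpha> W_big[OF z rigid_not_moving] by (intro mult_left_mono sum_mono mult_right_mono len_nonneg) auto
  finally show ?thesis by (simp add: rigid_factor_def)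
qed

definition CC :: real where "CC = 4 * (1 + del / 2) * exp (del / 2 * ln 2)"

text \<open>The budget: rigid decay \<open>2 * kap\<close> in \<open>L1\<close>, growth
  \<open>del / 2\<close> in \<open>L1\<close> and t from the moving factors, and the remainder's
  decay \<open>del\<close> in t bought with growth \<open>del\<close> in \<open>L1\<close>. Since
  \<open>2 * del \<le> kap\<close>, the rate \<open>del / 2\<close> is left in all
  directions.\<close>

lemma norm_cl_rem_le:
  assumes z: "z \<in> W" and \<sigma>: "\<sigma> a = 0"
  shows "norm (rigid_factor z \<sigma> * (cl z \<sigma> t * rem z \<sigma> t)) \<le> CC * exp (- (del / 2) * (L1 \<sigma> + \<bar>t\<bar>))"
proof -
  have fin: "finite moving" by simp
  have k0: "0 \<le> \<alpha> * (real (card moving) * eps)" using \<alpha> eps_pos by simp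
  have "norm (cl z \<sigma> t) \<le> exp (\<alpha> * (real (card moving) * eps) * (L1 \<sigma> + \<bar>t\<bar> + ln 2))"
    by (rule norm_cluster_le[OF fin \<alpha> W_small[OF z] shift_le[where \<sigma> = \<sigma>, OF \<sigma>]])
  also have "\<dots> \<le> exp (del / 2 * (L1 \<sigma> + \<bar>t\<bar> + ln 2))"
    using mult_right_mono[OF eps_le(3), of "L1 \<sigma> + \<bar>t\<bar> + ln 2"] L1_nonneg[of \<sigma>] by simp
  finally have 1: "norm (cl z \<sigma> t) \<le> exp (del / 2 * (L1 \<sigma> + \<bar>t\<bar> + ln 2))" .
  have "norm (rem z \<sigma> t) \<le> 4 * (1 + \<alpha> * (real (card moving) * eps)) * exp (del * (L1 \<sigma> - \<bar>t\<bar>))"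
    by (rule norm_remainder_le[OF fin \<alpha> W_small[OF z] shift_le[where \<sigma> = \<sigma>, OF \<sigma>] _ _ L1_nonneg])
      (use del_pos del_le in auto)
  also have "\<dots> \<le> 4 * (1 + del / 2) * exp (del * (L1 \<sigma> - \<bar>t\<bar>))"
    using eps_le(3) by (intro mult_right_mono mult_left_mono) auto
  finally have 2: "norm (rem z \<sigma> t) \<le> 4 * (1 + del / 2) * exp (del * (L1 \<sigma> - \<bar>t\<bar>))" .
  have "norm (rigid_factor z \<sigma> * (cl z \<sigma> t * rem z \<sigma> t))
     \<le> exp (- 2 * kap * L1 \<sigma>) * (exp (del / 2 * (L1 \<sigma> + \<bar>t\<bar> + ln 2)) * (4 * (1 + del / 2) * exp (del * (L1 \<sigma> - \<bar>t\<bar>))))"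
    unfolding norm_mult by (intro mult_mono norm_rigid_factor_le[where \<sigma> = \<sigma>, OF z \<sigma>] 1 2) (use del_pos in auto)
  also have "\<dots> = CC * exp (- 2 * kap * L1 \<sigma> + (del / 2 * (L1 \<sigma> + \<bar>t\<bar>) + del * (L1 \<sigma> - \<bar>t\<bar>)))"
    by (simp only: CC_def distrib_left[of "del / 2" "L1 \<sigma> + \<bar>t\<bar>" "ln 2"] exp_add mult_ac)
  also have "\<dots> \<le> CC * exp (- (del / 2) * (L1 \<sigma> + \<bar>t\<bar>))"
  proof -
    have "2 * del * L1 \<sigma> \<le> kap * L1 \<sigma>" using del_le L1_nonneg by (intro mult_right_mono) auto
    moreover have "0 \<le> kap * L1 \<sigma>" using kap_pos L1_nonneg by simp
    ultimately have "- 2 * kap * L1 \<sigma> + (del / 2 * (L1 \<sigma> + \<bar>t\<bar>) + del * (L1 \<sigma> - \<bar>t\<bar>)) \<le> - (del / 2) * (L1 \<sigma> + \<bar>t\<bar>)"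
      by (simp add: algebra_simps)
    then show ?thesis using del_pos by (intro mult_left_mono) (auto simp: CC_def)
  qed
  finally show ?thesis .
qed

section \<open>The continued integrand and the change of variables\<close>

text \<open>The coordinate at a doubles as the translation t, and the update
  \<open>\<tau>(a := 0)\<close> leaves the relative coordinates. Thus one integral over V covers
  both.\<close>

definition FF :: "('v, 'e) energies \<Rightarrow> ('v \<Rightarrow> real) \<Rightarrow> complex" where
  "FF z \<tau> = rigid_factor z (\<tau>(a := 0)) * (cl z (\<tau>(a := 0)) (\<tau> a) * rem z (\<tau>(a := 0)) (\<tau> a))"

definition NP :: "('v, 'e) energies \<Rightarrow> ('v \<Rightarrow> real) \<Rightarrow> complex" where
  "NP z \<tau> = rigid_factor z (\<tau>(a := 0)) * cl z (\<tau>(a := 0)) (\<tau> a)"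

lemma sum_V_split: "(\<Sum>v\<in>V. \<bar>\<tau> v\<bar>) = L1 (\<tau>(a := 0)) + \<bar>\<tau> a\<bar>"
proof -
  have "(\<Sum>v\<in>V. \<bar>\<tau> v\<bar>) = \<bar>\<tau> a\<bar> + (\<Sum>v\<in>V - {a}. \<bar>\<tau> v\<bar>)" by (rule sum.remove) (use aV in auto)
  moreover have "(\<Sum>v\<in>V - {a}. \<bar>\<tau> v\<bar>) = L1 (\<tau>(a := 0))" unfolding L1_def by (rule sum.cong) auto
  ultimately show ?thesis by simp
qed

lemma norm_FF_le: "z \<in> W \<Longrightarrow> norm (FF z \<tau>) \<le> CC * exp (- (del / 2) * (\<Sum>v\<in>V. \<bar>\<tau> v\<bar>))"
  unfolding FF_def sum_V_split by (rule norm_cl_rem_le) simp_all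

lemma measurable_shift [measurable]:
  "(\<lambda>\<tau>. shift (\<tau>(a := 0)) i) \<in> borel_measurable (lbs I)"
  unfolding shift_def by (cases i) (auto intro!: borel_measurable_diff measurable_upd_component simp del: fun_upd_apply)

lemma measurable_rigid_factor [measurable]:
  "(\<lambda>\<tau>. rigid_factor z (\<tau>(a := 0))) \<in> borel_measurable (lbs I)"
proof -
  have [measurable]: "(\<lambda>\<tau>. len (\<tau>(a := 0)) i) \<in> borel_measurable (lbs I)" if "i \<in> rigid" for i
  proof (cases i)
    case (Inl v)
    then show ?thesis unfolding len_def
      by (auto intro!: measurable_lcosh_compose measurable_upd_component simp del: fun_upd_apply)
  next
    case (Inr e)
    then have "e \<in> edges G" using that by (auto simp: rigid_def)
    then show ?thesis unfolding len_def using Inr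
      by (auto intro!: measurable_edge_len measurable_upd_component simp del: fun_upd_apply)
  qed
  show ?thesis unfolding rigid_factor_def by measurable
qed

lemma measurable_cl [measurable]:
  "(\<lambda>\<tau>. cl z (\<tau>(a := 0)) (\<tau> a)) \<in> borel_measurable (lbs I)"
  "(\<lambda>\<tau>. rem z (\<tau>(a := 0)) (\<tau> a)) \<in> borel_measurable (lbs I)"
  unfolding cluster_def remainder_def by measurable

lemma measurable_FF [measurable]: "FF z \<in> borel_measurable (lbs I)" "NP z \<in> borel_measurable (lbs I)"
  unfolding FF_def NP_def by measurable

lemma integrable_exp_V: "c > 0 \<Longrightarrow> integrable (lbs V) (\<lambda>\<tau>. C * exp (- c * (\<Sum>v\<in>V. \<bar>\<tau> v\<bar>)))"
  using lbs_integrable_exp[of V c] by simp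

lemma integrable_FF:
  assumes "z \<in> W" shows "integrable (lbs V) (FF z)"
proof (rule Bochner_Integration.integrable_bound)
  show "integrable (lbs V) (\<lambda>\<tau>. CC * exp (- (del / 2) * (\<Sum>v\<in>V. \<bar>\<tau> v\<bar>)))"
    using del_pos by (intro integrable_exp_V) simp
  show "AE \<tau> in lbs V. norm (FF z \<tau>) \<le> norm (CC * exp (- (del / 2) * (\<Sum>v\<in>V. \<bar>\<tau> v\<bar>)))"
    by (intro AE_I2 order_trans[OF norm_FF_le[OF assms]]) (simp only: real_norm_def abs_ge_self)
qed simp

text \<open>The holomorphic continuation of X_S times the integral. Its power of \<alpha> is one
  lower, since integrating the derivative in t produces \<alpha> X_S and not X_S alone.\<close>

definition FI :: "('v, 'e) energies \<Rightarrow> complex" where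
  "FI z = of_real \<alpha> ^ (card V - 1) * (LINT \<tau>|lbs V. FF z \<tau>)"

lemma holo_on_FI: "holo_on FI W"
proof -
  have "holo_on (\<lambda>z. LINT \<tau>|lbs V. FF z \<tau>) W"
  proof (rule holo_on_integral)
    show "holo_on (\<lambda>z. FF z \<tau>) W" for \<tau>
      unfolding FF_def rigid_factor_def cluster_def remainder_def
      by (intro holo_on_mult holo_on_exp holo_on_sum holo_on_add holo_on_const holo_on_component)
    fix z0 assume "z0 \<in> W"
    show "\<exists>r>0. \<exists>B. integrable (lbs V) B \<and> (\<forall>z\<in>ball z0 r \<inter> W. \<forall>\<tau>\<in>space (lbs V). norm (FF z \<tau>) \<le> B \<tau>)"
    proof (intro exI conjI ballI)
      show "integrable (lbs V) (\<lambda>\<tau>. CC * exp (- (del / 2) * (\<Sum>v\<in>V. \<bar>\<tau> v\<bar>)))"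
        using del_pos by (intro integrable_exp_V) simp
      show "norm (FF z \<tau>) \<le> CC * exp (- (del / 2) * (\<Sum>v\<in>V. \<bar>\<tau> v\<bar>))" if "z \<in> ball z0 1 \<inter> W" for z \<tau>
        using that by (intro norm_FF_le) auto
    qed simp
  qed (auto intro: measurable_FF)
  then show ?thesis unfolding FI_def[abs_def] by (intro holo_on_mult holo_on_const)
qed

lemma Xsum_moving: "Xsum G S z = (\<Sum>i\<in>moving. z $ i)"
  unfolding moving_def Xsum_def by (simp add: sum.Plus o_def)

lemma bp_Xplane: "bp \<in> Xplane G S"
  by (simp add: Xplane_def Xsum_moving bp_def)

text \<open>Adding the coordinate at a to the other coordinates of S preserves the measure. Edges
  inside S or inside its complement see only unchanged differences; vertices of S and boundary edges
  acquire t. No convergence is involved.\<close>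

lemma zono_integral_NP: "zono_integral G \<alpha> z = of_real \<alpha> ^ card V * (LINT \<tau>|lbs V. NP z \<tau>)"
proof -
  define \<Phi> where "\<Phi> = (\<lambda>\<tau>. vertex_product G \<alpha> z \<tau> * edge_product G \<alpha> z \<tau>)"
  define T where "T = (\<lambda>\<tau> :: 'v \<Rightarrow> real. \<lambda>i\<in>V. if i \<in> S - {a} then \<tau> i + \<tau> a else \<tau> i)"
  have \<Phi>: "\<Phi> \<tau> = exp (- of_real \<alpha> * ((\<Sum>v\<in>V. xen z v * of_real (lcosh (\<tau> v)))
      + (\<Sum>e\<in>edges G. yen z e * of_real (edge_len G \<tau> e))))" for \<tau>
    unfolding \<Phi>_def using vertex_product_exp[of V \<alpha> z \<tau>] edge_product_exp[of V \<alpha> z \<tau>]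
    by (simp add: induced_verts distrib_left flip: exp_add)
  have [measurable]: "\<Phi> \<in> borel_measurable (lbs V)"
  proof -
    have [measurable]: "(\<lambda>\<tau>. edge_len G \<tau> e) \<in> borel_measurable (lbs V)" if "e \<in> edges G" for e
      by (rule measurable_edge_len[OF that]) simp
    show ?thesis unfolding \<Phi>[abs_def] by measurable
  qed
  have T: "T \<in> measurable (lbs V) (lbs V)"
    unfolding T_def by (intro measurable_restrict) (auto intro!: borel_measurable_add)
  have TD: "distr (lbs V) (lbs V) T = lbs V"
    unfolding T_def by (rule lbs_shift_invariant) (use S_verts in auto)
  have "\<Phi> (T \<tau>) = NP z \<tau>" for \<tau>
  proof -
    define \<sigma> where "\<sigma> = \<tau>(a := 0)"
    have TS: "T \<tau> v = \<sigma> v + \<tau> a" if "v \<in> S" for v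
      using that S_verts by (auto simp: T_def \<sigma>_def)
    have TV: "T \<tau> v = \<sigma> v" if "v \<in> V - S" for v using that a by (auto simp: T_def \<sigma>_def)
    have eB: "edge_len G (T \<tau>) e = lcosh (\<sigma> (inn e) - \<sigma> (out e) + \<tau> a)" if "e \<in> B" for e
      using edge_len_eq[OF inn_out(1)[OF that]] TS[OF inn_out(2)[OF that]] TV[OF inn_out(3)[OF that]]
      by (simp add: algebra_simps)
    have eI: "edge_len G (T \<tau>) e = edge_len G \<sigma> e" if e: "e \<in> edges G - B" for e
    proof -
      obtain u v where uv: "ends G e = {u, v}" "u \<noteq> v" "u \<in> V" "v \<in> V" using ends_pair[of e] e by blast
      have "(u \<in> S) = (v \<in> S)" using edge_boundary_pair[OF uv(1,2), of S] e by blast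
      then have "T \<tau> u - T \<tau> v = \<sigma> u - \<sigma> v" using TS TV uv by (cases "u \<in> S") auto
      then show ?thesis by (simp add: edge_len_eq[OF uv(1)])
    qed
    have v: "(\<Sum>v\<in>V. xen z v * of_real (lcosh (T \<tau> v)))
       = (\<Sum>v\<in>S. xen z v * of_real (lcosh (\<sigma> v + \<tau> a))) + (\<Sum>v\<in>V - S. xen z v * of_real (lcosh (\<sigma> v)))"
      using sum.subset_diff[OF S_verts, of "\<lambda>v. xen z v * of_real (lcosh (T \<tau> v))"] TS TV by simp
    have BE: "B \<subseteq> edges G" by (auto simp: edge_boundary_def)
    have e: "(\<Sum>e\<in>edges G. yen z e * of_real (edge_len G (T \<tau>) e))
       = (\<Sum>e\<in>B. yen z e * of_real (lcosh (\<sigma> (inn e) - \<sigma> (out e) + \<tau> a))) + (\<Sum>e\<in>edges G - B. yen z e * of_real (edge_len G \<sigma> e))"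
      using sum.subset_diff[OF BE, of "\<lambda>e. yen z e * of_real (edge_len G (T \<tau>) e)"] eB eI by simp
    show ?thesis
      unfolding \<Phi> v e NP_def rigid_factor_def cluster_def \<sigma>_def[symmetric] moving_def rigid_def
      by (simp add: sum.Plus o_def shift_def len_def algebra_simps flip: exp_add)
  qed
  then have "(LINT \<tau>|lbs V. \<Phi> \<tau>) = (LINT \<tau>|lbs V. NP z \<tau>)"
    using integral_distr[OF T, of \<Phi>] TD by simp
  then show ?thesis by (simp add: zono_integral_def \<Phi>_def)
qed

lemma V_insert: "insert a (V - {a}) = V" using aV by auto

lemma lbs_V_fubini:
  fixes f :: "('v \<Rightarrow> real) \<Rightarrow> complex"
  assumes "integrable (lbs V) f"
  shows "(LINT \<tau>|lbs V. f \<tau>) = (LINT \<sigma>|lbs (V - {a}). LINT t|lborel. f (\<sigma>(a := t)))"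
  using lb.product_integral_insert[of "V - {a}" a f] assms by (simp add: V_insert del: insert_Diff_single)

lemma integrable_line_exp:
  fixes f :: "real \<Rightarrow> complex"
  assumes "c > 0" "\<And>t. norm (f t) \<le> C * exp (- c * \<bar>t\<bar>)" "continuous_on UNIV f"
  shows "integrable lborel f"
proof (rule Bochner_Integration.integrable_bound)
  show "integrable lborel (\<lambda>t. C * exp (- c * \<bar>t\<bar>))" using integrable_exp_abs[OF assms(1)] by simp
  show "f \<in> borel_measurable lborel" using borel_measurable_continuous_onI[OF assms(3)] by simp
  show "AE t in lborel. norm (f t) \<le> norm (C * exp (- c * \<bar>t\<bar>))"
    by (intro AE_I2 order_trans[OF assms(2)]) (simp only: real_norm_def abs_ge_self)
qed

lemma integrable_line_FF:
  assumes z: "z \<in> W" and \<sigma>: "\<sigma> a = 0"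
  shows "integrable lborel (\<lambda>t. cl z \<sigma> t * rem z \<sigma> t)"
proof -
  have "integrable lborel (\<lambda>t. rigid_factor z \<sigma> * (cl z \<sigma> t * rem z \<sigma> t))"
  proof (rule integrable_line_exp)
    show "del / 2 > 0" using del_pos by simp
    show "norm (rigid_factor z \<sigma> * (cl z \<sigma> t * rem z \<sigma> t)) \<le> CC * exp (- (del / 2) * L1 \<sigma>) * exp (- (del / 2) * \<bar>t\<bar>)" for t
      using norm_cl_rem_le[where \<sigma> = \<sigma>, OF z \<sigma>, of t] by (simp only: distrib_left exp_add mult.assoc)
    show "continuous_on UNIV (\<lambda>t. rigid_factor z \<sigma> * (cl z \<sigma> t * rem z \<sigma> t))"
      by (intro continuous_intros continuous_cluster continuous_remainder)
  qed
  moreover have "rigid_factor z \<sigma> \<noteq> 0" by (simp add: rigid_factor_def)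
  ultimately show ?thesis
    using integrable_mult_right[of "inverse (rigid_factor z \<sigma>)" lborel "\<lambda>t. rigid_factor z \<sigma> * (cl z \<sigma> t * rem z \<sigma> t)"]
    by (simp add: field_simps)
qed

end

lemma tendsto_exp_abs:
  assumes "c > (0::real)"
  shows "((\<lambda>t. C * exp (- c * \<bar>t\<bar>)) \<longlongrightarrow> 0) at_top" "((\<lambda>t. C * exp (- c * \<bar>t\<bar>)) \<longlongrightarrow> 0) at_bot"
proof -
  have *: "((\<lambda>t. C * exp (- c * \<bar>t\<bar>)) \<longlongrightarrow> 0) F" if "filterlim (\<lambda>t::real. \<bar>t\<bar>) at_top F" for F
  proof (intro tendsto_mult_right_zero filterlim_compose[OF exp_at_bot])
    show "filterlim (\<lambda>t. - c * \<bar>t\<bar>) at_bot F"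
      by (rule filterlim_tendsto_neg_mult_at_bot[OF tendsto_const _ that]) (use assms in simp)
  qed
  show "((\<lambda>t. C * exp (- c * \<bar>t\<bar>)) \<longlongrightarrow> 0) at_top" by (rule *[OF filterlim_abs_real])
  have "filterlim (\<lambda>t::real. \<bar>- t\<bar>) at_top at_bot"
    by (rule filterlim_compose[OF filterlim_abs_real filterlim_uminus_at_top_at_bot])
  then show "((\<lambda>t. C * exp (- c * \<bar>t\<bar>)) \<longlongrightarrow> 0) at_bot" by (intro *) simp
qed

context tree_block
begin

text \<open>Here X_S > 0, so \<open>cl\<close> decays in t, tanh t times \<open>cl\<close> vanishes
  at both ends, and the integral of its derivative is 0. On each line this equates the integral of
  \<open>cl\<close> times \<open>rem\<close> with \<alpha> X_S times that of
  \<open>cl\<close>.\<close>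

lemma FI_positive:
  assumes z: "z \<in> W" "z \<in> positive_energies G"
  shows "FI z = Xsum G S z * zono_integral G \<alpha> z"
proof -
  define X where "X = (\<Sum>i\<in>moving. Re (z $ i))"
  have pos: "Re (z $ i) > 0" "z $ i = of_real (Re (z $ i))" if i: "i \<in> moving" for i
  proof -
    have "\<exists>t>0. z $ i = of_real t"
      using i z(2) S_verts unfolding moving_def positive_energies_def edge_boundary_def by auto
    then show "Re (z $ i) > 0" "z $ i = of_real (Re (z $ i))" by auto
  qed
  have Xz: "Xsum G S z = of_real X"
    unfolding Xsum_moving X_def of_real_sum by (rule sum.cong) (use pos in auto)
  have "Inl a \<in> moving" using a by (auto simp: moving_def)
  then have X0: "X > 0" unfolding X_def using pos by (intro sum_pos) auto
  have "X \<le> (\<Sum>i\<in>moving. eps)"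
    unfolding X_def
  proof (rule sum_mono)
    fix i assume "i \<in> moving"
    then show "Re (z $ i) \<le> eps" using W_small[OF z(1)] complex_Re_le_cmod[of "z $ i"] by fastforce
  qed
  then have "\<alpha> * X \<le> \<alpha> * (real (card moving) * eps)" using \<alpha> by simp
  \<comment> \<open>The decay of \<open>cl\<close> in t costs a factor exp(\<alpha> X L1); small
    moving energies keep this cost within half of the rigid decay.\<close>
  then have aX: "\<alpha> * X \<le> kap" using eps_le(3) del_le(2) del_pos by linarith
  define c where "c = min kap (\<alpha> * X)"
  have c: "c > 0" "c \<le> kap" "c \<le> \<alpha> * X" using kap_pos \<alpha> X0 by (auto simp: c_def)
  have clb: "norm (cl z \<sigma> t) \<le> exp (- (\<alpha> * X) * (\<bar>t\<bar> - L1 \<sigma>))" if \<sigma>: "\<sigma> a = 0" for \<sigma> t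
    using norm_cluster_le_pos[OF _ \<alpha>, of moving "($) z" "shift \<sigma>" "L1 \<sigma>" t] pos(1) shift_le[where \<sigma> = \<sigma>, OF \<sigma>]
    by (simp add: X_def less_imp_le)
  have NPb: "norm (NP z \<tau>) \<le> 1 * exp (- c * (\<Sum>v\<in>V. \<bar>\<tau> v\<bar>))" for \<tau>
  proof -
    define \<sigma> where "\<sigma> = \<tau>(a := 0)"
    have \<sigma>: "\<sigma> a = 0" by (simp add: \<sigma>_def)
    have "norm (NP z \<tau>) \<le> exp (- 2 * kap * L1 \<sigma>) * exp (- (\<alpha> * X) * (\<bar>\<tau> a\<bar> - L1 \<sigma>))"
      unfolding NP_def norm_mult \<sigma>_def[symmetric]
      by (intro mult_mono norm_rigid_factor_le[where \<sigma> = \<sigma>, OF z(1) \<sigma>] clb[where \<sigma> = \<sigma>, OF \<sigma>]) auto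
    also have "\<dots> = exp (- 2 * kap * L1 \<sigma> - (\<alpha> * X) * (\<bar>\<tau> a\<bar> - L1 \<sigma>))" by (simp flip: exp_add)
    also have "\<dots> \<le> exp (- c * (L1 \<sigma> + \<bar>\<tau> a\<bar>))"
    proof -
      have "\<alpha> * X * L1 \<sigma> \<le> kap * L1 \<sigma>" "c * L1 \<sigma> \<le> kap * L1 \<sigma>" "c * \<bar>\<tau> a\<bar> \<le> \<alpha> * X * \<bar>\<tau> a\<bar>"
        using aX c L1_nonneg by (auto intro: mult_right_mono)
      then have "- 2 * kap * L1 \<sigma> - (\<alpha> * X) * (\<bar>\<tau> a\<bar> - L1 \<sigma>) \<le> - c * (L1 \<sigma> + \<bar>\<tau> a\<bar>)"
        by (simp add: algebra_simps)
      then show ?thesis by simp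
    qed
    finally show ?thesis unfolding sum_V_split \<sigma>_def by simp
  qed
  have iNP: "integrable (lbs V) (NP z)"
  proof (rule Bochner_Integration.integrable_bound)
    show "integrable (lbs V) (\<lambda>\<tau>. 1 * exp (- c * (\<Sum>v\<in>V. \<bar>\<tau> v\<bar>)))" by (rule integrable_exp_V[OF c(1)])
    show "AE \<tau> in lbs V. norm (NP z \<tau>) \<le> norm (1 * exp (- c * (\<Sum>v\<in>V. \<bar>\<tau> v\<bar>)))"
      by (intro AE_I2 order_trans[OF NPb]) (simp only: real_norm_def abs_ge_self)
  qed simp
  have inner: "(LINT t|lborel. cl z \<sigma> t * rem z \<sigma> t - of_real \<alpha> * (\<Sum>i\<in>moving. z $ i) * cl z \<sigma> t) = 0"
    if \<sigma>: "\<sigma> a = 0" for \<sigma>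
  proof -
    have clb': "norm (cl z \<sigma> t) \<le> exp (\<alpha> * X * L1 \<sigma>) * exp (- (\<alpha> * X) * \<bar>t\<bar>)" for t
      using clb[where \<sigma> = \<sigma>, OF \<sigma>, of t] by (simp add: algebra_simps flip: exp_add)
    have aX0: "\<alpha> * X > 0" using \<alpha> X0 by simp
    have icl: "integrable lborel (cl z \<sigma>)" by (rule integrable_line_exp[OF aX0 clb' continuous_cluster])
    have tb: "norm (of_real (tanh t) * cl z \<sigma> t) \<le> exp (\<alpha> * X * L1 \<sigma>) * exp (- (\<alpha> * X) * \<bar>t\<bar>)" for t
    proof -
      have "norm (of_real (tanh t) * cl z \<sigma> t) \<le> 1 * norm (cl z \<sigma> t)"
        unfolding norm_mult using abs_tanh_less[of t] by (intro mult_right_mono) auto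
      then show ?thesis using clb'[of t] by simp
    qed
    have "(LINT t|lborel. cl z \<sigma> t * rem z \<sigma> t - of_real \<alpha> * (\<Sum>i\<in>moving. z $ i) * cl z \<sigma> t) = 0 - 0"
    proof (rule integral_FTC_real_line)
      show "((\<lambda>t. of_real (tanh t) * cl z \<sigma> t) has_vector_derivative
          cl z \<sigma> t * rem z \<sigma> t - of_real \<alpha> * (\<Sum>i\<in>moving. z $ i) * cl z \<sigma> t) (at t)" for t
        by (rule cluster_derivative) simp
      have "continuous_on UNIV (\<lambda>t. cl z \<sigma> t * rem z \<sigma> t - of_real \<alpha> * (\<Sum>i\<in>moving. z $ i) * cl z \<sigma> t)"
        by (intro continuous_intros continuous_cluster continuous_remainder)
      then show "isCont (\<lambda>t. cl z \<sigma> t * rem z \<sigma> t - of_real \<alpha> * (\<Sum>i\<in>moving. z $ i) * cl z \<sigma> t) t" for t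
        by (simp add: continuous_on_eq_continuous_at)
      show "integrable lborel (\<lambda>t. cl z \<sigma> t * rem z \<sigma> t - of_real \<alpha> * (\<Sum>i\<in>moving. z $ i) * cl z \<sigma> t)"
        using integrable_line_FF[where \<sigma> = \<sigma>, OF z(1) \<sigma>] icl by simp
      show "((\<lambda>t. of_real (tanh t) * cl z \<sigma> t) \<longlongrightarrow> 0) at_bot"
        by (rule Lim_null_comparison[OF always_eventually[OF allI[OF tb]] tendsto_exp_abs(2)[OF aX0]])
      show "((\<lambda>t. of_real (tanh t) * cl z \<sigma> t) \<longlongrightarrow> 0) at_top"
        by (rule Lim_null_comparison[OF always_eventually[OF allI[OF tb]] tendsto_exp_abs(1)[OF aX0]])
    qed
    then show ?thesis by simp
  qed
  define H where "H = (\<lambda>\<tau>. FF z \<tau> - of_real \<alpha> * Xsum G S z * NP z \<tau>)"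
  have iH: "integrable (lbs V) H" unfolding H_def using integrable_FF[OF z(1)] iNP by simp
  have "(LINT \<tau>|lbs V. H \<tau>) = (LINT \<sigma>|lbs (V - {a}). LINT t|lborel. H (\<sigma>(a := t)))"
    by (rule lbs_V_fubini[OF iH])
  also have "\<dots> = (LINT \<sigma>|lbs (V - {a}). 0)"
  proof (rule Bochner_Integration.integral_cong[OF refl])
    fix \<sigma> :: "'v \<Rightarrow> real"
    define \<sigma>0 where "\<sigma>0 = \<sigma>(a := 0)"
    have "H (\<sigma>(a := t)) = rigid_factor z \<sigma>0 * (cl z \<sigma>0 t * rem z \<sigma>0 t - of_real \<alpha> * (\<Sum>i\<in>moving. z $ i) * cl z \<sigma>0 t)" for t
      unfolding H_def FF_def NP_def fun_upd_upd fun_upd_same \<sigma>0_def[symmetric] Xsum_moving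
      by (simp add: algebra_simps)
    then show "(LINT t|lborel. H (\<sigma>(a := t))) = 0"
      using inner[of \<sigma>0] by (simp add: \<sigma>0_def)
  qed
  finally have "(LINT \<tau>|lbs V. FF z \<tau>) = of_real \<alpha> * Xsum G S z * (LINT \<tau>|lbs V. NP z \<tau>)"
    unfolding H_def using integrable_FF[OF z(1)] iNP by simp
  moreover have "of_real \<alpha> ^ card V = of_real \<alpha> ^ (card V - 1) * complex_of_real \<alpha>"
    using card_V by (metis One_nat_def Suc_pred power_Suc2)
  ultimately show ?thesis unfolding FI_def zono_integral_NP by (simp add: mult_ac)
qed

section \<open>The value on the hyperplane\<close>

definition theta :: "('v, 'e) energies \<Rightarrow> ('v \<Rightarrow> real) \<Rightarrow> complex" where
  "theta z \<sigma> = (\<Sum>i\<in>moving. z $ i * of_real (shift \<sigma> i))"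

text \<open>The sign \<epsilon> = 1 or -1 names the end of the t-line: on X_S = 0 the moving factors
  tend there to exp(-\<epsilon> \<alpha> theta).\<close>

definition limit_integrand :: "real \<Rightarrow> ('v, 'e) energies \<Rightarrow> ('v \<Rightarrow> real) \<Rightarrow> complex" where
  "limit_integrand \<epsilon> z \<sigma> = rigid_factor z (\<sigma>(a := 0)) * exp (- of_real (\<epsilon> * \<alpha>) * theta z (\<sigma>(a := 0)))"

lemma integrable_limit_integrand:
  assumes z: "z \<in> W" and \<epsilon>: "\<bar>\<epsilon>\<bar> = 1"
  shows "integrable (lbs (V - {a})) (limit_integrand \<epsilon> z)"
proof (rule Bochner_Integration.integrable_bound)
  show "integrable (lbs (V - {a})) (\<lambda>\<sigma>. exp (- kap * (\<Sum>v\<in>V - {a}. \<bar>\<sigma> v\<bar>)))"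
    by (rule lbs_integrable_exp) (use kap_pos in auto)
  show "AE \<sigma> in lbs (V - {a}). norm (limit_integrand \<epsilon> z \<sigma>) \<le> norm (exp (- kap * (\<Sum>v\<in>V - {a}. \<bar>\<sigma> v\<bar>)))"
  proof (rule AE_I2)
    fix \<sigma> :: "'v \<Rightarrow> real"
    define \<sigma>0 where "\<sigma>0 = \<sigma>(a := 0)"
    have \<sigma>0: "\<sigma>0 a = 0" by (simp add: \<sigma>0_def)
    have L: "L1 \<sigma>0 = (\<Sum>v\<in>V - {a}. \<bar>\<sigma> v\<bar>)" unfolding L1_def by (rule sum.cong) (auto simp: \<sigma>0_def)
    have "norm (theta z \<sigma>0) \<le> (\<Sum>i\<in>moving. eps * L1 \<sigma>0)"
      unfolding theta_def
    proof (rule sum_norm_le)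
      fix i assume i: "i \<in> moving"
      show "norm (z $ i * complex_of_real (shift \<sigma>0 i)) \<le> eps * L1 \<sigma>0"
        unfolding norm_mult using W_small[OF z i] shift_le[where \<sigma> = \<sigma>0, OF \<sigma>0 i] eps_pos
        by (intro mult_mono) auto
    qed
    then have "\<alpha> * norm (theta z \<sigma>0) \<le> (\<alpha> * (real (card moving) * eps)) * L1 \<sigma>0"
      using \<alpha> by simp
    also have "\<dots> \<le> kap * L1 \<sigma>0"
      using eps_le(3) del_le del_pos L1_nonneg by (intro mult_right_mono) auto
    finally have th: "\<alpha> * norm (theta z \<sigma>0) \<le> kap * L1 \<sigma>0" .
    have "norm (exp (- of_real (\<epsilon> * \<alpha>) * theta z \<sigma>0)) \<le> exp (kap * L1 \<sigma>0)"
    proof -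
      have "Re (- of_real (\<epsilon> * \<alpha>) * theta z \<sigma>0) \<le> norm (- of_real (\<epsilon> * \<alpha>) * theta z \<sigma>0)"
        by (rule complex_Re_le_cmod)
      also have "\<dots> = \<alpha> * norm (theta z \<sigma>0)" using \<epsilon> \<alpha> by (simp add: norm_mult abs_mult)
      finally show ?thesis using th by simp
    qed
    then have "norm (limit_integrand \<epsilon> z \<sigma>) \<le> exp (- 2 * kap * L1 \<sigma>0) * exp (kap * L1 \<sigma>0)"
      unfolding limit_integrand_def norm_mult \<sigma>0_def[symmetric]
      by (intro mult_mono norm_rigid_factor_le[where \<sigma> = \<sigma>0, OF z \<sigma>0]) auto
    also have "\<dots> = exp (- kap * L1 \<sigma>0)" by (simp flip: exp_add)
    finally show "norm (limit_integrand \<epsilon> z \<sigma>) \<le> norm (exp (- kap * (\<Sum>v\<in>V - {a}. \<bar>\<sigma> v\<bar>)))"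
      using L by simp
  qed
  show "limit_integrand \<epsilon> z \<in> borel_measurable (lbs (V - {a}))"
    unfolding limit_integrand_def theta_def by measurable
qed

lemma len_neg:
  assumes "\<And>v. v \<in> V \<Longrightarrow> \<sigma>' v = - \<sigma> v" "i \<in> rigid"
  shows "len \<sigma>' i = len \<sigma> i"
proof (cases i)
  case (Inl v)
  then show ?thesis using assms by (auto simp: len_def rigid_def)
next
  case (Inr e)
  then have "e \<in> edges G" using assms(2) by (auto simp: rigid_def)
  then obtain u v where uv: "ends G e = {u, v}" "u \<in> V" "v \<in> V" using ends_pair by metis
  have "\<sigma>' u - \<sigma>' v = - (\<sigma> u - \<sigma> v)" using assms(1) uv by simp
  then show ?thesis unfolding len_def Inr sum.case edge_len_eq[OF uv(1)] by (simp only: lcosh_minus)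
qed

lemma shift_neg:
  assumes "\<And>v. v \<in> V \<Longrightarrow> \<sigma>' v = - \<sigma> v" "i \<in> moving"
  shows "shift \<sigma>' i = - shift \<sigma> i"
proof (cases i)
  case (Inl v)
  then show ?thesis using assms S_verts by (auto simp: shift_def moving_def)
next
  case (Inr e)
  then have "e \<in> B" using assms(2) by (auto simp: moving_def)
  then show ?thesis using inn_out[of e] assms(1)[of "inn e"] assms(1)[of "out e"] S_verts Inr
    by (auto simp: shift_def)
qed

lemma limit_integrand_reflect:
  "(LINT \<sigma>|lbs (V - {a}). limit_integrand (- 1) z \<sigma>) = (LINT \<sigma>|lbs (V - {a}). limit_integrand 1 z \<sigma>)"
proof -
  define T where "T = (\<lambda>\<sigma> :: 'v \<Rightarrow> real. \<lambda>i\<in>V - {a}. - \<sigma> i)"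
  have T: "T \<in> measurable (lbs (V - {a})) (lbs (V - {a}))"
    unfolding T_def by (intro measurable_restrict) simp
  have TD: "distr (lbs (V - {a})) (lbs (V - {a})) T = lbs (V - {a})"
    unfolding T_def by (rule lbs_reflect) simp
  have "limit_integrand 1 z (T \<sigma>) = limit_integrand (- 1) z \<sigma>" for \<sigma>
  proof -
    have neg: "((T \<sigma>)(a := 0)) v = - ((\<sigma>(a := 0)) v)" if "v \<in> V" for v
      using that by (simp add: T_def)
    have "rigid_factor z ((T \<sigma>)(a := 0)) = rigid_factor z (\<sigma>(a := 0))"
      unfolding rigid_factor_def using len_neg[OF neg] by (simp cong: sum.cong del: fun_upd_apply)
    moreover have "theta z ((T \<sigma>)(a := 0)) = - theta z (\<sigma>(a := 0))"
      unfolding theta_def using shift_neg[OF neg] by (simp add: sum_negf cong: sum.cong del: fun_upd_apply)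
    ultimately show ?thesis by (simp add: limit_integrand_def del: fun_upd_apply)
  qed
  moreover have "limit_integrand 1 z \<in> borel_measurable (lbs (V - {a}))"
    unfolding limit_integrand_def theta_def by measurable
  ultimately show ?thesis using integral_distr[OF T, of "limit_integrand 1 z"] TD by simp
qed

text \<open>With X_S = 0 the integrand in t is the full derivative of tanh t times
  \<open>cl\<close>; the opposite signs of tanh at the two ends turn the difference of boundary
  values into a sum.\<close>

lemma FI_plane:
  assumes z: "z \<in> W" "z \<in> Xplane G S"
  shows "FI z = 2 * of_real \<alpha> ^ (card V - 1) * (LINT \<sigma>|lbs (V - {a}). limit_integrand 1 z \<sigma>)"
proof -
  have s0: "(\<Sum>i\<in>moving. z $ i) = 0" using z(2) by (simp add: Xplane_def Xsum_moving)
  have inner: "(LINT t|lborel. cl z \<sigma> t * rem z \<sigma> t) = exp (- of_real \<alpha> * theta z \<sigma>) + exp (of_real \<alpha> * theta z \<sigma>)"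
    if \<sigma>: "\<sigma> a = 0" for \<sigma>
  proof -
    have "(LINT t|lborel. cl z \<sigma> t * rem z \<sigma> t) = of_real 1 * exp (- of_real \<alpha> * theta z \<sigma>) - of_real (- 1) * exp (of_real \<alpha> * theta z \<sigma>)"
    proof (rule integral_FTC_real_line)
      show "((\<lambda>t. of_real (tanh t) * cl z \<sigma> t) has_vector_derivative cl z \<sigma> t * rem z \<sigma> t) (at t)" for t
        using cluster_derivative[of moving \<alpha> "($) z" "shift \<sigma>" t] s0 by simp
      have "continuous_on UNIV (\<lambda>t. cl z \<sigma> t * rem z \<sigma> t)"
        by (intro continuous_intros continuous_cluster continuous_remainder)
      then show "isCont (\<lambda>t. cl z \<sigma> t * rem z \<sigma> t) t" for t
        by (simp add: continuous_on_eq_continuous_at)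
      show "integrable lborel (\<lambda>t. cl z \<sigma> t * rem z \<sigma> t)"
        by (rule integrable_line_FF[where \<sigma> = \<sigma>, OF z(1) \<sigma>])
      show "((\<lambda>t. of_real (tanh t) * cl z \<sigma> t) \<longlongrightarrow> of_real (- 1) * exp (of_real \<alpha> * theta z \<sigma>)) at_bot"
        unfolding theta_def by (intro tendsto_mult tendsto_of_real tanh_real_at_bot cluster_tendsto s0) simp
      show "((\<lambda>t. of_real (tanh t) * cl z \<sigma> t) \<longlongrightarrow> of_real 1 * exp (- of_real \<alpha> * theta z \<sigma>)) at_top"
        unfolding theta_def by (intro tendsto_mult tendsto_of_real tanh_real_at_top cluster_tendsto s0) simp
    qed
    then show ?thesis by simp
  qed
  have "(LINT \<tau>|lbs V. FF z \<tau>) = (LINT \<sigma>|lbs (V - {a}). LINT t|lborel. FF z (\<sigma>(a := t)))"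
    by (rule lbs_V_fubini[OF integrable_FF[OF z(1)]])
  also have "\<dots> = (LINT \<sigma>|lbs (V - {a}). limit_integrand 1 z \<sigma> + limit_integrand (- 1) z \<sigma>)"
  proof (rule Bochner_Integration.integral_cong[OF refl])
    fix \<sigma> :: "'v \<Rightarrow> real"
    define \<sigma>0 where "\<sigma>0 = \<sigma>(a := 0)"
    have "FF z (\<sigma>(a := t)) = rigid_factor z \<sigma>0 * (cl z \<sigma>0 t * rem z \<sigma>0 t)" for t
      unfolding FF_def fun_upd_upd fun_upd_same \<sigma>0_def[symmetric] ..
    then show "(LINT t|lborel. FF z (\<sigma>(a := t))) = limit_integrand 1 z \<sigma> + limit_integrand (- 1) z \<sigma>"
      using inner[of \<sigma>0] unfolding limit_integrand_def \<sigma>0_def[symmetric]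
      by (simp add: \<sigma>0_def distrib_left)
  qed
  also have "\<dots> = 2 * (LINT \<sigma>|lbs (V - {a}). limit_integrand 1 z \<sigma>)"
    using integrable_limit_integrand[OF z(1), of 1] integrable_limit_integrand[OF z(1), of "- 1"]
    by (simp add: limit_integrand_reflect)
  finally show ?thesis by (simp add: FI_def)
qed

end

section \<open>Factorisation of the residue\<close>

context tree_block
begin

section \<open>The components outside S and the factorisation\<close>

definition blocks :: "'v set set" where
  "blocks = conn_components (induced G (V - S))"

lemma block_subset: "K \<in> blocks \<Longrightarrow> K \<subseteq> V - S"
proof
  fix y assume K: "K \<in> blocks" "y \<in> K"
  then obtain u where u: "u \<in> V - S" "(u, y) \<in> (adj (induced G (V - S)))\<^sup>*"
    by (auto simp: blocks_def conn_components_def)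
  from u(2) show "y \<in> V - S"
    by (induction rule: rtrancl_induct) (use u(1) in \<open>auto simp: adj_def edges_induced\<close>)
qed

lemma blocks_disjoint:
  assumes "K \<in> blocks" "K' \<in> blocks" "K \<noteq> K'"
  shows "K \<inter> K' = {}"
proof (rule ccontr)
  define R where "R = (adj (induced G (V - S)))\<^sup>*"
  have symR: "(x, y) \<in> R \<Longrightarrow> (y, x) \<in> R" for x y
    unfolding R_def by (rule symD[OF sym_rtrancl]) (auto simp: sym_def intro: adj_sym)
  have trR: "(x, y) \<in> R \<Longrightarrow> (y, w) \<in> R \<Longrightarrow> (x, w) \<in> R" for x y w
    unfolding R_def by (rule rtrancl_trans)
  obtain u u' where K: "K = R `` {u}" "K' = R `` {u'}"
    using assms(1,2) by (auto simp: blocks_def conn_components_def R_def)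
  assume "K \<inter> K' \<noteq> {}"
  then obtain x where "(u, x) \<in> R" "(u', x) \<in> R" using K by auto
  then have "(u, u') \<in> R" "(u', u) \<in> R" using symR trR by blast+
  then have "K = K'" unfolding K using trR by blast
  then show False using assms(3) by simp
qed

lemma Union_blocks: "\<Union>blocks = V - S"
proof
  show "\<Union>blocks \<subseteq> V - S" using block_subset by blast
  show "V - S \<subseteq> \<Union>blocks"
  proof
    fix u assume u: "u \<in> V - S"
    have "u \<in> (adj (induced G (V - S)))\<^sup>* `` {u}" by auto
    then show "u \<in> \<Union>blocks" using u unfolding blocks_def conn_components_def by auto
  qed
qed

lemma UN_EA_blocks: "(\<Union>K\<in>blocks. EA K) = EA (V - S)"
proof
  show "(\<Union>K\<in>blocks. EA K) \<subseteq> EA (V - S)" using block_subset by (fastforce simp: EA_def)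
  show "EA (V - S) \<subseteq> (\<Union>K\<in>blocks. EA K)"
  proof
    fix e assume e: "e \<in> EA (V - S)"
    then have eG: "e \<in> edges G" "ends G e \<subseteq> V - S" by (auto simp: EA_def)
    obtain u v where uv: "ends G e = {u, v}" using ends_pair[OF eG(1)] by metis
    then have "u \<in> V - S" using eG by auto
    then obtain K where K: "K \<in> blocks" "u \<in> K" using Union_blocks by blast
    have "(u, v) \<in> adj (induced G (V - S))" using eG uv by (auto simp: adj_def edges_induced)
    then have "v \<in> K" using conn_components_closed K unfolding blocks_def by metis
    then show "e \<in> (\<Union>K\<in>blocks. EA K)" using K uv eG by (auto simp: EA_def)
  qed
qed

lemma EA_disjoint: "K \<inter> K' = {} \<Longrightarrow> EA K \<inter> EA K' = {}"
proof (rule ccontr)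
  assume "K \<inter> K' = {}" "EA K \<inter> EA K' \<noteq> {}"
  then obtain e where "e \<in> edges G" "ends G e \<subseteq> K \<inter> K'" by (auto simp: EA_def)
  then show False using ends_pair[of e] \<open>K \<inter> K' = {}\<close> by (metis insert_not_empty subset_empty)
qed

lemma J_integrand_exp:
  "J_integrand G \<alpha> S K z \<tau> = exp (- of_real \<alpha> * ((\<Sum>v\<in>K. xen z v * of_real (lcosh (\<tau> v)))
     + (\<Sum>e\<in>EA K. yen z e * of_real (edge_len G \<tau> e)) - (\<Sum>v\<in>K. eta G S v z * of_real (\<tau> v))))"
  unfolding J_integrand_def vertex_product_exp edge_product_exp EA_def edges_induced
  by (simp add: algebra_simps flip: exp_add)

lemma J_integrand_restrict: "J_integrand G \<alpha> S K z (restrict \<tau> K) = J_integrand G \<alpha> S K z \<tau>"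
proof -
  have "edge_len G (restrict \<tau> K) e = edge_len G \<tau> e" if "e \<in> EA K" for e
    using that by (intro edge_len_cong) (auto simp: EA_def)
  then show ?thesis unfolding J_integrand_exp by simp
qed

lemma measurable_J_integrand [measurable]: "J_integrand G \<alpha> S K z \<in> borel_measurable (lbs I)"
proof -
  have [measurable]: "(\<lambda>\<tau>. edge_len G \<tau> e) \<in> borel_measurable (lbs I)" if "e \<in> EA K" for e
    by (rule measurable_edge_len) (use that in \<open>auto simp: EA_def\<close>)
  show ?thesis unfolding J_integrand_exp[abs_def] by measurable
qed

lemma prod_J_integrand:
  "(\<Prod>K\<in>blocks. J_integrand G \<alpha> S K z \<tau>) =
    exp (- of_real \<alpha> * ((\<Sum>v\<in>V - S. xen z v * of_real (lcosh (\<tau> v)))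
     + (\<Sum>e\<in>EA (V - S). yen z e * of_real (edge_len G \<tau> e)) - (\<Sum>v\<in>V - S. eta G S v z * of_real (\<tau> v))))"
proof -
  have V: "(\<Sum>K\<in>blocks. \<Sum>v\<in>K. f v) = (\<Sum>v\<in>V - S. f v)" for f :: "'v \<Rightarrow> complex"
    unfolding Union_blocks[symmetric] using sum.Union_disjoint[of blocks f] blocks_disjoint by simp
  have E: "(\<Sum>K\<in>blocks. \<Sum>e\<in>EA K. f e) = (\<Sum>e\<in>EA (V - S). f e)" for f :: "'e \<Rightarrow> complex"
    unfolding UN_EA_blocks[symmetric]
    by (rule sum.UNION_disjoint[symmetric]) (auto dest: blocks_disjoint EA_disjoint)
  have "(\<Prod>K\<in>blocks. J_integrand G \<alpha> S K z \<tau>) = exp (\<Sum>K\<in>blocks. - of_real \<alpha> * ((\<Sum>v\<in>K. xen z v * of_real (lcosh (\<tau> v)))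
     + (\<Sum>e\<in>EA K. yen z e * of_real (edge_len G \<tau> e)) - (\<Sum>v\<in>K. eta G S v z * of_real (\<tau> v))))"
    unfolding J_integrand_exp by (rule exp_sum[symmetric]) simp
  then show ?thesis
    unfolding sum_distrib_left[symmetric] sum_subtractf sum.distrib V E .
qed

lemma eta_weighted:
  assumes f: "\<And>e. e \<in> B \<Longrightarrow> ends G e \<inter> A = {f e}"
  shows "(\<Sum>v\<in>A. eta G S v z * w v) = (\<Sum>e\<in>B. yen z e * w (f e))"
proof -
  have "(\<Sum>v\<in>A. eta G S v z * w v) = (\<Sum>v\<in>A. \<Sum>e\<in>B. if v \<in> ends G e then yen z e * w v else 0)"
    unfolding eta_def sum_distrib_right by (simp add: sum.inter_filter)
  also have "\<dots> = (\<Sum>e\<in>B. \<Sum>v\<in>A. if v \<in> ends G e then yen z e * w v else 0)" by (rule sum.swap)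
  also have "\<dots> = (\<Sum>e\<in>B. yen z e * w (f e))"
  proof (rule sum.cong[OF refl])
    fix e assume e: "e \<in> B"
    have "(\<Sum>v\<in>A. if v \<in> ends G e then yen z e * w v else 0) = (\<Sum>v\<in>A. if v = f e then yen z e * w v else 0)"
      using f[OF e] by (intro sum.cong) auto
    moreover have "f e \<in> A" using f[OF e] by blast
    ultimately show "(\<Sum>v\<in>A. if v \<in> ends G e then yen z e * w v else 0) = yen z e * w (f e)" by simp
  qed
  finally show ?thesis .
qed

text \<open>A boundary edge contributes its energy times the inner minus the outer coordinate. The
  inner part joins x_v in the internal block, and the outer part, with opposite sign, becomes the
  exponential in the outer blocks.\<close>

lemma theta_eq:
  "theta z \<sigma> = (\<Sum>v\<in>S. cc z v * of_real (\<sigma> v)) - (\<Sum>v\<in>V - S. eta G S v z * of_real (\<sigma> v))"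
proof -
  have "theta z \<sigma> = (\<Sum>v\<in>S. xen z v * of_real (\<sigma> v)) + (\<Sum>e\<in>B. yen z e * of_real (\<sigma> (inn e) - \<sigma> (out e)))"
    unfolding theta_def moving_def by (simp add: sum.Plus o_def shift_def)
  also have "(\<Sum>e\<in>B. yen z e * of_real (\<sigma> (inn e) - \<sigma> (out e)))
     = (\<Sum>v\<in>S. eta G S v z * of_real (\<sigma> v)) - (\<Sum>v\<in>V - S. eta G S v z * of_real (\<sigma> v))"
  proof -
    have "ends G e \<inter> S = {inn e}" "ends G e \<inter> (V - S) = {out e}" if "e \<in> B" for e
      using inn_out[OF that] by auto
    then show ?thesis
      by (simp add: eta_weighted[where f = inn] eta_weighted[where f = out] right_diff_distrib sum_subtractf)
  qed
  finally show ?thesis by (simp add: cc_def distrib_right sum.distrib)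
qed

lemma rigid_edges: "edges G - B = EA S \<union> EA (V - S)" "EA S \<inter> EA (V - S) = {}"
proof -
  show "EA S \<inter> EA (V - S) = {}" by (rule EA_disjoint) auto
  show "edges G - B = EA S \<union> EA (V - S)"
  proof (rule set_eqI)
    fix e
    show "e \<in> edges G - B \<longleftrightarrow> e \<in> EA S \<union> EA (V - S)"
    proof (cases "e \<in> edges G")
      case True
      obtain u v where uv: "ends G e = {u, v}" "u \<noteq> v" "u \<in> V" "v \<in> V" using ends_pair[OF True] by metis
      show ?thesis using edge_boundary_pair[OF uv(1,2) True, of S] uv True by (auto simp: EA_def)
    qed (auto simp: EA_def)
  qed
qed

lemma limit_integrand_factor:
  "limit_integrand 1 z \<sigma> = C_integrand G \<alpha> S z (\<sigma>(a := 0)) * (\<Prod>K\<in>blocks. J_integrand G \<alpha> S K z \<sigma>)"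
proof -
  define \<sigma>0 where "\<sigma>0 = \<sigma>(a := 0)"
  have V: "\<sigma> v = \<sigma>0 v" if "v \<in> V - S" for v using that a by (auto simp: \<sigma>0_def)
  have E: "edge_len G \<sigma> e = edge_len G \<sigma>0 e" if "e \<in> EA (V - S)" for e
    using that V by (intro edge_len_cong) (auto simp: EA_def)
  have rg: "(\<Sum>i\<in>rigid. z $ i * of_real (len \<sigma>0 i)) = (\<Sum>v\<in>V - S. xen z v * of_real (lcosh (\<sigma>0 v)))
      + ((\<Sum>e\<in>EA S. yen z e * of_real (edge_len G \<sigma>0 e)) + (\<Sum>e\<in>EA (V - S). yen z e * of_real (edge_len G \<sigma>0 e)))"
    unfolding rigid_def rigid_edges(1) using rigid_edges(2)
    by (simp add: sum.Plus o_def len_def sum.union_disjoint)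
  have J: "(\<Prod>K\<in>blocks. J_integrand G \<alpha> S K z \<sigma>) =
    exp (- of_real \<alpha> * ((\<Sum>v\<in>V - S. xen z v * of_real (lcosh (\<sigma>0 v)))
     + (\<Sum>e\<in>EA (V - S). yen z e * of_real (edge_len G \<sigma>0 e)) - (\<Sum>v\<in>V - S. eta G S v z * of_real (\<sigma>0 v))))"
    unfolding prod_J_integrand using V E by simp
  show ?thesis
    unfolding limit_integrand_def \<sigma>0_def[symmetric] J C_integrand_peel peel_def rigid_factor_def rg theta_eq
    by (simp add: algebra_simps flip: exp_add)
qed

text \<open>The limit integrand converges absolutely and is a product of nonvanishing factors in
  disjoint variables, so the internal factor converges too. The powers of \<alpha> match because
  card V - 1 is card S - 1 plus the sizes of the blocks.\<close>

lemma plane_value: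
  assumes z: "z \<in> W" "z \<in> Xplane G S"
  shows "z \<in> C_domain G \<alpha> S a"
    "FI z = 2 * (\<Prod>K\<in>blocks. J_integral G \<alpha> S K z) * C_integral G \<alpha> S a z"
proof -
  define f where "f = (\<lambda>\<sigma>. C_integrand G \<alpha> S z (\<sigma>(a := 0)))"
  define g where "g = (\<lambda>\<sigma>. \<Prod>K\<in>blocks. J_integrand G \<alpha> S K z \<sigma>)"
  have un: "(S - {a}) \<union> (V - S) = V - {a}" using a S_verts by auto
  have disj: "(S - {a}) \<inter> (V - S) = {}" by auto
  have f: "f (restrict \<tau> (S - {a})) = f \<tau>" for \<tau>
    unfolding f_def C_integrand_peel by (rule peel_cong) auto
  have g: "g (restrict \<tau> (V - S)) = g \<tau>" for \<tau>
    unfolding g_def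
  proof (rule prod.cong[OF refl])
    fix K assume "K \<in> blocks"
    then have "restrict (restrict \<tau> (V - S)) K = restrict \<tau> K"
      using block_subset by (auto simp: restrict_def fun_eq_iff)
    then show "J_integrand G \<alpha> S K z (restrict \<tau> (V - S)) = J_integrand G \<alpha> S K z \<tau>"
      using J_integrand_restrict by metis
  qed
  have nz: "f \<tau> \<noteq> 0" "g \<tau> \<noteq> 0" for \<tau>
    by (simp_all add: f_def g_def C_integrand_peel peel_def J_integrand_exp)
  have int: "integrable (lbs ((S - {a}) \<union> (V - S))) (\<lambda>\<sigma>. f \<sigma> * g \<sigma>)"
    using integrable_limit_integrand[OF z(1), of 1]
    unfolding un f_def g_def limit_integrand_factor[abs_def] by simp
  note F = lbs_integrable_factors[OF _ _ disj nz f g int]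
  have iC: "integrable (lbs (S - {a})) f" and ig: "integrable (lbs (V - S)) g" using F(1,2) by simp_all
  show "z \<in> C_domain G \<alpha> S a" using iC by (simp add: C_domain_def f_def)
  have "(LINT \<sigma>|lbs (V - {a}). limit_integrand 1 z \<sigma>) = (LINT \<sigma>|lbs (S - {a}). f \<sigma>) * (LINT \<sigma>|lbs (V - S). g \<sigma>)"
    using F(3) unfolding un f_def g_def limit_integrand_factor by simp
  moreover have "(LINT \<sigma>|lbs (V - S). g \<sigma>) = (\<Prod>K\<in>blocks. LINT \<sigma>|lbs K. J_integrand G \<alpha> S K z \<sigma>)"
    unfolding Union_blocks[symmetric] g_def
  proof (rule lbs_integral_prod_blocks)
    show "integrable (lbs (\<Union>blocks)) (\<lambda>\<tau>. \<Prod>K\<in>blocks. J_integrand G \<alpha> S K z \<tau>)"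
      using ig unfolding Union_blocks g_def .
    show "J_integrand G \<alpha> S K z \<tau> \<noteq> 0" for K \<tau> by (simp add: J_integrand_exp)
  qed (use blocks_disjoint J_integrand_restrict in auto)
  moreover have "card V - 1 = (card S - 1) + (\<Sum>K\<in>blocks. card K)"
  proof -
    have "(\<Sum>K\<in>blocks. card K) = card (V - S)"
      unfolding Union_blocks[symmetric]
      by (rule card_Union_disjoint[symmetric]) (auto simp: pairwise_def disjnt_def dest: blocks_disjoint)
    moreover have "card V = card S + card (V - S)"
      using card_mono[OF _ S_verts] by (simp add: card_Diff_subset[OF _ S_verts])
    moreover have "card S > 0" using a by (auto simp: card_gt_0_iff)
    ultimately show ?thesis by linarith
  qed
  ultimately show "FI z = 2 * (\<Prod>K\<in>blocks. J_integral G \<alpha> S K z) * C_integral G \<alpha> S a z"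
    unfolding FI_plane[OF z]
    by (simp add: J_integral_def C_integral_def f_def prod.distrib power_add power_sum mult_ac)
qed

section \<open>Outer blocks near the base point\<close>

text \<open>Each vertex factor decays at least at rate \<alpha>/2, and the exponential with eta
  takes back at most \<alpha>/4.\<close>

lemma norm_J_integrand_le:
  assumes K: "K \<subseteq> V - S" and z: "z \<in> W"
  shows "norm (J_integrand G \<alpha> S K z \<tau>) \<le> exp (- (\<alpha> / 4) * (\<Sum>v\<in>K. \<bar>\<tau> v\<bar>))"
proof -
  have x: "(\<Sum>v\<in>K. 1 / 2 * \<bar>\<tau> v\<bar>) \<le> (\<Sum>v\<in>K. Re (xen z v) * lcosh (\<tau> v))"
  proof (rule sum_mono)
    fix v assume "v \<in> K"
    then have "Inl v \<notin> moving" using K by (auto simp: moving_def)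
    then show "1 / 2 * \<bar>\<tau> v\<bar> \<le> Re (xen z v) * lcosh (\<tau> v)"
      using W_big[OF z, of "Inl v"] lcosh_ge[of "\<tau> v"] by (intro mult_mono) auto
  qed
  have y: "0 \<le> (\<Sum>e\<in>EA K. Re (yen z e) * edge_len G \<tau> e)"
  proof (rule sum_nonneg)
    fix e assume e: "e \<in> EA K"
    then have "e \<in> EA (V - S)" using K by (auto simp: EA_def)
    then have "Inr e \<notin> moving" using rigid_edges(1) by (auto simp: moving_def)
    then have "Re (yen z e) \<ge> 1 / 2" using W_big[OF z] by blast
    then show "0 \<le> Re (yen z e) * edge_len G \<tau> e" using e by (auto simp: EA_def intro!: mult_nonneg_nonneg edge_len_nonneg)
  qed
  have h: "(\<Sum>v\<in>K. Re (eta G S v z) * \<tau> v) \<le> (\<Sum>v\<in>K. 1 / 4 * \<bar>\<tau> v\<bar>)"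
  proof (rule sum_mono)
    fix v
    have "norm (eta G S v z) \<le> (\<Sum>e\<in>{e \<in> B. v \<in> ends G e}. eps)"
      unfolding eta_def by (rule sum_norm_le) (auto intro!: W_small[OF z] simp: moving_def)
    also have "\<dots> \<le> (\<Sum>i\<in>moving. eps)"
    proof -
      have "card {e \<in> B. v \<in> ends G e} \<le> card B" by (rule card_mono) auto
      also have "\<dots> \<le> card moving" unfolding moving_def by (simp add: card_Plus)
      finally show ?thesis using eps_pos by (simp add: mult_right_mono)
    qed
    also have "\<dots> \<le> 1 / 4" using eps_le(1) by simp
    finally have "\<bar>Re (eta G S v z)\<bar> \<le> 1 / 4" using abs_Re_le_cmod order_trans by blast
    then have "\<bar>Re (eta G S v z)\<bar> * \<bar>\<tau> v\<bar> \<le> 1 / 4 * \<bar>\<tau> v\<bar>" by (rule mult_right_mono) simp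
    moreover have "Re (eta G S v z) * \<tau> v \<le> \<bar>Re (eta G S v z)\<bar> * \<bar>\<tau> v\<bar>"
      using abs_ge_self[of "Re (eta G S v z) * \<tau> v"] by (simp add: abs_mult)
    ultimately show "Re (eta G S v z) * \<tau> v \<le> 1 / 4 * \<bar>\<tau> v\<bar>" by linarith
  qed
  have s: "(\<Sum>v\<in>K. 1 / 2 * \<bar>\<tau> v\<bar>) = 1 / 2 * (\<Sum>v\<in>K. \<bar>\<tau> v\<bar>)" "(\<Sum>v\<in>K. 1 / 4 * \<bar>\<tau> v\<bar>) = 1 / 4 * (\<Sum>v\<in>K. \<bar>\<tau> v\<bar>)"
    by (simp_all only: sum_distrib_left)
  have "1 / 4 * (\<Sum>v\<in>K. \<bar>\<tau> v\<bar>) \<le> (\<Sum>v\<in>K. Re (xen z v) * lcosh (\<tau> v)) + (\<Sum>e\<in>EA K. Re (yen z e) * edge_len G \<tau> e)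
     - (\<Sum>v\<in>K. Re (eta G S v z) * \<tau> v)"
    using x y h unfolding s by linarith
  then have "\<alpha> * (1 / 4 * (\<Sum>v\<in>K. \<bar>\<tau> v\<bar>)) \<le> \<alpha> * ((\<Sum>v\<in>K. Re (xen z v) * lcosh (\<tau> v)) + (\<Sum>e\<in>EA K. Re (yen z e) * edge_len G \<tau> e)
     - (\<Sum>v\<in>K. Re (eta G S v z) * \<tau> v))"
    using \<alpha> by (intro mult_left_mono) auto
  then show ?thesis unfolding J_integrand_exp by simp
qed

lemma J_near_bp:
  assumes K: "K \<in> blocks"
  shows "W \<subseteq> J_domain G \<alpha> S K" "holo_on (J_integral G \<alpha> S K) W"
proof -
  note KS = block_subset[OF K]
  have ie: "integrable (lbs K) (\<lambda>\<tau>. exp (- (\<alpha> / 4) * (\<Sum>v\<in>K. \<bar>\<tau> v\<bar>)))"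
    by (rule lbs_integrable_exp) (use \<alpha> in auto)
  show "W \<subseteq> J_domain G \<alpha> S K"
  proof
    fix z assume z: "z \<in> W"
    have "integrable (lbs K) (J_integrand G \<alpha> S K z)"
      by (rule Bochner_Integration.integrable_bound[OF ie])
        (use norm_J_integrand_le[OF KS z] in auto)
    then show "z \<in> J_domain G \<alpha> S K" by (simp add: J_domain_def)
  qed
  have "holo_on (\<lambda>z. LINT \<tau>|lbs K. J_integrand G \<alpha> S K z \<tau>) W"
  proof (rule holo_on_integral)
    show "holo_on (\<lambda>z. J_integrand G \<alpha> S K z \<tau>) W" for \<tau>
      unfolding J_integrand_exp eta_def
      by (intro holo_on_mult holo_on_exp holo_on_sum holo_on_add holo_on_diff holo_on_const holo_on_component)
    fix z0 assume "z0 \<in> W"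
    show "\<exists>r>0. \<exists>B. integrable (lbs K) B \<and> (\<forall>z\<in>ball z0 r \<inter> W. \<forall>\<tau>\<in>space (lbs K). norm (J_integrand G \<alpha> S K z \<tau>) \<le> B \<tau>)"
    proof (intro exI conjI ballI)
      show "norm (J_integrand G \<alpha> S K z \<tau>) \<le> exp (- (\<alpha> / 4) * (\<Sum>v\<in>K. \<bar>\<tau> v\<bar>))" if "z \<in> ball z0 1 \<inter> W" for z \<tau>
        using that by (intro norm_J_integrand_le KS) auto
    qed (use ie in auto)
  qed auto
  then show "holo_on (J_integral G \<alpha> S K) W"
    unfolding J_integral_def[abs_def] by (intro holo_on_mult holo_on_const)
qed

text \<open>The whole ball lies in the domain of convergence, where the continuation is prescribed,
  so its arbitrary values do not interfere.\<close>

lemma J_value_near_bp: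
  assumes K: "K \<in> blocks" and J: "mero_continuation UNIV (J_domain G \<alpha> S K) (J_integral G \<alpha> S K) J" and z: "z \<in> W"
  shows "has_mero_value J z (J_integral G \<alpha> S K z)"
proof (rule has_mero_valueI[OF open_ball z J_near_bp(2)[OF K] open_ball closure_subset subset_refl])
  fix x assume "x \<in> W"
  then show "J_integral G \<alpha> S K x = J x"
    using J J_near_bp(1)[OF K] unfolding mero_continuation_def by (metis subsetD)
qed

section \<open>From the base point to the whole hyperplane\<close>

text \<open>The continuation is prescribed only at real positive points, so \<open>FI\<close> is
  compared with its local quotient there and the identity is then spread over a ball. Dividing by
  the denominator on a dense open set identifies the value, also at points of the
  hyperplane.\<close>

lemma zono_value_near_bp:
  assumes I: "mero_continuation UNIV (positive_energies G) (zono_integral G \<alpha>) I"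
  obtains r where "r > 0" "ball bp r \<subseteq> W"
    "\<And>z. z \<in> ball bp r \<Longrightarrow> has_mero_value (\<lambda>w. Xsum G S w * I w) z (FI z)"
proof -
  have mI: "mero_on I UNIV" and vI: "\<And>z. z \<in> positive_energies G \<Longrightarrow> I z = zono_integral G \<alpha> z"
    using I unfolding mero_continuation_def by blast+
  obtain r1 g h where r1: "r1 > 0" "holo_on g (ball bp r1)" "holo_on h (ball bp r1)"
    "ball bp r1 \<inter> UNIV \<subseteq> closure {z \<in> ball bp r1 \<inter> UNIV. h z \<noteq> 0}"
    "\<And>z. z \<in> ball bp r1 \<inter> UNIV \<Longrightarrow> h z \<noteq> 0 \<Longrightarrow> I z = g z / h z"
    by (rule mero_on_ball[OF mI UNIV_I]) (rule that)
  define r where "r = min r1 eps"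
  define U where "U = ball bp r"
  have r: "r > 0" "U \<subseteq> ball bp r1" "U \<subseteq> W" "open U" "convex U"
    using r1(1) eps_pos by (auto simp: r_def U_def)
  have gh: "holo_on g U" "holo_on h U" "holo_on FI U"
    using r1(2,3) holo_on_FI r(2,3) holo_on_subset by blast+
  define P where "P = {z :: ('v, 'e) energies. \<forall>i. Re (z $ i) > 0}"
  have P: "open P"
  proof -
    have "open (\<Inter>i. {z :: ('v, 'e) energies. Re (z $ i) > 0})"
      by (intro open_INT ballI open_Collect_less continuous_intros) simp
    moreover have "(\<Inter>i. {z :: ('v, 'e) energies. Re (z $ i) > 0}) = P" by (auto simp: P_def)
    ultimately show ?thesis by simp
  qed
  have PR: "z \<in> positive_energies G" if "z \<in> P" "z \<in> real_points" for z
  proof -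
    have "\<exists>t>0. z $ i = complex_of_real t" for i
      using that by (auto simp: P_def real_points_def intro!: exI[of _ "Re (z $ i)"])
    then show ?thesis by (simp add: positive_energies_def)
  qed
  \<comment> \<open>The outer factor h makes the function vanish also where the denominator does, so
    the identity theorem applies without excluding those points.\<close>
  define \<Psi> where "\<Psi> = (\<lambda>z. h z * (FI z * h z - Xsum G S z * g z))"
  define o1 :: "('v, 'e) energies" where "o1 = (\<chi> i. 1)"
  \<comment> \<open>The base point has zero entries; adding c to every entry makes all of them
    positive and stays within r / 2 of it.\<close>
  define c where "c = r / (2 * (norm o1 + 1))"
  define w where "w = bp + of_real c *s o1"
  have \<Psi>0: "\<Psi> z = 0" if z: "z \<in> U" for z
  proof (rule holo_on_identity_real[where f = \<Psi> and W = U and U = P and q = w])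
    show "holo_on \<Psi> U" unfolding \<Psi>_def by (intro holo_on_mult holo_on_diff gh holo_on_Xsum)
    have n1: "norm o1 + 1 > 0" by (simp add: add_nonneg_pos)
    have c: "c > 0" using r(1) n1 by (simp add: c_def)
    have bpi: "bp $ i = 0 \<or> bp $ i = 1" for i by (simp add: bp_def)
    have wi: "w $ i = bp $ i + of_real c" for i by (simp add: w_def o1_def)
    have re: "Re (w $ i) > 0" "w $ i \<in> \<real>" for i
      using bpi[of i] c by (auto simp: wi)
    show "w \<in> P" "w \<in> real_points" using re by (simp_all add: P_def real_points_def)
    have "norm (of_real c *s o1) < r"
    proof -
      have "c * norm o1 \<le> c * (norm o1 + 1)" using c by simp
      also have "\<dots> = r / 2" 
      proof -
        have "r / (2 * x) * x = r / 2" if "x > 0" for x :: real using that by simp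
        from this[OF n1] show ?thesis by (simp only: c_def)
      qed
      finally show ?thesis using c r(1) by (simp add: norm_smult)
    qed
    then show "w \<in> U" by (simp add: U_def w_def dist_norm)
    fix x assume x: "x \<in> P \<inter> U \<inter> real_points"
    have "x \<in> positive_energies G" using PR x by blast
    then have "FI x = Xsum G S x * I x" using FI_positive[of x] vI x r(3) by auto
    moreover have "h x \<noteq> 0 \<Longrightarrow> I x = g x / h x" using r1(5) x r(2) by blast
    ultimately show "\<Psi> x = 0" by (cases "h x = 0") (auto simp: \<Psi>_def)
  qed (use z r P in auto)
  define A where "A = U \<inter> h -` (- {0})"
  have A: "open A" unfolding A_def
    by (rule continuous_open_preimage[OF holo_on_imp_continuous_on[OF gh(2)] r(4) open_Compl[OF closed_singleton]])
  have UA: "U \<subseteq> closure A"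
  proof -
    have bpU: "bp \<in> U" using r(1) by (simp add: U_def)
    obtain x where x: "x \<in> ball bp r1 \<inter> UNIV" "h x \<noteq> 0" "x \<in> U"
      by (rule dense_nonempty[OF r1(4) _ r(4) bpU]) (use r1(1) in auto)
    have "U \<inter> UNIV \<subseteq> closure {z \<in> U \<inter> UNIV. h z \<noteq> 0}"
      by (rule holo_on_nonzero_dense[OF gh(2) r(4,5) complex_affine_UNIV x(3) UNIV_I x(2)])
    moreover have "{z \<in> U \<inter> UNIV. h z \<noteq> 0} = A" by (auto simp: A_def)
    ultimately show ?thesis by simp
  qed
  have "has_mero_value (\<lambda>w. Xsum G S w * I w) z (FI z)" if z: "z \<in> U" for z
  proof (rule has_mero_valueI[OF r(4) z gh(3) A UA])
    show "A \<subseteq> U" by (auto simp: A_def)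
    fix x assume "x \<in> A"
    then have x: "x \<in> U" "h x \<noteq> 0" by (auto simp: A_def)
    then have "FI x * h x = Xsum G S x * g x" using \<Psi>0[of x] by (simp add: \<Psi>_def)
    then have "FI x = Xsum G S x * g x / h x" using x(2) by (simp add: eq_divide_eq)
    moreover have "I x = g x / h x" using r1(5) x r(2) by blast
    ultimately show "FI x = Xsum G S x * I x" by simp
  qed
  then show ?thesis using that[of r] r by (simp add: U_def)
qed

lemma residue_formula:
  assumes I: "mero_continuation UNIV (positive_energies G) (zono_integral G \<alpha>) I"
    and J: "\<And>K. K \<in> blocks \<Longrightarrow> mero_continuation UNIV (J_domain G \<alpha> S K) (J_integral G \<alpha> S K) (J K)"
  shows "generically_on (Xplane G S) (\<lambda>z. regular_at (\<lambda>w. Xsum G S w * I w) z \<and>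
      (\<forall>K\<in>blocks. regular_at (J K) z) \<and>
      residue_along (Xsum G S) I z = 2 * (\<Prod>K\<in>blocks. mero_value (J K) z) * beta_product G \<alpha> S D z)"
proof -
  interpret lf: linear_form "Xsum G S" "axis (Inl a) 1" by (rule linear_form_Xsum)
  have H: "{z. Xsum G S z = 0} = Xplane G S" by (simp add: Xplane_def)
  note aff = complex_affine_Xplane[of G S]
  obtain r where r: "r > 0" "ball bp r \<subseteq> W"
    "\<And>z. z \<in> ball bp r \<Longrightarrow> has_mero_value (\<lambda>w. Xsum G S w * I w) z (FI z)"
    using zono_value_near_bp[OF I] by blast
  have bp: "bp \<in> ball bp r" "bp \<in> W" "Xsum G S bp = 0" using r(1) eps_pos bp_Xplane by (auto simp: Xplane_def)
  have mXI: "mero_on (\<lambda>w. Xsum G S w * I w) UNIV"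
    by (rule mero_on_mult[OF complex_affine_UNIV holo_on_imp_mero_on[OF complex_affine_UNIV holo_on_Xsum]])
      (use I in \<open>simp add: mero_continuation_def\<close>)
  have rXI: "regular_at (\<lambda>w. Xsum G S w * I w) bp" using r(3)[OF bp(1)] by (auto simp: regular_at_def)
  note XI = lf.mero_value_on_hyperplane[OF mXI bp(3) rXI, unfolded H]
  have JK: "mero_on (mero_value (J K)) (Xplane G S)" "generically_on (Xplane G S) (regular_at (J K))" if K: "K \<in> blocks" for K
  proof -
    have "mero_on (J K) UNIV" using J[OF K] by (simp add: mero_continuation_def)
    moreover have "regular_at (J K) bp" using J_value_near_bp[OF K J[OF K] bp(2)] by (auto simp: regular_at_def)
    ultimately show "mero_on (mero_value (J K)) (Xplane G S)" "generically_on (Xplane G S) (regular_at (J K))"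
      using lf.mero_value_on_hyperplane[OF _ bp(3), unfolded H] by blast+
  qed
  \<comment> \<open>Agreement is checked on a ball around the base point, where all values are
    convergent integrals, and spreads along the connected hyperplane.\<close>
  have "generically_on (Xplane G S) (\<lambda>z. mero_value (\<lambda>w. Xsum G S w * I w) z =
      2 * (\<Prod>K\<in>blocks. mero_value (J K) z) * beta_product G \<alpha> S D z)"
  proof (rule mero_on_identity[OF aff XI(1) _ open_ball bp(1) bp_Xplane])
    show "mero_on (\<lambda>z. 2 * (\<Prod>K\<in>blocks. mero_value (J K) z) * beta_product G \<alpha> S D z) (Xplane G S)"
      by (intro mero_on_mult mero_on_prod mero_on_const aff JK(1) mero_on_beta_product)
    fix z assume z: "z \<in> ball bp r \<inter> Xplane G S"
    then have zW: "z \<in> W" "z \<in> Xplane G S" using r(2) by blast+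
    have "mero_value (\<lambda>w. Xsum G S w * I w) z = FI z"
      using r(3) z has_mero_value_imp_mero_value by blast
    also have "\<dots> = 2 * (\<Prod>K\<in>blocks. J_integral G \<alpha> S K z) * C_integral G \<alpha> S a z"
      by (rule plane_value(2)[OF zW])
    also have "C_integral G \<alpha> S a z = beta_product G \<alpha> S D z"
      by (rule C_integral_beta[OF zW(2) plane_value(1)[OF zW]])
    also have "(\<Prod>K\<in>blocks. J_integral G \<alpha> S K z) = (\<Prod>K\<in>blocks. mero_value (J K) z)"
      by (rule prod.cong[OF refl])
        (rule has_mero_value_imp_mero_value[OF J_value_near_bp[OF _ J zW(1)], symmetric])
    finally show "mero_value (\<lambda>w. Xsum G S w * I w) z =
      2 * (\<Prod>K\<in>blocks. mero_value (J K) z) * beta_product G \<alpha> S D z" .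
  qed
  moreover have "generically_on (Xplane G S) (\<lambda>z. \<forall>K\<in>blocks. regular_at (J K) z)"
    by (rule generically_on_ball) (use JK(2) in auto)
  ultimately show ?thesis
    unfolding residue_along_def using XI(2) by (intro generically_on_conj)
qed

end

theorem mainTheorem10:
  fixes G :: "('v::finite, 'e::finite) multigraph"
    and \<alpha>' :: real
    and S :: "'v set"
    and a :: 'v
    and D :: "'e \<Rightarrow> 'v set"
    and I :: "('v, 'e) energies \<Rightarrow> complex"
    and J :: "'v set \<Rightarrow> ('v, 'e) energies \<Rightarrow> complex"
  assumes "loopless_multigraph G"
    and "connected_graph G"
    and "\<alpha>' > 0"
    and "S \<subseteq> verts G" and "S \<noteq> {}"
    and "is_tree (induced G S)"
    and "a \<in> S"
    and "\<And>e. e \<in> edges (induced G S) \<Longrightarrow> conn_components (delete_edge (induced G S) e) = {D e, S - D e}"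
    and "mero_continuation UNIV (positive_energies G) (zono_integral G \<alpha>') I"
    and "\<And>K. K \<in> conn_components (induced G (verts G - S)) \<Longrightarrow>
           mero_continuation UNIV (J_domain G \<alpha>' S K) (J_integral G \<alpha>' S K) (J K)"
  shows "mero_continuation (Xplane G S) (Xplane G S \<inter> C_domain G \<alpha>' S a)
           (C_integral G \<alpha>' S a) (beta_product G \<alpha>' S D) \<and>
         generically_on (Xplane G S) (\<lambda>z.
           regular_at (\<lambda>w. Xsum G S w * I w) z \<and>
           (\<forall>K\<in>conn_components (induced G (verts G - S)). regular_at (J K) z) \<and>
           residue_along (Xsum G S) I z =
             2 * (\<Prod>K\<in>conn_components (induced G (verts G - S)). mero_value (J K) z) * beta_product G \<alpha>' S D z)"
proof -
  interpret tree_block G \<alpha>' S a D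
    using assms(1-8) by unfold_locales (auto simp: is_tree_def)
  \<comment> \<open>The prescribed values have to be met on the whole domain of convergence in the
    hyperplane; \<open>C_integral_beta\<close> achieves this because it takes integrability as its
    only convergence hypothesis.\<close>
  have "mero_continuation (Xplane G S) (Xplane G S \<inter> C_domain G \<alpha>' S a)
      (C_integral G \<alpha>' S a) (beta_product G \<alpha>' S D)"
    unfolding mero_continuation_def using mero_on_beta_product C_integral_beta by auto
  then show ?thesis
    using residue_formula[OF assms(9), of J] assms(10) unfolding blocks_def by blast
qed

end
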